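(* Let $\Gamma$ be a locally compact Hausdorff group, let $\Lambda\subseteq\Gamma$ be a closed subgroup that almost commutes with compacts, let $n\in\mathbb{N}$, and let $\chi\colon\Gamma\to\mathbb{R}$ be a character that vanishes on $\Lambda$. If $\Lambda$ is of type $\mathrm{C}_n$, then: (1) For every $k\le n$, if the filtration $(\Gamma_\chi\cdot\operatorname{E}F)_{F\in\mathcal{C}(\Gamma/\Lambda)}$ of $\operatorname{E}(\Gamma/\Lambda)$ is essentially $(k-1)$-connected, then $\chi\in\Sigma^k_{\mathrm{top}}(\Gamma)$. (2) For every $k\le n+1$, if $\chi\in\Sigma^k_{\mathrm{top}}(\Gamma)$, then the filtration $(\Gamma_\chi\cdot\operatorname{E}F)_{F\in\mathcal{C}(\Gamma/\Lambda)}$ is essentially $(k-1)$-connected.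
   Context: Conventions: $\mathbb{N}$ includes $0$; $k$ ranges over natural numbers; $\Gamma/\Lambda$ is the space of left cosets with the quotient topology and the left multiplication action of $\Gamma$; $\Lambda$ carries the subspace topology. A closed subgroup $\Lambda$ of a locally compact Hausdorff group $\Gamma$ almost commutes with compacts if for every compact $C\subseteq\Gamma$ there is a compact $C'\subseteq\Gamma$ with $C\Lambda\subseteq\Lambda C'$ and $\Lambda C\subseteq C'\Lambda$. For a set $X$, $\operatorname{E}X$ is the simplicial set whose $k$-simplices are the tuples $(x_0,\dots,x_k)\in X^{k+1}$, the $i$-th face (degeneracy) map deleting (doubling) the $i$-th entry; a group action on $X$ induces one on $\operatorname{E}X$. For a topological space $X$, $\mathcal{C}(X)$ is the poset of compact subspaces of $X$ ordered by inclusion. A filtration of a simplicial set $Y$ over a directed poset $A$ is a family of simplicial subsets $(Y_\alpha)_{\alpha\in A}$ with union $Y$ and $Y_\alpha\subseteq Y_\beta$ for $\alpha\le\beta$. For $Y$ connected, it is essentially $m$-connected if for some (equivalently every) vertex $y$ of $Y$, for all $0\le k\le m$ and every $\alpha$ with $y\in Y_\alpha$ there is $\beta\ge\alpha$ such that $\pi_k(|Y_\alpha|,y)\to\pi_k(|Y_\beta|,y)$ is trivial (vacuous for $m=-1$). For a locally compact Hausdorff group $G$, a character is a continuous homomorphism $\chi\colon G\to\mathbb{R}$, and $G_\chi=\chi^{-1}([0,+\infty))$. If $G$ acts on a set $X$ and $C\subseteq X$, then $G_\chi\cdot\operatorname{E}C=\bigcup_{g\in G_\chi}g\cdot\operatorname{E}C\subseteq\operatorname{E}X$.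 By definition $\chi\in\Sigma^k_{\mathrm{top}}(G)$ iff the filtration $(G_\chi\cdot\operatorname{E}C)_{C\in\mathcal{C}(G)}$ of $\operatorname{E}G$ (with $G$ acting on itself by left multiplication) is essentially $(k-1)$-connected. $G$ is of type $\mathrm{C}_n$ if $(G\cdot\operatorname{E}C)_{C\in\mathcal{C}(G)}$ is essentially $(n-1)$-connected. *)

theory Defs
  imports "HOL-Analysis.Analysis" "HOL-Homology.Homology" "HOL-Algebra.Left_Coset"
begin

section \<open>Quotient topologies\<close>

definition quotient_topology :: "'a topology \<Rightarrow> ('a \<Rightarrow> 'b) \<Rightarrow> 'b topology" where
  "quotient_topology X q =
     topology (\<lambda>U. U \<subseteq> q ` topspace X \<and> openin X {x \<in> topspace X. q x \<in> U})"

lemma openin_quotient_topology: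
  "openin (quotient_topology X q) U \<longleftrightarrow>
     U \<subseteq> q ` topspace X \<and> openin X {x \<in> topspace X. q x \<in> U}"
proof -
  have "istopology (\<lambda>U. U \<subseteq> q ` topspace X \<and> openin X {x \<in> topspace X. q x \<in> U})"
    unfolding istopology_def
  proof (intro conjI allI impI)
    fix S U
    assume "S \<subseteq> q ` topspace X \<and> openin X {x \<in> topspace X. q x \<in> S}"
      and "U \<subseteq> q ` topspace X \<and> openin X {x \<in> topspace X. q x \<in> U}"
    moreover have "{x \<in> topspace X. q x \<in> S \<inter> U} =
        {x \<in> topspace X. q x \<in> S} \<inter> {x \<in> topspace X. q x \<in> U}"
      by auto
    ultimately show "S \<inter> U \<subseteq> q ` topspace X" "openin X {x \<in> topspace X. q x \<in> S \<inter> U}"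
      by auto
  next
    fix K
    assume K: "\<forall>U\<in>K. U \<subseteq> q ` topspace X \<and> openin X {x \<in> topspace X. q x \<in> U}"
    have "{x \<in> topspace X. q x \<in> \<Union>K} = (\<Union>U\<in>K. {x \<in> topspace X. q x \<in> U})"
      by auto
    then show "openin X {x \<in> topspace X. q x \<in> \<Union>K}"
      using K by auto
    show "\<Union>K \<subseteq> q ` topspace X"
      using K by auto
  qed
  then show ?thesis
    by (simp add: quotient_topology_def)
qed

lemma topspace_quotient_topology [simp]:
  "topspace (quotient_topology X q) = q ` topspace X"
proof -
  have "openin (quotient_topology X q) (q ` topspace X)"
    by (simp add: openin_quotient_topology Collect_conj_eq Int_absorb2 image_eqI subsetI)
  then show ?thesis
    by (metis openin_quotient_topology openin_subset openin_topspace subset_antisym)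
qed

lemma quotient_map_quotient_topology: "quotient_map X (quotient_topology X q) q"
  by (auto simp: quotient_map_def openin_quotient_topology)

section \<open>Simplicial sets and geometric realization\<close>

text \<open>
  The faces with target dimension \<open>k\<close> are \<open>face Y k i : Y\<^sub>k\<^sub>+\<^sub>1 \<rightarrow> Y\<^sub>k\<close> for \<open>i \<le> k + 1\<close>,
  the degeneracies with source dimension \<open>k\<close> are \<open>degen Y k i : Y\<^sub>k \<rightarrow> Y\<^sub>k\<^sub>+\<^sub>1\<close> for \<open>i \<le> k\<close>.
\<close>

record 's simplicial_data =
  simplices :: "nat \<Rightarrow> 's set"
  face :: "nat \<Rightarrow> nat \<Rightarrow> 's \<Rightarrow> 's"
  degen :: "nat \<Rightarrow> nat \<Rightarrow> 's \<Rightarrow> 's"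

definition simplicial_set :: "'s simplicial_data \<Rightarrow> bool" where
  "simplicial_set Y \<longleftrightarrow>
     (\<forall>k. \<forall>x\<in>simplices Y (Suc k). \<forall>i\<le>Suc k. face Y k i x \<in> simplices Y k) \<and>
     (\<forall>k. \<forall>x\<in>simplices Y k. \<forall>i\<le>k. degen Y k i x \<in> simplices Y (Suc k)) \<and>
     (\<forall>k. \<forall>x\<in>simplices Y (Suc (Suc k)). \<forall>j\<le>Suc (Suc k). \<forall>i<j.
        face Y k i (face Y (Suc k) j x) = face Y k (j - 1) (face Y (Suc k) i x)) \<and>
     (\<forall>k. \<forall>x\<in>simplices Y k. \<forall>j\<le>k. \<forall>i\<le>j.
        degen Y (Suc k) i (degen Y k j x) = degen Y (Suc k) (Suc j) (degen Y k i x)) \<and>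
     (\<forall>k. \<forall>x\<in>simplices Y (Suc k). \<forall>j\<le>Suc k. \<forall>i<j.
        face Y (Suc k) i (degen Y (Suc k) j x) = degen Y k (j - 1) (face Y k i x)) \<and>
     (\<forall>k. \<forall>x\<in>simplices Y k. \<forall>j\<le>k.
        face Y k j (degen Y k j x) = x \<and> face Y k (Suc j) (degen Y k j x) = x) \<and>
     (\<forall>k. \<forall>x\<in>simplices Y (Suc k). \<forall>j\<le>k. \<forall>i\<le>Suc (Suc k). Suc j < i \<longrightarrow>
        face Y (Suc k) i (degen Y (Suc k) j x) = degen Y k j (face Y k (i - 1) x))"

definition simplicial_subset :: "'s simplicial_data \<Rightarrow> 's simplicial_data \<Rightarrow> bool" where
  "simplicial_subset Z Y \<longleftrightarrow>
     simplicial_set Z \<and> (\<forall>k. simplices Z k \<subseteq> simplices Y k) \<and> face Z = face Y \<and> degen Z = degen Y"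

definition cosimplicial_degen :: "nat \<Rightarrow> (nat \<Rightarrow> real) \<Rightarrow> nat \<Rightarrow> real" where
  "cosimplicial_degen i t =
     (\<lambda>j. if j < i then t j else if j = i then t i + t (Suc i) else t (Suc j))"

definition realization_sum :: "'s simplicial_data \<Rightarrow> (nat \<times> 's \<times> (nat \<Rightarrow> real)) topology" where
  "realization_sum Y =
     sum_topology
       (\<lambda>k. prod_topology (discrete_topology (simplices Y k))
              (subtopology (powertop_real UNIV) (standard_simplex k)))
       UNIV"

text \<open>
  The generating identifications \<open>(d\<^sub>i x, t) \<sim> (x, \<delta>\<^sup>i t)\<close> and \<open>(s\<^sub>i x, t) \<sim> (x, \<sigma>\<^sup>i t)\<close>;
  the library's \<^const>\<open>simplical_face\<close> is the coface map \<open>\<delta>\<^sup>i\<close>.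
\<close>

definition realization_glue ::
  "'s simplicial_data \<Rightarrow> ((nat \<times> 's \<times> (nat \<Rightarrow> real)) \<times> (nat \<times> 's \<times> (nat \<Rightarrow> real))) set" where
  "realization_glue Y =
     {((k, face Y k i x, t), (Suc k, x, simplical_face i t)) | k i x t.
        x \<in> simplices Y (Suc k) \<and> i \<le> Suc k \<and> t \<in> standard_simplex k} \<union>
     {((Suc k, degen Y k i x, t), (k, x, cosimplicial_degen i t)) | k i x t.
        x \<in> simplices Y k \<and> i \<le> k \<and> t \<in> standard_simplex (Suc k)}"

definition realization_rel ::
  "'s simplicial_data \<Rightarrow> ((nat \<times> 's \<times> (nat \<Rightarrow> real)) \<times> (nat \<times> 's \<times> (nat \<Rightarrow> real))) set" where
  "realization_rel Y = (realization_glue Y \<union> (realization_glue Y)\<inverse>)\<^sup>*"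

text \<open>Points of the realization are the equivalence classes.\<close>

definition realization :: "'s simplicial_data \<Rightarrow> (nat \<times> 's \<times> (nat \<Rightarrow> real)) set topology" where
  "realization Y = quotient_topology (realization_sum Y) (\<lambda>p. realization_rel Y `` {p})"

definition realization_vertex ::
  "'s simplicial_data \<Rightarrow> 's \<Rightarrow> (nat \<times> 's \<times> (nat \<Rightarrow> real)) set" where
  "realization_vertex Y y = realization_rel Y `` {(0, y, \<lambda>i. if i = 0 then 1 else 0)}"

text \<open>
  If \<open>Z\<close> is a simplicial subset of \<open>Y\<close>, the map \<open>|Z| \<rightarrow> |Y|\<close> induced by the inclusion sends a
  class for \<open>Z\<close> to the class for \<open>Y\<close> containing it, that is, to its saturation.
\<close>

definition realization_inclusion ::
  "'s simplicial_data \<Rightarrow> (nat \<times> 's \<times> (nat \<Rightarrow> real)) set \<Rightarrow> (nat \<times> 's \<times> (nat \<Rightarrow> real)) set" where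
  "realization_inclusion Y c = realization_rel Y `` c"

section \<open>Homotopy groups\<close>

text \<open>
  \<open>\<pi>\<^sub>k\<close> as a pointed set, with elements the based homotopy classes of based maps from the
  \<open>k\<close>-sphere, and distinguished element the class of the constant map. The group structure is
  irrelevant for whether an induced map is trivial.
\<close>

definition sphere_base :: "nat \<Rightarrow> real" where
  "sphere_base = (\<lambda>i. if i = 0 then 1 else 0)"

definition homotopy_class ::
  "nat \<Rightarrow> 'a topology \<Rightarrow> 'a \<Rightarrow> ((nat \<Rightarrow> real) \<Rightarrow> 'a) \<Rightarrow> ((nat \<Rightarrow> real) \<Rightarrow> 'a) set" where
  "homotopy_class k X x f =
     {g. homotopic_with (\<lambda>h. h sphere_base = x) (nsphere k) X f g}"

definition homotopy_group :: "nat \<Rightarrow> 'a topology \<Rightarrow> 'a \<Rightarrow> ((nat \<Rightarrow> real) \<Rightarrow> 'a) set set" where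
  "homotopy_group k X x =
     homotopy_class k X x ` {f. continuous_map (nsphere k) X f \<and> f sphere_base = x}"

definition homotopy_group_map ::
  "nat \<Rightarrow> 'b topology \<Rightarrow> 'b \<Rightarrow> ('a \<Rightarrow> 'b) \<Rightarrow> ((nat \<Rightarrow> real) \<Rightarrow> 'a) set \<Rightarrow> ((nat \<Rightarrow> real) \<Rightarrow> 'b) set" where
  "homotopy_group_map k X' x' j c = (\<Union>f\<in>c. homotopy_class k X' x' (j \<circ> f))"

definition trivial_on_homotopy_group ::
  "nat \<Rightarrow> 'a topology \<Rightarrow> 'a \<Rightarrow> 'b topology \<Rightarrow> ('a \<Rightarrow> 'b) \<Rightarrow> bool" where
  "trivial_on_homotopy_group k X x X' j \<longleftrightarrow>
     (\<forall>c\<in>homotopy_group k X x.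
        homotopy_group_map k X' (j x) j c = homotopy_class k X' (j x) (\<lambda>_. j x))"

section \<open>Filtrations\<close>

definition filtration ::
  "'s simplicial_data \<Rightarrow> 'i::order set \<Rightarrow> ('i \<Rightarrow> 's simplicial_data) \<Rightarrow> bool" where
  "filtration Y A F \<longleftrightarrow>
     A \<noteq> {} \<and> (\<forall>\<alpha>\<in>A. \<forall>\<beta>\<in>A. \<exists>\<gamma>\<in>A. \<alpha> \<le> \<gamma> \<and> \<beta> \<le> \<gamma>) \<and>
     (\<forall>\<alpha>\<in>A. simplicial_subset (F \<alpha>) Y) \<and>
     (\<forall>\<alpha>\<in>A. \<forall>\<beta>\<in>A. \<alpha> \<le> \<beta> \<longrightarrow> simplicial_subset (F \<alpha>) (F \<beta>)) \<and>
     (\<forall>k. (\<Union>\<alpha>\<in>A. simplices (F \<alpha>) k) = simplices Y k)"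

text \<open>Meaningful for filtrations of connected simplicial sets.\<close>

definition essentially_connected ::
  "int \<Rightarrow> 's simplicial_data \<Rightarrow> 'i::order set \<Rightarrow> ('i \<Rightarrow> 's simplicial_data) \<Rightarrow> bool" where
  "essentially_connected m Y A F \<longleftrightarrow>
     (\<exists>y\<in>simplices Y 0. \<forall>k::nat. int k \<le> m \<longrightarrow>
        (\<forall>\<alpha>\<in>A. y \<in> simplices (F \<alpha>) 0 \<longrightarrow>
           (\<exists>\<beta>\<in>A. \<alpha> \<le> \<beta> \<and>
              trivial_on_homotopy_group k
                (realization (F \<alpha>)) (realization_vertex (F \<alpha>) y)
                (realization (F \<beta>)) (realization_inclusion (F \<beta>)))))"

section \<open>The simplicial set of tuples\<close>

text \<open>A \<open>k\<close>-simplex is a list of length \<open>k + 1\<close>.\<close>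

definition simplicial_E :: "'x set \<Rightarrow> 'x list simplicial_data" where
  "simplicial_E X =
     \<lparr>simplices = (\<lambda>k. {xs. length xs = Suc k \<and> set xs \<subseteq> X}),
      face = (\<lambda>k i xs. take i xs @ drop (Suc i) xs),
      degen = (\<lambda>k i xs. take (Suc i) xs @ drop i xs)\<rparr>"

definition translates_E :: "('g \<Rightarrow> 'x \<Rightarrow> 'x) \<Rightarrow> 'g set \<Rightarrow> 'x set \<Rightarrow> 'x list simplicial_data" where
  "translates_E \<phi> S C =
     (simplicial_E C)\<lparr>simplices := \<lambda>k. \<Union>g\<in>S. map (\<phi> g) ` simplices (simplicial_E C) k\<rparr>"

definition compacts :: "'x topology \<Rightarrow> 'x set set" where
  "compacts X = {C. compactin X C}"

lemma nth_delete:
  "i < length xs \<Longrightarrow> Suc j < length xs \<Longrightarrow>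
     (take i xs @ drop (Suc i) xs) ! j = xs ! (if j < i then j else Suc j)"
  by (auto simp: nth_append)

lemma nth_double:
  "i < length xs \<Longrightarrow> j \<le> length xs \<Longrightarrow>
     (take (Suc i) xs @ drop i xs) ! j = xs ! (if j \<le> i then j else j - 1)"
  by (auto simp: nth_append min_def intro!: arg_cong[where f = "(!) xs"])

lemma length_delete: "i < length xs \<Longrightarrow> length (take i xs @ drop (Suc i) xs) = length xs - 1"
  by simp

lemma length_double: "i < length xs \<Longrightarrow> length (take (Suc i) xs @ drop i xs) = Suc (length xs)"
  unfolding length_append length_take length_drop by arith

lemma simplicial_set_E_closed:
  assumes len: "\<And>k xs. xs \<in> P k \<Longrightarrow> length xs = Suc k"
    and f: "\<And>k xs i. xs \<in> P (Suc k) \<Longrightarrow> i \<le> Suc k \<Longrightarrow> take i xs @ drop (Suc i) xs \<in> P k"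
    and d: "\<And>k xs i. xs \<in> P k \<Longrightarrow> i \<le> k \<Longrightarrow> take (Suc i) xs @ drop i xs \<in> P (Suc k)"
  shows "simplicial_set ((simplicial_E X)\<lparr>simplices := P\<rparr>)"
  unfolding simplicial_set_def simplicial_E_def simplicial_data.simps simplicial_data.update_convs
proof (intro conjI allI ballI impI, goal_cases)
  case (1 k x i) then show ?case using f by blast
next
  case (2 k x i) then show ?case using d by blast
next
  case (3 k x j i)
  then have "length x = Suc (Suc (Suc k))" using len by blast
  moreover obtain m where "j = Suc m" using 3 by (cases j) auto
  ultimately show ?case using 3
    by (intro nth_equalityI) (auto simp: simplicial_data.simps nth_delete nth_double length_delete length_double not_less not_le
      simp del: take_append drop_append append_take_drop_id length_append length_take length_drop
      intro!: arg_cong[where f = "(!) x"])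
next
  case (4 k x j i)
  then have "length x = Suc k" using len by blast
  with 4 show ?case
    by (intro nth_equalityI) (auto simp: simplicial_data.simps nth_delete nth_double length_delete length_double not_less not_le
      simp del: take_append drop_append append_take_drop_id length_append length_take length_drop
      intro!: arg_cong[where f = "(!) x"])
next
  case (5 k x j i)
  then have "length x = Suc (Suc k)" using len by blast
  moreover obtain m where "j = Suc m" using 5 by (cases j) auto
  ultimately show ?case using 5
    by (intro nth_equalityI) (auto simp: simplicial_data.simps nth_delete nth_double length_delete length_double not_less not_le
      simp del: take_append drop_append append_take_drop_id length_append length_take length_drop
      intro!: arg_cong[where f = "(!) x"])
next
  case (6 k x j)
  then have "length x = Suc k" using len by blast
  with 6 show ?case
    by (intro nth_equalityI) (auto simp: simplicial_data.simps nth_delete nth_double length_delete length_double not_less not_le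
      simp del: take_append drop_append append_take_drop_id length_append length_take length_drop
      intro!: arg_cong[where f = "(!) x"])
next
  case (7 k x j)
  then have "length x = Suc k" using len by blast
  with 7 show ?case
    by (intro nth_equalityI) (auto simp: simplicial_data.simps nth_delete nth_double length_delete length_double not_less not_le
      simp del: take_append drop_append append_take_drop_id length_append length_take length_drop
      intro!: arg_cong[where f = "(!) x"])
next
  case (8 k x j i)
  then have "length x = Suc (Suc k)" using len by blast
  moreover obtain m where "i = Suc m" using 8 by (cases i) auto
  ultimately show ?case using 8
    by (intro nth_equalityI) (auto simp: simplicial_data.simps nth_delete nth_double length_delete length_double not_less not_le
      simp del: take_append drop_append append_take_drop_id length_append length_take length_drop
      intro!: arg_cong[where f = "(!) x"])
qed

lemma filtration_translates_E:
  assumes S: "\<And>g. g \<in> S \<Longrightarrow> \<phi> g ` topspace X \<subseteq> topspace X"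
    and e: "e \<in> S" "\<And>x. x \<in> topspace X \<Longrightarrow> \<phi> e x = x"
  shows "filtration (simplicial_E (topspace X)) (compacts X) (translates_E \<phi> S)"
proof -
  have mem: "xs \<in> simplices (translates_E \<phi> S C) k \<longleftrightarrow>
      (\<exists>g\<in>S. \<exists>ys. xs = map (\<phi> g) ys \<and> length ys = Suc k \<and> set ys \<subseteq> C)" for xs C k
    by (auto simp: translates_E_def simplicial_E_def)
  have 1: "simplicial_set (translates_E \<phi> S C)" for C
    unfolding translates_E_def
  proof (rule simplicial_set_E_closed, goal_cases)
    case (1 k xs)
    then show ?case by (auto simp: simplicial_E_def)
  next
    case (2 k xs i)
    then obtain g ys where *: "g \<in> S" "xs = map (\<phi> g) ys" "length ys = Suc (Suc k)" "set ys \<subseteq> C"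
      by (auto simp: simplicial_E_def)
    have "take i xs @ drop (Suc i) xs = map (\<phi> g) (take i ys @ drop (Suc i) ys)"
      by (simp add: * take_map drop_map)
    moreover have "set (take i ys @ drop (Suc i) ys) \<subseteq> C"
      using *(4) set_take_subset[of i ys] set_drop_subset[of "Suc i" ys] by auto
    moreover have "length (take i ys @ drop (Suc i) ys) = Suc k"
      using * 2 by auto
    ultimately show ?case
      using *(1) by (auto simp: simplicial_E_def simp del: map_append set_append length_append)
  next
    case (3 k xs i)
    then obtain g ys where *: "g \<in> S" "xs = map (\<phi> g) ys" "length ys = Suc k" "set ys \<subseteq> C"
      by (auto simp: simplicial_E_def)
    have "take (Suc i) xs @ drop i xs = map (\<phi> g) (take (Suc i) ys @ drop i ys)"
      by (simp add: * take_map drop_map)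
    moreover have "set (take (Suc i) ys @ drop i ys) \<subseteq> C"
      using *(4) set_take_subset[of "Suc i" ys] set_drop_subset[of i ys] by auto
    moreover have "length (take (Suc i) ys @ drop i ys) = Suc (Suc k)"
      using * 3 by auto
    ultimately show ?case
      using *(1) by (auto simp: simplicial_E_def simp del: map_append set_append length_append)
  qed
  have fd: "face (translates_E \<phi> S C) = face (simplicial_E D)"
    "degen (translates_E \<phi> S C) = degen (simplicial_E D)" for C D
    by (simp_all add: translates_E_def simplicial_E_def)
  have sub: "simplices (translates_E \<phi> S C) k \<subseteq> simplices (simplicial_E (topspace X)) k"
    if "C \<in> compacts X" for C k
  proof -
    have "C \<subseteq> topspace X"
      using that by (simp add: compacts_def compactin_subset_topspace)
    then show ?thesis
      using S by (fastforce simp: mem simplicial_E_def)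
  qed
  have exh: "xs \<in> (\<Union>C\<in>compacts X. simplices (translates_E \<phi> S C) k)"
    if "xs \<in> simplices (simplicial_E (topspace X)) k" for xs k
  proof -
    have xs: "length xs = Suc k" "set xs \<subseteq> topspace X"
      using that by (auto simp: simplicial_E_def)
    have "map (\<phi> e) xs = xs"
      using xs e(2) by (intro map_idI) auto
    then have "xs \<in> simplices (translates_E \<phi> S (set xs)) k"
      unfolding mem using e(1) xs by (intro bexI[of _ e] exI[of _ xs]) auto
    moreover have "set xs \<in> compacts X"
      using xs by (simp add: compacts_def finite_imp_compactin)
    ultimately show ?thesis
      by blast
  qed
  show ?thesis
    unfolding filtration_def simplicial_subset_def
  proof (intro conjI ballI allI impI)
    show "compacts X \<noteq> {}"
      by (metis compactin_empty compacts_def empty_Collect_eq)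
    show "\<exists>\<gamma>\<in>compacts X. \<alpha> \<le> \<gamma> \<and> \<beta> \<le> \<gamma>" if "\<alpha> \<in> compacts X" "\<beta> \<in> compacts X" for \<alpha> \<beta>
      using that compactin_Un[of X \<alpha> \<beta>] by (intro bexI[of _ "\<alpha> \<union> \<beta>"]) (auto simp: compacts_def)
    show "simplices (translates_E \<phi> S \<alpha>) k \<subseteq> simplices (translates_E \<phi> S \<beta>) k"
      if "\<alpha> \<le> \<beta>" for \<alpha> \<beta> k
      using that by (fastforce simp: mem)
    show "(\<Union>\<alpha>\<in>compacts X. simplices (translates_E \<phi> S \<alpha>) k) =
        simplices (simplicial_E (topspace X)) k" for k
      using sub exh by blast
    show "simplices (translates_E \<phi> S \<alpha>) k \<subseteq> simplices (simplicial_E (topspace X)) k"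
      if "\<alpha> \<in> compacts X" for \<alpha> k
      using that by (rule sub)
  qed (use 1 fd in \<open>auto simp: translates_E_def simplicial_E_def\<close>)
qed

section \<open>Topological groups\<close>

locale topological_group = group G for G (structure) +
  fixes T :: "'a topology"
  assumes topspace_eq: "topspace T = carrier G"
    and continuous_mult: "continuous_map (prod_topology T T) T (\<lambda>(x, y). x \<otimes> y)"
    and continuous_inv: "continuous_map T T (\<lambda>x. inv x)"

definition locally_compact_Hausdorff_group :: "('a, 'b) monoid_scheme \<Rightarrow> 'a topology \<Rightarrow> bool" where
  "locally_compact_Hausdorff_group G T \<longleftrightarrow>
     topological_group G T \<and> locally_compact_space T \<and> Hausdorff_space T"

definition almost_commutes_with_compacts ::
  "('a, 'b) monoid_scheme \<Rightarrow> 'a topology \<Rightarrow> 'a set \<Rightarrow> bool" where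
  "almost_commutes_with_compacts G T \<Lambda> \<longleftrightarrow>
     (\<forall>C. compactin T C \<longrightarrow>
        (\<exists>C'. compactin T C' \<and> C <#>\<^bsub>G\<^esub> \<Lambda> \<subseteq> \<Lambda> <#>\<^bsub>G\<^esub> C' \<and> \<Lambda> <#>\<^bsub>G\<^esub> C \<subseteq> C' <#>\<^bsub>G\<^esub> \<Lambda>))"

text \<open>The space of left cosets; its underlying set is \<open>lcosets \<Lambda>\<close>.\<close>

definition coset_space :: "('a, 'b) monoid_scheme \<Rightarrow> 'a topology \<Rightarrow> 'a set \<Rightarrow> 'a set topology" where
  "coset_space G T \<Lambda> = quotient_topology T (\<lambda>g. g <#\<^bsub>G\<^esub> \<Lambda>)"

definition character :: "('a, 'b) monoid_scheme \<Rightarrow> 'a topology \<Rightarrow> ('a \<Rightarrow> real) \<Rightarrow> bool" where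
  "character G T chi \<longleftrightarrow>
     continuous_map T euclideanreal chi \<and>
     (\<forall>x\<in>carrier G. \<forall>y\<in>carrier G. chi (x \<otimes>\<^bsub>G\<^esub> y) = chi x + chi y)"

definition nonneg_part :: "('a, 'b) monoid_scheme \<Rightarrow> ('a \<Rightarrow> real) \<Rightarrow> 'a set" where
  "nonneg_part G chi = {g \<in> carrier G. 0 \<le> chi g}"

definition Sigma_top ::
  "nat \<Rightarrow> ('a, 'b) monoid_scheme \<Rightarrow> 'a topology \<Rightarrow> ('a \<Rightarrow> real) set" where
  "Sigma_top k G T =
     {chi. character G T chi \<and>
         essentially_connected (int k - 1) (simplicial_E (topspace T)) (compacts T)
           (translates_E (mult G) (nonneg_part G chi))}"

definition type_C :: "nat \<Rightarrow> ('a, 'b) monoid_scheme \<Rightarrow> 'a topology \<Rightarrow> bool" where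
  "type_C n G T \<longleftrightarrow>
     essentially_connected (int n - 1) (simplicial_E (topspace T)) (compacts T)
       (translates_E (mult G) (carrier G))"

text \<open>The families used below are indeed filtrations.\<close>

lemma character_one:
  assumes "group G" "character G T chi"
  shows "chi \<one>\<^bsub>G\<^esub> = 0"
proof -
  interpret group G by fact
  have "chi (\<one>\<^bsub>G\<^esub> \<otimes>\<^bsub>G\<^esub> \<one>\<^bsub>G\<^esub>) = chi \<one>\<^bsub>G\<^esub> + chi \<one>\<^bsub>G\<^esub>"
    using assms(2) by (simp only: character_def one_closed)
  then show ?thesis by simp
qed

lemma filtration_group:
  assumes "topological_group G T" "S \<subseteq> carrier G" "\<one>\<^bsub>G\<^esub> \<in> S"
  shows "filtration (simplicial_E (topspace T)) (compacts T) (translates_E (mult G) S)"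
proof -
  interpret topological_group G T by fact
  show ?thesis
    using assms(2,3) by (intro filtration_translates_E[where e = "\<one>\<^bsub>G\<^esub>"]) (auto simp: topspace_eq)
qed

lemma filtration_coset_space:
  assumes "topological_group G T" "subgroup \<Lambda> G" "S \<subseteq> carrier G" "\<one>\<^bsub>G\<^esub> \<in> S"
  shows "filtration (simplicial_E (topspace (coset_space G T \<Lambda>))) (compacts (coset_space G T \<Lambda>))
           (translates_E (l_coset G) S)"
proof -
  interpret topological_group G T by fact
  have \<Lambda>: "\<Lambda> \<subseteq> carrier G"
    using assms(2) by (rule subgroup.subset)
  show ?thesis
  proof (rule filtration_translates_E[where e = "\<one>\<^bsub>G\<^esub>"])
    show "l_coset G g ` topspace (coset_space G T \<Lambda>) \<subseteq> topspace (coset_space G T \<Lambda>)"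
      if "g \<in> S" for g
      using that assms(3) \<Lambda> by (auto simp: coset_space_def topspace_eq lcos_m_assoc)
    show "\<one>\<^bsub>G\<^esub> <#\<^bsub>G\<^esub> x = x" if "x \<in> topspace (coset_space G T \<Lambda>)" for x
      using that \<Lambda> by (auto simp: coset_space_def topspace_eq lcos_m_assoc)
  qed (rule assms(4))
qed

end

theory Submission
  imports Defs
begin

text \<open>
  A point of the realization of a simplicial set of tuples \<open>(x\<^sub>0, \<dots>, x\<^sub>k)\<close>, where membership
  depends only on the set of entries, has a unique normal form, a list of vertices with positive
  weights. In these terms a simplicial subset becomes a subspace, and essential connectedness
  says that every sphere in the translates of \<open>E C\<close> bounds a cube in the translates of
  some larger \<open>E C'\<close>, without reference to base points.

  Let \<open>F\<close> be the image in \<open>\<Gamma> / \<Lambda>\<close> of a compact set \<open>C\<close>. For a map of a cube into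
  \<open>\<Gamma>\<^sub>\<chi> \<cdot> E F\<close> choose for each point \<open>x\<close> an element \<open>\<gamma> x\<close> of \<open>\<Gamma>\<^sub>\<chi>\<close> such that the
  image of \<open>x\<close> lies in \<open>\<gamma> x \<cdot> E F\<close>. On a fine grid each cell is mapped into the
  open star of a vertex, so the translates \<open>\<gamma> x F\<close> and \<open>\<gamma> y F\<close> meet if \<open>x\<close> and \<open>y\<close> lie in a
  common cell. Since \<open>\<Lambda>\<close> almost commutes with compacts, \<open>\<gamma> y \<Lambda>\<close> is then contained in \<open>\<gamma> x \<Lambda> E\<close> for a
  fixed compact \<open>E\<close>. As \<open>\<Lambda>\<close> is of type \<open>C\<^sub>n\<close> and is contained in the kernel of \<open>\<chi>\<close>, the map can be lifted,
  skeleton by skeleton up to dimension \<open>n\<close>, to \<open>\<Gamma>\<^sub>\<chi> \<cdot> E D\<close> with \<open>D\<close> compact. Lifting a cube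
  relative to its boundary gives (1). Lifting a sphere, filling the lift and projecting the
  filling gives (2), because the projection of the lift is homotopic to the original sphere.
\<close>

section \<open>Normal forms of points of the realization\<close>

text \<open>The order of quantifiers shapes the proof: the compact set of the filling may depend on
  \<open>C\<close> only, while the mesh of the grid depends on the individual sphere. The choice
  \<gamma> is not continuous, so comparing lifts along chains of cells would give a bound that grows
  with the grid. Instead each cell has its own centre, the value of \<gamma> at one chosen point of
  it. Passing from one centre to another inside a cell costs one left factor \<open>E\<close>, and
  this price is paid once per dimension, not once per cell. The two ranges of degrees are dimensions
  of what is lifted. For a k-sphere, (1) lifts a filling of dimension k + 1, so k < n; (2) lifts
  only the sphere, so k \<le> n. The two halves of almost commuting have separate tasks. C\<Lambda>
  \<subseteq> \<Lambda>C' compares neighbouring translates (\<open>transition\<close>). \<Lambda>C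
  \<subseteq> C'\<Lambda> bounds the image in \<Gamma>/\<Lambda> of a set lying in g\<Lambda>B by
  one translate g \<cdot> F (\<open>compact_near_proj\<close>). Cubical grids take the place of
  simplicial approximation: the maps stay merely continuous, and only the supports of their values
  are controlled.\<close>

fun wcons :: "'x \<times> real \<Rightarrow> ('x \<times> real) list \<Rightarrow> ('x \<times> real) list" where
  "wcons (v, a) [] = (if a = 0 then [] else [(v, a)])"
| "wcons (v, a) ((w, b) # l) =
     (if a = 0 then (w, b) # l else if v = w then (v, a + b) # l else (v, a) # (w, b) # l)"

text \<open>Dropping zero weights mirrors the face identifications, merging equal neighbours mirrors
  the degeneracy identifications. Only neighbours merge: (x, y, x) with x \<noteq> y is a
  nondegenerate simplex, so a point is an ordered list and not merely a weight function on
  vertices.\<close>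

definition wnorm :: "('x \<times> real) list \<Rightarrow> ('x \<times> real) list" where
  "wnorm l = foldr wcons l []"

definition wscale :: "('x \<Rightarrow> 'y) \<Rightarrow> real \<Rightarrow> ('x \<times> real) list \<Rightarrow> ('y \<times> real) list" where
  "wscale \<phi> c l = map (\<lambda>(v, a). (\<phi> v, c * a)) l"

definition nonneg_weights :: "('x \<times> real) list \<Rightarrow> bool" where
  "nonneg_weights l \<longleftrightarrow> (\<forall>e\<in>set l. 0 \<le> snd e)"

definition weight :: "'x \<Rightarrow> ('x \<times> real) list \<Rightarrow> real" where
  "weight v l = (\<Sum>e\<leftarrow>l. if fst e = v then snd e else 0)"

definition supp :: "('x \<times> real) list \<Rightarrow> 'x set" where
  "supp l = fst ` set l"

lemma wcons_0 [simp]: "wcons (v, 0) l = l"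
  by (cases l) auto

lemma wcons_0': "snd e = 0 \<Longrightarrow> wcons e l = l"
  by (cases e) simp

text \<open>Nonnegativity excludes weights that cancel: with weights 1 and -1 over the empty list
  the left side would keep a vertex of weight 0.\<close>

lemma wcons_add: "0 \<le> a \<Longrightarrow> 0 \<le> b \<Longrightarrow> wcons (v, a) (wcons (v, b) l) = wcons (v, a + b) l"
  by (cases l) (auto simp: add.assoc)

lemma wnorm_append: "wnorm (A @ B) = foldr wcons A (wnorm B)"
  by (simp add: wnorm_def)

lemma nonneg_weights_wcons: "0 \<le> snd e \<Longrightarrow> nonneg_weights l \<Longrightarrow> nonneg_weights (wcons e l)"
  by (induction e l rule: wcons.induct) (auto simp: nonneg_weights_def)

lemma nonneg_weights_wnorm: "nonneg_weights l \<Longrightarrow> nonneg_weights (wnorm l)"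
  by (induction l) (auto simp: wnorm_def nonneg_weights_def
      dest: nonneg_weights_wcons[unfolded nonneg_weights_def])

lemma pos_weights_wcons:
  "0 \<le> snd e \<Longrightarrow> \<forall>x\<in>set l. 0 < snd x \<Longrightarrow> \<forall>x\<in>set (wcons e l). 0 < snd x"
  by (induction e l rule: wcons.induct) auto

lemma pos_weights_wnorm: "nonneg_weights l \<Longrightarrow> \<forall>x\<in>set (wnorm l). 0 < snd x"
  by (induction l) (auto simp: wnorm_def nonneg_weights_def dest: pos_weights_wcons)

lemma foldr_wscale_wcons:
  assumes "0 \<le> c" "0 \<le> snd e" "nonneg_weights l"
  shows "foldr wcons (wscale \<phi> c (wcons e l)) B =
         wcons (\<phi> (fst e), c * snd e) (foldr wcons (wscale \<phi> c l) B)"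
  using assms
  by (induction e l rule: wcons.induct)
     (auto simp: wscale_def nonneg_weights_def wcons_add distrib_left)

lemma foldr_wscale_wnorm:
  assumes "0 \<le> c" "nonneg_weights l"
  shows "foldr wcons (wscale \<phi> c (wnorm l)) B = foldr wcons (wscale \<phi> c l) B"
  using assms(2)
proof (induction l)
  case (Cons e l)
  then have nn: "0 \<le> snd e" "nonneg_weights l"
    by (auto simp: nonneg_weights_def)
  have "foldr wcons (wscale \<phi> c (wnorm (e # l))) B =
      wcons (\<phi> (fst e), c * snd e) (foldr wcons (wscale \<phi> c (wnorm l)) B)"
    using foldr_wscale_wcons[OF assms(1) nn(1) nonneg_weights_wnorm[OF nn(2)]]
    by (simp add: wnorm_def)
  then show ?case
    using Cons.IH nn by (simp add: wscale_def case_prod_beta)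
qed (simp add: wnorm_def)

lemma wscale_id [simp]: "wscale id 1 l = l" "wscale (\<lambda>x. x) 1 l = l"
  by (simp_all add: wscale_def)

lemma foldr_wcons_wnorm: "nonneg_weights l \<Longrightarrow> foldr wcons (wnorm l) B = foldr wcons l B"
  using foldr_wscale_wnorm[of 1 l id] by simp

lemma wnorm_wnorm: "nonneg_weights l \<Longrightarrow> wnorm (wnorm l) = wnorm l"
  using foldr_wcons_wnorm[of l "[]"] by (simp add: wnorm_def)

lemma foldr_wcons_cong:
  "(\<And>i. i \<in> set is \<Longrightarrow> f i = g i \<or> snd (f i) = 0 \<and> snd (g i) = 0) \<Longrightarrow>
     foldr wcons (map f is) B = foldr wcons (map g is) B"
proof (induction "is")
  case (Cons i "is")
  then have IH: "foldr wcons (map f is) B = foldr wcons (map g is) B"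
    by simp
  consider "f i = g i" | "snd (f i) = 0" "snd (g i) = 0"
    using Cons.prems[of i] by auto
  then show ?case
    by cases (simp_all add: IH wcons_0')
qed simp

lemma weight_wcons: "weight v (wcons e l) = weight v (e # l)"
  by (induction e l rule: wcons.induct) (auto simp: weight_def)

lemma weight_wnorm: "weight v (wnorm l) = weight v l"
proof (induction l)
  case (Cons e l)
  then show ?case
    using weight_wcons[of v e "wnorm l"] by (simp add: wnorm_def weight_def)
qed (simp add: wnorm_def)

lemma total_weight_wcons: "sum_list (map snd (wcons e l)) = snd e + sum_list (map snd l)"
  by (induction e l rule: wcons.induct) auto

lemma total_weight_wnorm: "sum_list (map snd (wnorm l)) = sum_list (map snd l)"
proof (induction l)
  case (Cons e l)
  then show ?case
    using total_weight_wcons[of e "wnorm l"] by (simp add: wnorm_def)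
qed (simp add: wnorm_def)

lemma supp_wcons:
  "0 \<le> snd e \<Longrightarrow> supp (wcons e l) = (if snd e = 0 then supp l else insert (fst e) (supp l))"
  by (induction e l rule: wcons.induct) (auto simp: supp_def)

lemma supp_wnorm:
  "nonneg_weights l \<Longrightarrow> supp (wnorm l) = {fst e | e. e \<in> set l \<and> snd e \<noteq> 0}"
proof (induction l)
  case (Cons e l)
  then have "supp (wnorm (e # l)) =
      (if snd e = 0 then supp (wnorm l) else insert (fst e) (supp (wnorm l)))"
    using supp_wcons[of e "wnorm l"] by (simp add: wnorm_def nonneg_weights_def)
  with Cons show ?case
    by (cases e) (auto simp: nonneg_weights_def)
qed (simp add: wnorm_def supp_def)

lemma weight_pos_iff:
  assumes "\<forall>x\<in>set l. 0 < snd x"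
  shows "0 < weight v l \<longleftrightarrow> v \<in> supp l"
  using assms
proof (induction l)
  case (Cons e l)
  have "0 \<le> weight v l"
    using Cons.prems unfolding weight_def by (intro sum_list_nonneg) auto
  with Cons show ?case
    by (auto simp: weight_def supp_def)
qed (simp_all add: weight_def supp_def)

lemma wnorm_normal:
  assumes "\<forall>x\<in>set l. 0 < snd x" "distinct_adj (map fst l)"
  shows "wnorm l = l"
  using assms
proof (induction l)
  case (Cons e l)
  then have "wnorm l = l"
    by (cases l) (auto simp: wnorm_def)
  moreover have "wcons e l = e # l"
    using Cons.prems by (cases e; cases l) (auto simp: distinct_adj_Cons)
  ultimately show ?case
    by (simp add: wnorm_def)
qed (simp add: wnorm_def)

section \<open>Points of simplices and the gluing relation\<close>

definition weighted_tuple :: "nat \<Rightarrow> 'x list \<Rightarrow> (nat \<Rightarrow> real) \<Rightarrow> ('x \<times> real) list" where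
  "weighted_tuple k xs t = map (\<lambda>i. (xs ! i, t i)) [0..<Suc k]"

fun normal_form :: "nat \<times> 'x list \<times> (nat \<Rightarrow> real) \<Rightarrow> ('x \<times> real) list" where
  "normal_form (k, xs, t) = wnorm (weighted_tuple k xs t)"

definition full_complex :: "('x set \<Rightarrow> bool) \<Rightarrow> 'x list simplicial_data" where
  "full_complex P = (simplicial_E UNIV)\<lparr>simplices := \<lambda>k. {xs. length xs = Suc k \<and> P (set xs)}\<rparr>"

lemma full_complex_simps [simp]:
  "simplices (full_complex P) k = {xs. length xs = Suc k \<and> P (set xs)}"
  "face (full_complex P) k i xs = take i xs @ drop (Suc i) xs"
  "degen (full_complex P) k i xs = take (Suc i) xs @ drop i xs"
  by (simp_all add: full_complex_def simplicial_E_def)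

lemma nonneg_weighted_tuple:
  "t \<in> standard_simplex k \<Longrightarrow> nonneg_weights (weighted_tuple k xs t)"
  by (auto simp: nonneg_weights_def weighted_tuple_def standard_simplex_def)

lemma total_weighted_tuple: "sum_list (map snd (weighted_tuple k xs t)) = (\<Sum>i\<le>k. t i)"
  by (simp add: weighted_tuple_def o_def sum_list_distinct_conv_sum_set atLeast0LessThan
      lessThan_Suc_atMost del: upt_Suc)

lemma upt_split: "i \<le> j \<Longrightarrow> j \<le> k \<Longrightarrow> [i..<k] = [i..<j] @ [j..<k]"
  using upt_add_eq_append[of i j "k - j"] by simp

lemma upt_split3: "i \<le> k \<Longrightarrow> [0..<Suc k] = [0..<i] @ [i] @ [Suc i..<Suc k]"
  using upt_split[of 0 i "Suc k"] by (simp add: upt_conv_Cons del: upt_Suc)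

text \<open>The coface map inserts the weight 0 at position \<open>i\<close>, and
  \<open>wcons\<close> drops this entry.\<close>

lemma normal_form_face:
  assumes "length xs = Suc (Suc k)" "i \<le> Suc k"
  shows "normal_form (Suc k, xs, simplical_face i t) = normal_form (k, take i xs @ drop (Suc i) xs, t)"
proof -
  let ?ys = "take i xs @ drop (Suc i) xs"
  have 1: "weighted_tuple (Suc k) xs (simplical_face i t) =
      map (\<lambda>j. (xs ! j, t j)) [0..<i] @ [(xs ! i, 0)] @ map (\<lambda>j. (xs ! j, t (j - 1))) [Suc i..<Suc (Suc k)]"
    unfolding weighted_tuple_def upt_split3[OF assms(2)] by (auto simp: simplical_face_def simp del: upt_Suc)
  have split: "[0..<Suc k] = [0..<i] @ [i..<Suc k]"
    using assms by (intro upt_split) auto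
  have ys: "?ys ! j = xs ! (if j < i then j else Suc j)" if "j < Suc k" for j
    using that assms by (intro nth_delete) auto
  have 2: "weighted_tuple k ?ys t =
      map (\<lambda>j. (xs ! j, t j)) [0..<i] @ map (\<lambda>j. (xs ! Suc j, t j)) [i..<Suc k]"
    unfolding weighted_tuple_def split map_append
    using ys assms by (auto simp del: upt_Suc append_take_drop_id)
  have 3: "map (\<lambda>j. (xs ! Suc j, t j)) [i..<Suc k] = map (\<lambda>j. (xs ! j, t (j - 1))) [Suc i..<Suc (Suc k)]"
    by (subst map_Suc_upt[symmetric]) (simp add: o_def del: upt_Suc map_Suc_upt)
  show ?thesis
    unfolding normal_form.simps 1 2 3 wnorm_append by (simp add: wnorm_def)
qed

text \<open>Doubling yields two adjacent entries with the same vertex; \<open>wcons_add\<close>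
  merges them with the summed weight that \<open>cosimplicial_degen\<close> prescribes.\<close>

lemma normal_form_degen:
  assumes "length xs = Suc k" "i \<le> k" "0 \<le> t i" "0 \<le> t (Suc i)"
  shows "normal_form (Suc k, take (Suc i) xs @ drop i xs, t) = normal_form (k, xs, cosimplicial_degen i t)"
proof -
  let ?ys = "take (Suc i) xs @ drop i xs"
  have split: "[0..<Suc (Suc k)] = [0..<i] @ [i] @ [Suc i] @ [Suc (Suc i)..<Suc (Suc k)]"
    using assms by (subst upt_split3[of i]) (auto simp: upt_conv_Cons simp del: upt_Suc)
  have ys: "?ys ! j = xs ! (if j \<le> i then j else j - 1)" if "j < Suc (Suc k)" for j
    using that assms by (intro nth_double) auto
  have 1: "weighted_tuple (Suc k) ?ys t =
      map (\<lambda>j. (xs ! j, t j)) [0..<i] @ [(xs ! i, t i)] @ [(xs ! i, t (Suc i))] @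
      map (\<lambda>j. (xs ! (j - 1), t j)) [Suc (Suc i)..<Suc (Suc k)]"
    unfolding weighted_tuple_def split map_append
    using ys assms by (auto simp del: upt_Suc append_take_drop_id)
  have 2: "weighted_tuple k xs (cosimplicial_degen i t) =
      map (\<lambda>j. (xs ! j, t j)) [0..<i] @ [(xs ! i, t i + t (Suc i))] @
      map (\<lambda>j. (xs ! j, t (Suc j))) [Suc i..<Suc k]"
    unfolding weighted_tuple_def upt_split3[OF assms(2)]
    by (auto simp: cosimplicial_degen_def simp del: upt_Suc)
  have 3: "map (\<lambda>j. (xs ! j, t (Suc j))) [Suc i..<Suc k] =
      map (\<lambda>j. (xs ! (j - 1), t j)) [Suc (Suc i)..<Suc (Suc k)]"
    by (subst map_Suc_upt[symmetric]) (simp add: o_def del: upt_Suc map_Suc_upt)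
  show ?thesis
    unfolding normal_form.simps 1 2 3 wnorm_append using assms by (simp add: wnorm_def wcons_add)
qed

lemma topspace_realization_sum:
  "topspace (realization_sum (full_complex P)) =
     {(k, xs, t). length xs = Suc k \<and> P (set xs) \<and> t \<in> standard_simplex k}"
  by (auto simp: realization_sum_def)

lemma realization_rel_sym: "(p, q) \<in> realization_rel Y \<Longrightarrow> (q, p) \<in> realization_rel Y"
  unfolding realization_rel_def by (metis converse_iff converse_Un converse_converse rtrancl_converseI sup_commute)

lemma realization_rel_trans:
  "(p, q) \<in> realization_rel Y \<Longrightarrow> (q, r) \<in> realization_rel Y \<Longrightarrow> (p, r) \<in> realization_rel Y"
  unfolding realization_rel_def by (rule rtrancl_trans)

lemma realization_rel_refl: "(p, p) \<in> realization_rel Y"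
  unfolding realization_rel_def by simp

lemma realization_rel_glue: "(p, q) \<in> realization_glue Y \<Longrightarrow> (p, q) \<in> realization_rel Y"
  unfolding realization_rel_def by auto

lemma normal_form_glue:
  assumes "(p, q) \<in> realization_glue (full_complex P)"
  shows "normal_form p = normal_form q"
  using assms unfolding realization_glue_def
proof (elim UnE CollectE exE conjE, goal_cases)
  case (1 k i x t)
  then show ?case
    using normal_form_face[of x k i t] by simp
next
  case (2 k i x t)
  then show ?case
    using normal_form_degen[of x k i t] by (simp add: standard_simplex_def)
qed

lemma normal_form_rel:
  assumes "(p, q) \<in> realization_rel (full_complex P)"
  shows "normal_form p = normal_form q"
  using assms unfolding realization_rel_def
  by (induction rule: rtrancl_induct) (auto dest: normal_form_glue)

definition hereditary :: "('x set \<Rightarrow> bool) \<Rightarrow> bool" where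
  "hereditary P \<longleftrightarrow> (\<forall>s s'. P s \<longrightarrow> s' \<subseteq> s \<longrightarrow> P s')"

lemma hereditaryD: "hereditary P \<Longrightarrow> P s \<Longrightarrow> s' \<subseteq> s \<Longrightarrow> P s'"
  by (auto simp: hereditary_def)

definition reduced_point :: "('x \<times> real) list \<Rightarrow> nat \<times> 'x list \<times> (nat \<Rightarrow> real)" where
  "reduced_point l = (length l - 1, map fst l, \<lambda>i. if i < length l then snd (l ! i) else 0)"

lemma standard_simplexI:
  assumes "\<And>i. 0 \<le> t i" "\<And>i. i > k \<Longrightarrow> t i = 0" "(\<Sum>i\<le>k. t i) = 1"
  shows "t \<in> standard_simplex k"
proof -
  have "t i \<le> 1" for i
  proof (cases "i \<le> k")
    case True
    then have "t i \<le> (\<Sum>i\<le>k. t i)"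
      using assms(1) by (intro member_le_sum) auto
    then show ?thesis
      using assms(3) by simp
  next
    case False
    then show ?thesis
      using assms(2) by simp
  qed
  then show ?thesis
    using assms by (auto simp: standard_simplex_def)
qed

lemma sum_weights_normal_form: "sum_list (map snd (normal_form (k, xs, t))) = (\<Sum>i\<le>k. t i)"
  by (simp add: total_weight_wnorm total_weighted_tuple)

text \<open>With \<open>normal_form_rel\<close> this makes the normal form a complete invariant of
  the classes. Induction on the dimension: a vanishing coordinate leads to a face, equal neighbours
  exhibit the simplex as a degeneracy, and a point with neither defect is its own reduced point.
  Passing to smaller tuples stays inside the complex because \<open>P\<close> is hereditary.\<close>

lemma rel_reduced_point:
  assumes "hereditary P"
  shows "length xs = Suc k \<Longrightarrow> P (set xs) \<Longrightarrow> t \<in> standard_simplex k \<Longrightarrow>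
    ((k, xs, t), reduced_point (normal_form (k, xs, t))) \<in> realization_rel (full_complex P)"
proof (induction k arbitrary: xs t rule: less_induct)
  case (less k)
  have t: "0 \<le> t i" "i > k \<Longrightarrow> t i = 0" "(\<Sum>i\<le>k. t i) = 1" for i
    using less.prems by (auto simp: standard_simplex_def)
  consider (zero) i where "i \<le> k" "t i = 0" | (dup) i where "i < k" "xs ! i = xs ! Suc i"
    | (red) "\<And>i. i \<le> k \<Longrightarrow> t i \<noteq> 0" "\<And>i. i < k \<Longrightarrow> xs ! i \<noteq> xs ! Suc i"
    by blast
  then show ?case
  proof cases
    case zero
    then obtain k' where k: "k = Suc k'"
      using t by (cases k) auto
    define t' where "t' j = (if j < i then t j else t (Suc j))" for j
    define ys where "ys = take i xs @ drop (Suc i) xs"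
    have tt: "simplical_face i t' = t"
      unfolding simplical_face_def
    proof
      fix j show "(if j < i then t' j else if j = i then 0 else t' (j - 1)) = t j"
        using zero by (cases j) (auto simp: t'_def)
    qed
    have len: "length ys = Suc k'"
      using less.prems zero k by (auto simp: ys_def)
    have nf: "normal_form (k, xs, t) = normal_form (k', ys, t')"
      using normal_form_face[of xs k' i t'] less.prems zero k by (simp add: tt ys_def)
    have "t' \<in> standard_simplex k'"
    proof (rule standard_simplexI)
      show "(\<Sum>i\<le>k'. t' i) = 1"
        using nf t(3) by (metis sum_weights_normal_form)
    qed (use t k zero in \<open>auto simp: t'_def\<close>)
    moreover have "P (set ys)"
      using less.prems(2) hereditaryD[OF assms] set_take_subset[of i xs] set_drop_subset[of "Suc i" xs]
      by (metis ys_def set_append Un_least)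
    moreover have "((k', ys, t'), (k, xs, t)) \<in> realization_glue (full_complex P)"
      unfolding realization_glue_def using less.prems zero k calculation(1)
      by (intro UnI1 CollectI exI[of _ k'] exI[of _ i] exI[of _ xs] exI[of _ t']) (auto simp: tt ys_def)
    ultimately show ?thesis
      unfolding nf using less.IH[of k' ys t'] len k
      by (meson lessI realization_rel_glue realization_rel_sym realization_rel_trans)
  next
    case dup
    then obtain k' where k: "k = Suc k'"
      by (cases k) auto
    define ys where "ys = take i xs @ drop (Suc i) xs"
    define t' where "t' = cosimplicial_degen i t"
    have len: "length ys = Suc k'"
      using less.prems dup k by (auto simp: ys_def)
    have xs: "xs = take (Suc i) ys @ drop i ys"
    proof (rule nth_equalityI)
      show "length xs = length (take (Suc i) ys @ drop i ys)"
        using len less.prems dup k by auto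
      fix j assume j: "j < length xs"
      have "(take (Suc i) ys @ drop i ys) ! j = ys ! (if j \<le> i then j else j - 1)"
        using j less.prems len k dup by (intro nth_double) auto
      also have "\<dots> = xs ! j"
        unfolding ys_def using j less.prems k dup by (subst nth_delete) (auto simp: not_le less_Suc_eq le_less)
      finally show "xs ! j = (take (Suc i) ys @ drop i ys) ! j" ..
    qed
    have nf: "normal_form (k, xs, t) = normal_form (k', ys, t')"
      using normal_form_degen[of ys k' i t] len dup k t by (simp add: t'_def flip: xs)
    have "t' \<in> standard_simplex k'"
    proof (rule standard_simplexI)
      show "(\<Sum>i\<le>k'. t' i) = 1"
        using nf t(3) by (metis sum_weights_normal_form)
    qed (use t k dup in \<open>auto simp: t'_def cosimplicial_degen_def\<close>)
    moreover have "P (set ys)"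
      using less.prems(2) hereditaryD[OF assms] set_take_subset[of i xs] set_drop_subset[of "Suc i" xs]
      by (metis ys_def set_append Un_least)
    moreover have "((k, xs, t), (k', ys, t')) \<in> realization_glue (full_complex P)"
      unfolding realization_glue_def using less.prems dup k calculation len
      by (intro UnI2 CollectI exI[of _ k'] exI[of _ i] exI[of _ ys] exI[of _ t]) (auto simp: t'_def simp flip: xs)
    ultimately show ?thesis
      unfolding nf using less.IH[of k' ys t'] len k
      by (meson lessI realization_rel_glue realization_rel_trans)
  next
    case red
    have "normal_form (k, xs, t) = weighted_tuple k xs t"
      unfolding normal_form.simps
    proof (rule wnorm_normal)
      show "\<forall>x\<in>set (weighted_tuple k xs t). 0 < snd x"
        using red(1) t(1) by (auto simp: weighted_tuple_def less_le)
      have "map fst (weighted_tuple k xs t) = xs"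
        unfolding weighted_tuple_def using less.prems(1) map_nth[of xs] by (simp add: o_def)
      then show "distinct_adj (map fst (weighted_tuple k xs t))"
        using red(2) less.prems(1) by (simp add: distinct_adj_conv_nth)
    qed
    moreover have "map fst (weighted_tuple k xs t) = xs"
      unfolding weighted_tuple_def using less.prems(1) map_nth[of xs] by (simp add: o_def)
    moreover have "(\<lambda>i. if i < length (weighted_tuple k xs t) then snd (weighted_tuple k xs t ! i) else 0) = t"
      using t(2) by (auto simp: weighted_tuple_def simp del: upt_Suc)
    ultimately have "reduced_point (normal_form (k, xs, t)) = (k, xs, t)"
      by (simp add: reduced_point_def) (simp add: weighted_tuple_def)
    then show ?thesis
      by (metis realization_rel_refl)
  qed
qed

section \<open>The space of normal forms\<close>

abbreviation simplex_topology :: "nat \<Rightarrow> (nat \<Rightarrow> real) topology" where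
  "simplex_topology k \<equiv> subtopology (powertop_real UNIV) (standard_simplex k)"

lemma openin_prod_discrete_topology:
  "openin (prod_topology (discrete_topology S) X) U \<longleftrightarrow>
     U \<subseteq> S \<times> topspace X \<and> (\<forall>x\<in>S. openin X {t. (x, t) \<in> U})"
proof (intro iffI conjI ballI)
  assume U: "openin (prod_topology (discrete_topology S) X) U"
  then show sub: "U \<subseteq> S \<times> topspace X"
    by (metis openin_subset topspace_discrete_topology topspace_prod_topology)
  fix x assume x: "x \<in> S"
  have "continuous_map X (prod_topology (discrete_topology S) X) (\<lambda>t. (x, t))"
    using x by (intro continuous_map_pairedI) auto
  then have "openin X {t \<in> topspace X. (x, t) \<in> U}"
    using U by (rule openin_continuous_map_preimage)
  moreover have "{t \<in> topspace X. (x, t) \<in> U} = {t. (x, t) \<in> U}"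
    using sub by auto
  ultimately show "openin X {t. (x, t) \<in> U}"
    by simp
next
  assume *: "U \<subseteq> S \<times> topspace X \<and> (\<forall>x\<in>S. openin X {t. (x, t) \<in> U})"
  then have "U = (\<Union>x\<in>S. {x} \<times> {t. (x, t) \<in> U})"
    by auto
  moreover have "openin (prod_topology (discrete_topology S) X) (\<Union>x\<in>S. {x} \<times> {t. (x, t) \<in> U})"
    using * by (intro openin_Union) (auto simp: openin_prod_Times_iff)
  ultimately show "openin (prod_topology (discrete_topology S) X) U"
    by metis
qed

lemma openin_realization_sum:
  "openin (realization_sum (full_complex P)) U \<longleftrightarrow>
     U \<subseteq> topspace (realization_sum (full_complex P)) \<and>
     (\<forall>k xs. length xs = Suc k \<longrightarrow> P (set xs) \<longrightarrow> openin (simplex_topology k) {t. (k, xs, t) \<in> U})"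
  unfolding topspace_realization_sum
  unfolding realization_sum_def openin_sum_topology openin_prod_discrete_topology
  by (auto simp: subset_iff)

lemma closedin_realization_sum:
  "closedin (realization_sum (full_complex P)) U \<longleftrightarrow>
     U \<subseteq> topspace (realization_sum (full_complex P)) \<and>
     (\<forall>k xs. length xs = Suc k \<longrightarrow> P (set xs) \<longrightarrow> closedin (simplex_topology k) {t. (k, xs, t) \<in> U})"
proof -
  have "standard_simplex k - {t. (k, xs, t) \<in> U} =
      {t. (k, xs, t) \<in> topspace (realization_sum (full_complex P)) - U}"
    if "length xs = Suc k" "P (set xs)" for k xs
    using that by (auto simp: topspace_realization_sum)
  then show ?thesis
    unfolding closedin_def openin_realization_sum
    by (auto simp: topspace_realization_sum)
qed

lemma continuous_map_realization_sum:
  assumes "\<And>k xs. length xs = Suc k \<Longrightarrow> P (set xs) \<Longrightarrow>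
    continuous_map (simplex_topology k) Y (\<lambda>t. g (k, xs, t))"
  shows "continuous_map (realization_sum (full_complex P)) Y g"
  unfolding continuous_map_def
proof (intro conjI allI impI)
  show "g \<in> topspace (realization_sum (full_complex P)) \<rightarrow> topspace Y"
    using assms by (fastforce simp: topspace_realization_sum continuous_map_def)
  fix V assume "openin Y V"
  then have "openin (simplex_topology k) {t \<in> topspace (simplex_topology k). g (k, xs, t) \<in> V}"
    if "length xs = Suc k" "P (set xs)" for k xs
    using assms[OF that] openin_continuous_map_preimage by blast
  then show "openin (realization_sum (full_complex P))
      {x \<in> topspace (realization_sum (full_complex P)). g x \<in> V}"
    by (auto simp: openin_realization_sum topspace_realization_sum cong: conj_cong)
qed

lemma continuous_map_simplex_realization_sum:
  assumes "length xs = Suc k" "P (set xs)"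
  shows "continuous_map (simplex_topology k) (realization_sum (full_complex P)) (\<lambda>t. (k, xs, t))"
  unfolding continuous_map_def
proof (intro conjI allI impI)
  show "(\<lambda>t. (k, xs, t)) \<in> topspace (simplex_topology k) \<rightarrow> topspace (realization_sum (full_complex P))"
    using assms by (auto simp: topspace_realization_sum)
  fix V assume V: "openin (realization_sum (full_complex P)) V"
  then have "openin (simplex_topology k) {t. (k, xs, t) \<in> V}"
    using assms by (simp add: openin_realization_sum)
  moreover have "{t. (k, xs, t) \<in> V} = {t \<in> topspace (simplex_topology k). (k, xs, t) \<in> V}"
    using openin_subset[OF V] by (auto simp: topspace_realization_sum)
  ultimately show "openin (simplex_topology k) {t \<in> topspace (simplex_topology k). (k, xs, t) \<in> V}"
    by simp
qed

text \<open>The copies of the single simplices are open in the disjoint sum, so their products with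
  \<open>Z\<close> form an open cover along which the restrictions can be pasted.\<close>

lemma continuous_map_prod_realization_sum:
  assumes g: "\<And>k xs. length xs = Suc k \<Longrightarrow> P (set xs) \<Longrightarrow>
    continuous_map (prod_topology Z (simplex_topology k)) Y (\<lambda>(s, t). g (s, (k, xs, t)))"
  shows "continuous_map (prod_topology Z (realization_sum (full_complex P))) Y g"
proof -
  let ?R = "realization_sum (full_complex P)"
  define T where "T = (\<lambda>(k, xs). topspace Z \<times> {p \<in> topspace ?R. fst p = k \<and> fst (snd p) = xs})"
  define I where "I = {(k, xs). length xs = Suc k \<and> P (set xs)}"
  have coord: "continuous_map ?R (powertop_real UNIV) (\<lambda>p. snd (snd p))"
    by (rule continuous_map_realization_sum)
      (simp add: continuous_map_from_subtopology)
  show ?thesis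
  proof (rule pasting_lemma[where I = I and T = T and f = "\<lambda>i. g"])
    fix i assume "i \<in> I"
    then obtain k xs where i: "i = (k, xs)" "length xs = Suc k" "P (set xs)"
      by (auto simp: I_def)
    have Ti: "T i = topspace Z \<times> {p \<in> topspace ?R. fst p = k \<and> fst (snd p) = xs}"
      by (simp add: T_def i(1))
    have "openin ?R {p \<in> topspace ?R. fst p = k \<and> fst (snd p) = xs}"
      unfolding openin_realization_sum
    proof (intro conjI allI impI)
      fix k' xs' assume "length xs' = Suc k'" "P (set xs')"
      then have "{t. (k', xs', t) \<in> {p \<in> topspace ?R. fst p = k \<and> fst (snd p) = xs}} =
          (if k = k' \<and> xs = xs' then topspace (simplex_topology k') else {})"
        by (auto simp: topspace_realization_sum)
      then show "openin (simplex_topology k')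
          {t. (k', xs', t) \<in> {p \<in> topspace ?R. fst p = k \<and> fst (snd p) = xs}}"
        using openin_topspace[of "simplex_topology k'"] by (simp split: if_split)
    qed auto
    then show "openin (prod_topology Z ?R) (T i)"
      by (simp add: Ti openin_prod_Times_iff)
    have "continuous_map (subtopology (prod_topology Z ?R) (T i))
        (prod_topology Z (simplex_topology k)) (\<lambda>p. (fst p, snd (snd (snd p))))"
    proof (rule continuous_map_pairedI)
      show "continuous_map (subtopology (prod_topology Z ?R) (T i)) Z fst"
        by (intro continuous_map_from_subtopology continuous_map_fst)
      have "continuous_map (prod_topology Z ?R) (powertop_real UNIV) (\<lambda>p. snd (snd (snd p)))"
        using continuous_map_compose[OF continuous_map_snd coord] by (simp add: o_def)
      then show "continuous_map (subtopology (prod_topology Z ?R) (T i)) (simplex_topology k)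
          (\<lambda>p. snd (snd (snd p)))"
        unfolding continuous_map_in_subtopology
      proof (intro conjI)
        show "(\<lambda>p. snd (snd (snd p))) \<in> topspace (subtopology (prod_topology Z ?R) (T i)) \<rightarrow> standard_simplex k"
          by (auto simp: Ti topspace_realization_sum)
      qed (use \<open>continuous_map (prod_topology Z ?R) _ _\<close> in \<open>rule continuous_map_from_subtopology\<close>)
    qed
    from continuous_map_compose[OF this g[OF i(2,3)]]
    show "continuous_map (subtopology (prod_topology Z ?R) (T i)) Y g"
      by (rule continuous_map_eq) (auto simp: Ti)
  next
    show "\<exists>j. j \<in> I \<and> x \<in> T j \<and> g x = g x" if "x \<in> topspace (prod_topology Z ?R)" for x
      using that by (intro exI[of _ "(fst (snd x), fst (snd (snd x)))"])
        (auto simp: I_def T_def topspace_realization_sum)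
  qed auto
qed

section \<open>The model of the realization and its subspaces\<close>

definition model :: "('x set \<Rightarrow> bool) \<Rightarrow> ('x \<times> real) list topology" where
  "model P = quotient_topology (realization_sum (full_complex P)) normal_form"

lemma quotient_map_model: "quotient_map (realization_sum (full_complex P)) (model P) normal_form"
  unfolding model_def by (rule quotient_map_quotient_topology)

lemma topspace_model:
  "topspace (model P) =
     {normal_form (k, xs, t) | k xs t. length xs = Suc k \<and> P (set xs) \<and> t \<in> standard_simplex k}"
  unfolding model_def topspace_quotient_topology topspace_realization_sum by force

lemma normal_form_in_model:
  "length xs = Suc k \<Longrightarrow> P (set xs) \<Longrightarrow> t \<in> standard_simplex k \<Longrightarrow>
     normal_form (k, xs, t) \<in> topspace (model P)"
  unfolding topspace_model by blast

lemma continuous_map_model: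
  assumes "\<And>k xs. length xs = Suc k \<Longrightarrow> P (set xs) \<Longrightarrow>
    continuous_map (simplex_topology k) Y (\<lambda>t. g (normal_form (k, xs, t)))"
  shows "continuous_map (model P) Y g"
proof (rule continuous_compose_quotient_map[OF quotient_map_model])
  show "continuous_map (realization_sum (full_complex P)) Y (g \<circ> normal_form)"
    using assms by (intro continuous_map_realization_sum) (auto simp del: normal_form.simps)
qed

text \<open>Whitehead's theorem: the product of a quotient map with the identity of a locally
  compact Hausdorff space is again a quotient map. Hence homotopies on the model can be checked
  simplex by simplex.\<close>

lemma continuous_map_prod_model:
  assumes "locally_compact_space Z" "Hausdorff_space Z"
    and "\<And>k xs. length xs = Suc k \<Longrightarrow> P (set xs) \<Longrightarrow>
      continuous_map (prod_topology Z (simplex_topology k)) Y (\<lambda>(s, t). g (s, normal_form (k, xs, t)))"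
  shows "continuous_map (prod_topology Z (model P)) Y g"
proof (rule continuous_compose_quotient_map[OF quotient_map_prod_right[OF _ _ quotient_map_model]])
  show "continuous_map (prod_topology Z (realization_sum (full_complex P))) Y
      (g \<circ> (\<lambda>(x, y). (x, normal_form y)))"
    using assms(3) by (intro continuous_map_prod_realization_sum) (simp add: case_prod_beta del: normal_form.simps)
qed (use assms in auto)

lemma continuous_map_normal_form:
  assumes "length xs = Suc k" "P (set xs)" "continuous_map Z (simplex_topology k) \<tau>"
  shows "continuous_map Z (model P) (\<lambda>z. normal_form (k, xs, \<tau> z))"
proof -
  have "continuous_map (simplex_topology k) (model P) (\<lambda>t. normal_form (k, xs, t))"
    using continuous_map_compose[OF continuous_map_simplex_realization_sum[of xs k P, OF assms(1,2)]
        quotient_imp_continuous_map[OF quotient_map_model]]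
    by (simp add: o_def del: normal_form.simps)
  from continuous_map_compose[OF assms(3) this] show ?thesis
    by (simp add: o_def del: normal_form.simps)
qed

lemma supp_normal_form:
  assumes "length xs = Suc k" "t \<in> standard_simplex k"
  shows "supp (normal_form (k, xs, t)) = {xs ! i | i. i \<le> k \<and> t i \<noteq> 0}"
  using assms supp_wnorm[OF nonneg_weighted_tuple[OF assms(2)], of xs]
  by (fastforce simp: weighted_tuple_def image_iff less_Suc_eq_le simp del: upt_Suc)

lemma supp_normal_form_subset:
  assumes "length xs = Suc k" "t \<in> standard_simplex k"
  shows "supp (normal_form (k, xs, t)) \<subseteq> set xs"
  unfolding supp_normal_form[OF assms] using assms by auto

abbreviation points :: "('x \<times> real) list topology" where
  "points \<equiv> model (\<lambda>_. True)"

lemma topspace_model_subset: "topspace (model P) \<subseteq> topspace points"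
  unfolding topspace_model by blast

lemma supp_model: "hereditary P \<Longrightarrow> l \<in> topspace (model P) \<Longrightarrow> P (supp l)"
  unfolding topspace_model using supp_normal_form_subset hereditaryD by (smt (verit) mem_Collect_eq)

text \<open>On the face where \<open>t\<close> vanishes off \<open>s\<close>, the vertices off \<open>s\<close> may be replaced by any vertex of \<open>s\<close>.\<close>

definition collapse_tuple :: "nat \<Rightarrow> 'x list \<Rightarrow> nat set \<Rightarrow> 'x list" where
  "collapse_tuple k xs s = map (\<lambda>i. xs ! (if i \<in> s then i else (SOME i. i \<in> s))) [0..<Suc k]"

lemma length_collapse_tuple [simp]: "length (collapse_tuple k xs s) = Suc k"
  by (simp add: collapse_tuple_def)

lemma set_collapse_tuple:
  assumes "s \<noteq> {}" "s \<subseteq> {..k}"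
  shows "set (collapse_tuple k xs s) = (!) xs ` s"
proof -
  have "(SOME i. i \<in> s) \<in> s"
    using assms by (simp add: some_in_eq)
  then show ?thesis
    using assms unfolding collapse_tuple_def by (force simp: image_iff less_Suc_eq_le simp del: upt_Suc)
qed

lemma normal_form_collapse_tuple:
  assumes "\<And>i. i \<le> k \<Longrightarrow> i \<notin> s \<Longrightarrow> t i = 0"
  shows "normal_form (k, collapse_tuple k xs s, t) = normal_form (k, xs, t)"
  unfolding normal_form.simps wnorm_def weighted_tuple_def
  using assms by (intro foldr_wcons_cong) (auto simp: collapse_tuple_def less_Suc_eq_le simp del: upt_Suc)

text \<open>A tuple representing a point may have entries of weight 0 that violate \<open>P\<close>;
  collapsing these onto a vertex of the support gives a tuple that satisfies it.\<close>

lemma topspace_model_eq: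
  assumes "hereditary P"
  shows "topspace (model P) = {l \<in> topspace points. P (supp l)}"
proof (intro equalityI subsetI)
  fix l assume l: "l \<in> {l \<in> topspace points. P (supp l)}"
  then obtain k xs t where *: "l = normal_form (k, xs, t)" "length xs = Suc k" "t \<in> standard_simplex k"
    by (auto simp: topspace_model)
  define s where "s = {i. i \<le> k \<and> t i \<noteq> 0}"
  have "s \<noteq> {}"
    using *(3) by (force simp: s_def standard_simplex_def)
  then have "set (collapse_tuple k xs s) = supp l"
    using *(2,3) unfolding *(1) by (subst set_collapse_tuple) (auto simp: s_def supp_normal_form simp del: normal_form.simps)
  moreover have "normal_form (k, collapse_tuple k xs s, t) = l"
    unfolding *(1) by (rule normal_form_collapse_tuple) (auto simp: s_def)
  ultimately show "l \<in> topspace (model P)"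
    using l *(3) normal_form_in_model[of "collapse_tuple k xs s" k P t] by simp
qed (use supp_model[OF assms] topspace_model_subset in auto)

lemma closedin_face:
  "closedin (simplex_topology k) {t \<in> standard_simplex k. \<forall>i\<le>k. i \<notin> s \<longrightarrow> t i = 0}"
proof -
  have "closedin (simplex_topology k) {t \<in> standard_simplex k. t i = 0}" for i
  proof -
    have "continuous_map (simplex_topology k) euclideanreal (\<lambda>t. t i)"
      by (intro continuous_map_from_subtopology continuous_map_product_projection) auto
    from closedin_continuous_map_preimage[OF this, of "{0}"] show ?thesis
      by simp
  qed
  then have "closedin (simplex_topology k) (\<Inter>(insert (topspace (simplex_topology k))
      ((\<lambda>i. {t \<in> standard_simplex k. t i = 0}) ` {i. i \<le> k \<and> i \<notin> s})))"
    by (intro closedin_Inter) (auto simp only: insert_iff image_iff closedin_topspace)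
  moreover have "\<Inter>(insert (topspace (simplex_topology k))
      ((\<lambda>i. {t \<in> standard_simplex k. t i = 0}) ` {i. i \<le> k \<and> i \<notin> s})) =
      {t \<in> standard_simplex k. \<forall>i\<le>k. i \<notin> s \<longrightarrow> t i = 0}"
    by auto
  ultimately show ?thesis
    by simp
qed

text \<open>In a fixed simplex the preimage of \<open>B\<close> is a union over the finitely many
  faces whose vertices satisfy \<open>P\<close>. Each piece is closed: it is a closed face
  intersected with the preimage of \<open>B\<close> under the collapsed tuple, which is a simplex of
  the smaller complex.\<close>

lemma closedin_points_model:
  assumes P: "hereditary P" and B: "closedin (model P) B"
  shows "closedin points B"
proof -
  have Bsub: "B \<subseteq> topspace (model P)"
    using B by (rule closedin_subset)
  have Bslice: "closedin (simplex_topology k) {t \<in> standard_simplex k. normal_form (k, ys, t) \<in> B}"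
    if "length ys = Suc k" "P (set ys)" for k ys
    using closedin_continuous_map_preimage[OF continuous_map_normal_form[of ys k P, OF that continuous_map_id] B]
    by simp
  have "closedin (realization_sum (full_complex (\<lambda>_. True)))
      {p \<in> topspace (realization_sum (full_complex (\<lambda>_. True))). normal_form p \<in> B}"
    unfolding closedin_realization_sum
  proof (intro conjI allI impI)
    fix k and xs :: "'a list" assume xs: "length xs = Suc k"
    define S where "S = {s. s \<subseteq> {..k} \<and> s \<noteq> {} \<and> P ((!) xs ` s)}"
    let ?face = "\<lambda>s. {t \<in> standard_simplex k. \<forall>i\<le>k. i \<notin> s \<longrightarrow> t i = 0} \<inter>
        {t \<in> standard_simplex k. normal_form (k, collapse_tuple k xs s, t) \<in> B}"
    have "{t. (k, xs, t) \<in> {p \<in> topspace (realization_sum (full_complex (\<lambda>_. True))). normal_form p \<in> B}} =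
        (\<Union>s\<in>S. ?face s)" (is "?L = ?R")
    proof (intro equalityI subsetI)
      fix t assume "t \<in> ?L"
      then have t: "t \<in> standard_simplex k" "normal_form (k, xs, t) \<in> B"
        by (auto simp: topspace_realization_sum)
      define s where "s = {i. i \<le> k \<and> t i \<noteq> 0}"
      have "s \<noteq> {}"
        using t(1) by (force simp: s_def standard_simplex_def)
      moreover have "P ((!) xs ` s)"
      proof -
        have "P (supp (normal_form (k, xs, t)))"
          using t(2) Bsub supp_model[OF P] by blast
        moreover have "supp (normal_form (k, xs, t)) = (!) xs ` s"
          using xs t(1) by (subst supp_normal_form) (auto simp: s_def)
        ultimately show ?thesis
          by simp
      qed
      moreover have "normal_form (k, collapse_tuple k xs s, t) = normal_form (k, xs, t)"
        by (rule normal_form_collapse_tuple) (auto simp: s_def)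
      ultimately have "s \<in> S" "t \<in> ?face s"
        using t by (auto simp: S_def s_def simp del: normal_form.simps)
      then show "t \<in> ?R"
        by (rule UN_I)
    next
      fix t assume "t \<in> ?R"
      then show "t \<in> ?L"
        using xs by (auto simp: topspace_realization_sum normal_form_collapse_tuple simp del: normal_form.simps)
    qed
    moreover have "closedin (simplex_topology k) (\<Union>s\<in>S. ?face s)"
    proof (rule closedin_Union)
      show "finite (?face ` S)"
        by (intro finite_imageI finite_subset[of S "Pow {..k}"]) (auto simp: S_def)
      show "closedin (simplex_topology k) C" if C: "C \<in> ?face ` S" for C
      proof -
        obtain s where "s \<in> S" "C = ?face s"
          using C by blast
        then show ?thesis
          using Bslice[of "collapse_tuple k xs s" k]
          by (auto simp: S_def set_collapse_tuple simp del: normal_form.simps intro!: closedin_Int closedin_face)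
      qed
    qed
    ultimately show "closedin (simplex_topology k)
        {t. (k, xs, t) \<in> {p \<in> topspace (realization_sum (full_complex (\<lambda>_. True))). normal_form p \<in> B}}"
      by (simp only:)
  qed auto
  moreover have "B \<subseteq> topspace points"
    using Bsub topspace_model_subset by blast
  ultimately show ?thesis
    using quotient_map_model[of "\<lambda>_. True", unfolded quotient_map_closedin, THEN conjunct2, rule_format, of B]
    by blast
qed

text \<open>The left side carries the quotient topology of the smaller complex, which could be finer
  than the subspace topology. The inclusion is a closed embedding, so the two agree, and continuity
  into a subcomplex becomes a condition on supports.\<close>

lemma model_eq_subtopology:
  assumes P: "hereditary P"
  shows "model P = subtopology points {l. P (supp l)}"
proof -
  have "embedding_map (model P) points id"
  proof (rule injective_closed_imp_embedding_map)
    show "continuous_map (model P) points id"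
      using continuous_map_normal_form[OF _ _ continuous_map_id, of _ _ "\<lambda>_. True"]
      by (intro continuous_map_model) (simp del: normal_form.simps)
    show "closed_map (model P) points id"
      using closedin_points_model[OF P] by (simp add: closed_map_def)
  qed auto
  then have "subtopology points (topspace (model P)) = model P"
    by (simp add: embedding_map_def)
  moreover have "subtopology points (topspace (model P)) = subtopology points {l. P (supp l)}"
    using subtopology_restrict[of points "{l. P (supp l)}"]
    by (simp add: topspace_model_eq[OF P] Collect_conj_eq Int_commute)
  ultimately show ?thesis
    by simp
qed

lemma continuous_map_into_model:
  "hereditary P \<Longrightarrow> continuous_map Z (model P) f \<longleftrightarrow>
     continuous_map Z points f \<and> (\<forall>z\<in>topspace Z. P (supp (f z)))"
  by (auto simp: model_eq_subtopology continuous_map_in_subtopology)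

lemma continuous_map_model_mono:
  assumes "hereditary P" "hereditary Q" "\<And>s. P s \<Longrightarrow> Q s" "continuous_map Z (model P) f"
  shows "continuous_map Z (model Q) f"
  using assms by (simp add: continuous_map_into_model)

text \<open>Its purpose is to make the open stars open: on points, v lies in the support exactly if
  its weight is positive.\<close>

lemma continuous_map_weight: "continuous_map points euclideanreal (weight v)"
proof (rule continuous_map_model)
  fix k and xs :: "'a list"
  have "weight v (normal_form (k, xs, t)) = (\<Sum>i\<le>k. if xs ! i = v then t i else 0)" for t
    by (simp add: weight_wnorm) (simp add: weight_def weighted_tuple_def o_def
      sum_list_distinct_conv_sum_set atLeast0LessThan lessThan_Suc_atMost del: upt_Suc cong: if_cong)
  moreover have "continuous_map (simplex_topology k) euclideanreal (\<lambda>t. if xs ! i = v then t i else 0)" for i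
    by (cases "xs ! i = v") (auto intro: continuous_map_from_subtopology continuous_map_product_projection)
  ultimately show "continuous_map (simplex_topology k) euclideanreal (\<lambda>t. weight v (normal_form (k, xs, t)))"
    by (simp del: normal_form.simps add: continuous_map_sum)
qed

lemma standard_simplex_nonzero: "t \<in> standard_simplex k \<Longrightarrow> \<exists>i\<le>k. t i \<noteq> 0"
  by (rule ccontr) (simp add: standard_simplex_def)

section \<open>Simplicial maps on points and contiguity homotopies\<close>

lemma wnorm_wscale_wnorm:
  "0 \<le> c \<Longrightarrow> nonneg_weights l \<Longrightarrow> wnorm (wscale \<phi> c (wnorm l)) = wnorm (wscale \<phi> c l)"
  using foldr_wscale_wnorm[of c l \<phi> "[]"] by (simp add: wnorm_def)

lemma points_facts:
  assumes "l \<in> topspace points"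
  shows "wnorm l = l" "\<forall>e\<in>set l. 0 < snd e" "nonneg_weights l" "supp l \<noteq> {}"
proof -
  obtain k xs t where *: "l = normal_form (k, xs, t)" "length xs = Suc k" "t \<in> standard_simplex k"
    using assms by (auto simp: topspace_model)
  note nn = nonneg_weighted_tuple[OF *(3), of xs]
  show "wnorm l = l"
    using wnorm_wnorm[OF nn] by (simp add: *(1))
  show "\<forall>e\<in>set l. 0 < snd e"
    using pos_weights_wnorm[OF nn] by (simp add: *(1))
  then show "nonneg_weights l"
    by (auto simp: nonneg_weights_def)
  have "\<exists>i\<le>k. t i \<noteq> 0"
    using *(3) by (rule standard_simplex_nonzero)
  then show "supp l \<noteq> {}"
    unfolding *(1) supp_normal_form[OF *(2,3)] by auto
qed

lemma weight_pos_points: "l \<in> topspace points \<Longrightarrow> 0 < weight v l \<longleftrightarrow> v \<in> supp l"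
  by (intro weight_pos_iff points_facts)

text \<open>The straight line from the \<phi>-image to the \<psi>-image of a point. Tuples are
  ordered, so it runs in the simplex with all \<phi>-images first and all \<psi>-images after them;
  a k-simplex thus leads to 2 * (k + 1) vertices, that is, to dimension 2 * k + 1.\<close>

definition join_map :: "('x \<Rightarrow> 'y) \<Rightarrow> ('x \<Rightarrow> 'y) \<Rightarrow> real \<Rightarrow> ('x \<times> real) list \<Rightarrow> ('y \<times> real) list" where
  "join_map \<phi> \<psi> s l = wnorm (wscale \<phi> (1 - s) l @ wscale \<psi> s l)"

definition vertex_map :: "('x \<Rightarrow> 'y) \<Rightarrow> ('x \<times> real) list \<Rightarrow> ('y \<times> real) list" where
  "vertex_map \<phi> l = wnorm (wscale \<phi> 1 l)"

definition join_coords :: "nat \<Rightarrow> real \<Rightarrow> (nat \<Rightarrow> real) \<Rightarrow> nat \<Rightarrow> real" where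
  "join_coords k s t = (\<lambda>i. if i \<le> k then (1 - s) * t i else if i \<le> 2 * k + 1 then s * t (i - Suc k) else 0)"

lemma weighted_tuple_join:
  assumes "length xs = Suc k"
  shows "weighted_tuple (2 * k + 1) (map \<phi> xs @ map \<psi> xs) (join_coords k s t) =
     wscale \<phi> (1 - s) (weighted_tuple k xs t) @ wscale \<psi> s (weighted_tuple k xs t)"
  by (rule nth_equalityI)
    (use assms in \<open>auto simp: weighted_tuple_def wscale_def join_coords_def nth_append simp del: upt_Suc\<close>)

lemma join_map_normal_form:
  assumes "length xs = Suc k" "t \<in> standard_simplex k" "0 \<le> s" "s \<le> 1"
  shows "join_map \<phi> \<psi> s (normal_form (k, xs, t)) =
     normal_form (2 * k + 1, map \<phi> xs @ map \<psi> xs, join_coords k s t)"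
  using assms nonneg_weighted_tuple[OF assms(2), of xs]
  by (simp only: join_map_def normal_form.simps wnorm_append weighted_tuple_join)
    (simp add: foldr_wscale_wnorm wnorm_wscale_wnorm)

lemma join_coords_simplex:
  assumes "t \<in> standard_simplex k" "0 \<le> s" "s \<le> 1"
  shows "join_coords k s t \<in> standard_simplex (2 * k + 1)"
proof (rule standard_simplexI)
  \<comment> \<open>Dummy vertices: only the weights enter the sum, so
    \<open>weighted_tuple_join\<close> can be applied to any tuple of the right length.\<close>
  let ?xs = "replicate (Suc k) ()"
  have scale: "sum_list (map snd (wscale \<phi> c l)) = c * sum_list (map snd l)" for \<phi> :: "unit \<Rightarrow> unit" and c l
    by (induction l) (auto simp: wscale_def algebra_simps)
  have "(\<Sum>i\<le>2 * k + 1. join_coords k s t i) =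
      sum_list (map snd (weighted_tuple (2 * k + 1) (map id ?xs @ map id ?xs) (join_coords k s t)))"
    by (simp only: total_weighted_tuple)
  also have "\<dots> = (1 - s) * (\<Sum>i\<le>k. t i) + s * (\<Sum>i\<le>k. t i)"
    by (subst weighted_tuple_join) (simp_all only: map_append sum_list_append scale total_weighted_tuple length_replicate)
  also have "\<dots> = 1"
    using assms(1) by (simp add: standard_simplex_def)
  finally show "(\<Sum>i\<le>2 * k + 1. join_coords k s t i) = 1" .
qed (use assms in \<open>auto simp: join_coords_def standard_simplex_def\<close>)

lemma continuous_map_simplexI:
  assumes "\<And>z. z \<in> topspace Z \<Longrightarrow> f z \<in> standard_simplex k"
    and "\<And>i. continuous_map Z euclideanreal (\<lambda>z. f z i)"
  shows "continuous_map Z (simplex_topology k) f"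
  using assms by (auto simp: continuous_map_in_subtopology continuous_map_componentwise_UNIV)

lemma continuous_map_join_map:
  "continuous_map (prod_topology (top_of_set {0..1}) points) points (\<lambda>(s, l). join_map \<phi> \<psi> s l)"
proof (rule continuous_map_prod_model)
  show "locally_compact_space (top_of_set {0..1::real})"
    by (intro compact_imp_locally_compact_space) (simp_all add: compact_space_subtopology)
  show "Hausdorff_space (top_of_set {0..1::real})"
    by (simp add: Hausdorff_space_subtopology)
  fix k and xs :: "'a list"
  assume xs: "length xs = Suc k"
  let ?Z = "prod_topology (top_of_set {0..1::real}) (simplex_topology k)"
  have s: "continuous_map ?Z euclideanreal (\<lambda>z. fst z)"
    by (metis continuous_map_fst continuous_map_into_fulltopology)
  have t: "continuous_map ?Z euclideanreal (\<lambda>z. snd z i)" for i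
    using continuous_map_compose[OF continuous_map_snd
        continuous_map_from_subtopology[OF continuous_map_product_projection[of i UNIV "\<lambda>_. euclideanreal"]]]
    by (simp add: o_def)
  have "continuous_map ?Z (simplex_topology (2 * k + 1)) (\<lambda>z. join_coords k (fst z) (snd z))"
  proof (rule continuous_map_simplexI)
    show "continuous_map ?Z euclideanreal (\<lambda>z. join_coords k (fst z) (snd z) i)" for i
      unfolding join_coords_def
      by (cases "i \<le> k"; cases "i \<le> 2 * k + 1")
        (auto intro!: continuous_map_real_mult continuous_map_diff s t)
  qed (auto intro: join_coords_simplex[simplified])
  from continuous_map_normal_form[OF _ _ this, of "map \<phi> xs @ map \<psi> xs" "\<lambda>_. True"]
  have "continuous_map ?Z points
      (\<lambda>z. normal_form (2 * k + 1, map \<phi> xs @ map \<psi> xs, join_coords k (fst z) (snd z)))"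
    using xs by (simp del: normal_form.simps)
  then show "continuous_map ?Z points
      (\<lambda>(s, t). case (s, normal_form (k, xs, t)) of (s, l) \<Rightarrow> join_map \<phi> \<psi> s l)"
    by (rule continuous_map_eq) (auto simp: join_map_normal_form xs simp del: normal_form.simps)
qed

lemma foldr_wscale_0: "foldr wcons (wscale \<phi> 0 l) B = B"
  by (induction l) (auto simp: wscale_def)

lemma join_map_0: "join_map \<phi> \<psi> 0 l = vertex_map \<phi> l"
  by (simp add: join_map_def vertex_map_def wnorm_append) (simp add: wnorm_def foldr_wscale_0)

lemma join_map_1: "join_map \<phi> \<psi> 1 l = vertex_map \<psi> l"
  by (simp add: join_map_def vertex_map_def wnorm_append foldr_wscale_0)

lemma supp_wnorm_subset: "nonneg_weights l \<Longrightarrow> supp (wnorm l) \<subseteq> supp l"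
  unfolding supp_wnorm by (simp only: supp_def) blast

lemma supp_wscale: "supp (wscale \<phi> c l) = \<phi> ` supp l"
  by (simp add: supp_def wscale_def image_image case_prod_beta)

lemma nonneg_weights_wscale: "nonneg_weights l \<Longrightarrow> 0 \<le> c \<Longrightarrow> nonneg_weights (wscale \<phi> c l)"
  by (simp add: nonneg_weights_def wscale_def case_prod_beta)

lemma supp_join_map:
  assumes "nonneg_weights l" "0 \<le> s" "s \<le> 1"
  shows "supp (join_map \<phi> \<psi> s l) \<subseteq> \<phi> ` supp l \<union> \<psi> ` supp l"
proof -
  have "nonneg_weights (wscale \<phi> (1 - s) l @ wscale \<psi> s l)"
    using assms nonneg_weights_wscale[OF assms(1), of "1 - s" \<phi>] nonneg_weights_wscale[OF assms(1), of s \<psi>] by (simp add: nonneg_weights_def ball_Un)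
  from supp_wnorm_subset[OF this] show ?thesis
    using supp_wscale[of \<phi> "1 - s" l] supp_wscale[of \<psi> s l]
    by (simp add: join_map_def supp_def image_Un)
qed

lemma supp_vertex_map:
  assumes "l \<in> topspace points"
  shows "supp (vertex_map \<phi> l) = \<phi> ` supp l"
proof -
  have "\<forall>e\<in>set (wscale \<phi> 1 l). snd e \<noteq> 0"
    using points_facts(2)[OF assms] by (auto simp: wscale_def)
  then have "supp (vertex_map \<phi> l) = supp (wscale \<phi> 1 l)"
    unfolding vertex_map_def supp_wnorm[OF nonneg_weights_wscale[OF points_facts(3)[OF assms] zero_le_one]]
    by (simp only: supp_def) blast
  then show ?thesis
    by (simp add: supp_wscale)
qed

lemma vertex_map_normal_form:
  assumes "length xs = Suc k" "t \<in> standard_simplex k"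
  shows "vertex_map \<phi> (normal_form (k, xs, t)) = normal_form (k, map \<phi> xs, t)"
proof -
  have "wscale \<phi> 1 (weighted_tuple k xs t) = weighted_tuple k (map \<phi> xs) t"
    using assms(1) by (auto simp: wscale_def weighted_tuple_def simp del: upt_Suc)
  then show ?thesis
    using foldr_wscale_wnorm[OF _ nonneg_weighted_tuple[OF assms(2)], of 1 \<phi> xs "[]"]
    by (simp add: vertex_map_def wnorm_def)
qed

lemma continuous_map_vertex_map: "continuous_map points points (vertex_map \<phi>)"
proof (rule continuous_map_model)
  fix k and xs :: "'a list"
  assume xs: "length xs = Suc k"
  have "continuous_map (simplex_topology k) points (\<lambda>t. normal_form (k, map \<phi> xs, t))"
    using continuous_map_normal_form[OF _ _ continuous_map_id, of "map \<phi> xs" k "\<lambda>_. True"] xs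
    by (simp del: normal_form.simps)
  then show "continuous_map (simplex_topology k) points (\<lambda>t. vertex_map \<phi> (normal_form (k, xs, t)))"
    by (rule continuous_map_eq) (simp add: vertex_map_normal_form xs del: normal_form.simps)
qed

lemma vertex_map_in_points: "l \<in> topspace points \<Longrightarrow> vertex_map \<phi> l \<in> topspace points"
  using continuous_map_vertex_map by (force simp: continuous_map_def)

lemma vertex_map_vertex_map:
  assumes "l \<in> topspace points"
  shows "vertex_map \<psi> (vertex_map \<phi> l) = vertex_map (\<psi> \<circ> \<phi>) l"
proof -
  obtain k xs t where *: "l = normal_form (k, xs, t)" "length xs = Suc k" "t \<in> standard_simplex k"
    using assms by (auto simp: topspace_model)
  show ?thesis
    unfolding *(1) using *(2,3) by (simp add: vertex_map_normal_form del: normal_form.simps)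
qed

lemma vertex_map_ident:
  assumes "l \<in> topspace points" "\<And>v. v \<in> supp l \<Longrightarrow> \<phi> v = v"
  shows "vertex_map \<phi> l = l"
proof -
  have "wscale \<phi> 1 l = l"
    unfolding wscale_def using assms(2) by (intro map_idI) (force simp: supp_def)
  then show ?thesis
    using points_facts(1)[OF assms(1)] by (simp add: vertex_map_def)
qed

text \<open>Contiguity of simplicial maps: both images of a point lie in one common simplex of the
  complex \<open>Q\<close>, and \<open>join_map\<close> stays in it.\<close>

lemma homotopic_contiguous:
  assumes f: "continuous_map Z points f" and Q: "hereditary Q"
    and "\<And>z. z \<in> topspace Z \<Longrightarrow> Q (\<phi> ` supp (f z) \<union> \<psi> ` supp (f z))"
  shows "homotopic_with (\<lambda>_. True) Z (model Q) (vertex_map \<phi> \<circ> f) (vertex_map \<psi> \<circ> f)"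
proof -
  let ?H = "(\<lambda>(s, l). join_map \<phi> \<psi> s l) \<circ> (\<lambda>p. (fst p, f (snd p)))"
  have "continuous_map (prod_topology (top_of_set {0..1}) Z) points ?H"
    by (rule continuous_map_compose[OF _ continuous_map_join_map])
      (intro continuous_map_pairedI continuous_map_fst continuous_map_compose[OF continuous_map_snd f, unfolded o_def])
  moreover have "Q (supp (join_map \<phi> \<psi> s (f z)))" if "z \<in> topspace Z" "0 \<le> s" "s \<le> 1" for z s
  proof -
    have "f z \<in> topspace points"
      using f that(1) by (force simp: continuous_map_def)
    then show ?thesis
      using hereditaryD[OF Q assms(3)[OF that(1)] supp_join_map[OF points_facts(3) that(2,3)]] by blast
  qed
  ultimately have "continuous_map (prod_topology (top_of_set {0..1}) Z) (model Q) ?H"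
    unfolding continuous_map_into_model[OF Q] by auto
  then show ?thesis
    unfolding homotopic_with_def by (intro exI[of _ ?H]) (auto simp: join_map_0 join_map_1)
qed

definition vertex_point :: "'x \<Rightarrow> ('x \<times> real) list" where
  "vertex_point v = [(v, 1)]"

lemma normal_form_vertex: "normal_form (0, [v], \<lambda>i. if i = 0 then 1 else 0) = vertex_point v"
  by (simp add: weighted_tuple_def wnorm_def vertex_point_def)

lemma vertex_point_in_points: "vertex_point v \<in> topspace points"
  using normal_form_in_model[of "[v]" 0 "\<lambda>_. True" "\<lambda>i. if i = 0 then 1 else 0"]
  by (simp add: normal_form_vertex standard_simplex_def del: normal_form.simps)

lemma supp_vertex_point [simp]: "supp (vertex_point v) = {v}"
  by (simp add: supp_def vertex_point_def)

section \<open>Comparison with the realization\<close>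

definition realization_point :: "(nat \<times> 'x list \<times> (nat \<Rightarrow> real)) set \<Rightarrow> ('x \<times> real) list" where
  "realization_point c = normal_form (SOME p. p \<in> c)"

definition point_class :: "('x set \<Rightarrow> bool) \<Rightarrow> ('x \<times> real) list \<Rightarrow> (nat \<times> 'x list \<times> (nat \<Rightarrow> real)) set" where
  "point_class P l = realization_rel (full_complex P) `` {reduced_point l}"

lemma realization_point_class:
  "realization_point (realization_rel (full_complex P) `` {p}) = normal_form p"
proof -
  have "p \<in> realization_rel (full_complex P) `` {p}"
    using realization_rel_refl by blast
  then have "(SOME q. q \<in> realization_rel (full_complex P) `` {p}) \<in> realization_rel (full_complex P) `` {p}"
    by (rule someI)
  then have "(p, SOME q. q \<in> realization_rel (full_complex P) `` {p}) \<in> realization_rel (full_complex P)"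
    by blast
  from normal_form_rel[OF this] show ?thesis
    by (simp only: realization_point_def)
qed

lemma realization_rel_Image_eq:
  assumes "(p, q) \<in> realization_rel Y"
  shows "realization_rel Y `` {p} = realization_rel Y `` {q}"
  using realization_rel_trans[OF assms] realization_rel_trans[OF realization_rel_sym[OF assms]] by blast

lemma point_class_normal_form:
  assumes "hereditary P" "p \<in> topspace (realization_sum (full_complex P))"
  shows "point_class P (normal_form p) = realization_rel (full_complex P) `` {p}"
proof -
  obtain k xs t where "p = (k, xs, t)"
    by (rule prod_cases3)
  then have "(p, reduced_point (normal_form p)) \<in> realization_rel (full_complex P)"
    using rel_reduced_point[OF assms(1), of xs k t] assms(2)
    by (simp add: topspace_realization_sum del: normal_form.simps)
  from realization_rel_Image_eq[OF this] show ?thesis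
    by (simp only: point_class_def)
qed

lemma quotient_map_realization:
  "quotient_map (realization_sum (full_complex P)) (realization (full_complex P))
     (\<lambda>p. realization_rel (full_complex P) `` {p})"
  unfolding realization_def by (rule quotient_map_quotient_topology)

lemma topspace_realization:
  "topspace (realization Y) = (\<lambda>p. realization_rel Y `` {p}) ` topspace (realization_sum Y)"
  by (simp add: realization_def)

lemma continuous_map_realization_point:
  "continuous_map (realization (full_complex P)) (model P) realization_point"
proof (rule continuous_compose_quotient_map[OF quotient_map_realization])
  have "realization_point \<circ> (\<lambda>p. realization_rel (full_complex P) `` {p}) = normal_form"
    by (rule ext) (simp only: o_apply realization_point_class)
  then show "continuous_map (realization_sum (full_complex P)) (model P)
      (realization_point \<circ> (\<lambda>p. realization_rel (full_complex P) `` {p}))"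
    using quotient_imp_continuous_map[OF quotient_map_model[of P]] by simp
qed

lemma continuous_map_point_class:
  assumes "hereditary P"
  shows "continuous_map (model P) (realization (full_complex P)) (point_class P)"
proof (rule continuous_compose_quotient_map[OF quotient_map_model])
  show "continuous_map (realization_sum (full_complex P)) (realization (full_complex P))
      (point_class P \<circ> normal_form)"
    using quotient_imp_continuous_map[OF quotient_map_realization[of P]]
    by (rule continuous_map_eq) (simp add: point_class_normal_form[OF assms])
qed

lemma realization_point_point_class:
  assumes "hereditary P" "l \<in> topspace (model P)"
  shows "realization_point (point_class P l) = l"
proof -
  obtain k xs t where "l = normal_form (k, xs, t)" "(k, xs, t) \<in> topspace (realization_sum (full_complex P))"
    using assms(2) by (auto simp: topspace_model topspace_realization_sum)
  then show ?thesis
    using assms(1) by (simp add: point_class_normal_form realization_point_class del: normal_form.simps)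
qed

lemma realization_rel_mono:
  assumes "\<And>s. P s \<Longrightarrow> Q s"
  shows "realization_rel (full_complex P) \<subseteq> realization_rel (full_complex Q)"
proof -
  have "realization_glue (full_complex P) \<subseteq> realization_glue (full_complex Q)"
  proof -
    have 1: "face (full_complex P) = face (full_complex Q)" "degen (full_complex P) = degen (full_complex Q)"
      by (simp_all add: full_complex_def simplicial_E_def)
    have 2: "simplices (full_complex P) k \<subseteq> simplices (full_complex Q) k" for k
      using assms by auto
    show ?thesis
      unfolding realization_glue_def 1 using 2 by (intro Un_mono) blast+
  qed
  then show ?thesis
    unfolding realization_rel_def by (intro rtrancl_mono Un_mono) auto
qed

lemma realization_inclusion_class:
  assumes "\<And>s. P s \<Longrightarrow> Q s"
  shows "realization_inclusion (full_complex Q) (realization_rel (full_complex P) `` {p}) =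
     realization_rel (full_complex Q) `` {p}"
  unfolding realization_inclusion_def
proof (intro equalityI subsetI)
  fix q assume "q \<in> realization_rel (full_complex Q) `` (realization_rel (full_complex P) `` {p})"
  then obtain r where "(p, r) \<in> realization_rel (full_complex P)" "(r, q) \<in> realization_rel (full_complex Q)"
    by blast
  then show "q \<in> realization_rel (full_complex Q) `` {p}"
    using realization_rel_mono[of P Q, OF assms] realization_rel_trans[of p r "full_complex Q" q] by blast
next
  fix q assume "q \<in> realization_rel (full_complex Q) `` {p}"
  moreover have "p \<in> realization_rel (full_complex P) `` {p}"
    using realization_rel_refl by blast
  ultimately show "q \<in> realization_rel (full_complex Q) `` (realization_rel (full_complex P) `` {p})"
    by blast
qed

lemma realization_inclusion_eq:
  assumes "hereditary P" "hereditary Q" "\<And>s. P s \<Longrightarrow> Q s" "c \<in> topspace (realization (full_complex P))"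
  shows "realization_inclusion (full_complex Q) c = point_class Q (realization_point c)"
proof -
  obtain p where p: "c = realization_rel (full_complex P) `` {p}" "p \<in> topspace (realization_sum (full_complex P))"
    using assms(4) by (auto simp: topspace_realization)
  then have "p \<in> topspace (realization_sum (full_complex Q))"
    using assms(3) by (auto simp: topspace_realization_sum)
  then show ?thesis
    by (simp add: p(1) realization_inclusion_class[of P Q, OF assms(3)] realization_point_class
        point_class_normal_form[OF assms(2)])
qed

lemma realization_vertex_eq:
  assumes "hereditary P" "P {v}"
  shows "realization_vertex (full_complex P) [v] = point_class P (vertex_point v)"
  unfolding realization_vertex_def
  using point_class_normal_form[OF assms(1), of "(0, [v], \<lambda>i. if i = 0 then 1 else 0)"] assms(2)
  by (simp add: normal_form_vertex topspace_realization_sum standard_simplex_def del: normal_form.simps)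

text \<open>Homotopic spheres have homotopic images, so the union in
  \<open>homotopy_group_map\<close> is a single homotopy class, and two classes agree exactly if
  their representatives are homotopic.\<close>

lemma trivial_on_homotopy_group_iff:
  assumes j: "continuous_map X X' j"
  shows "trivial_on_homotopy_group k X x X' j \<longleftrightarrow>
     (\<forall>f. continuous_map (nsphere k) X f \<and> f sphere_base = x \<longrightarrow>
        homotopic_with (\<lambda>h. h sphere_base = j x) (nsphere k) X' (j \<circ> f) (\<lambda>_. j x))"
proof -
  have "homotopy_group_map k X' (j x) j (homotopy_class k X x f) = homotopy_class k X' (j x) (\<lambda>_. j x) \<longleftrightarrow>
      homotopic_with (\<lambda>h. h sphere_base = j x) (nsphere k) X' (j \<circ> f) (\<lambda>_. j x)"
    if f: "continuous_map (nsphere k) X f" "f sphere_base = x" for f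
  proof -
    let ?h = "homotopic_with (\<lambda>h. h sphere_base = j x) (nsphere k) X'"
    have "homotopy_group_map k X' (j x) j (homotopy_class k X x f) = {g. ?h (j \<circ> f) g}"
    proof (intro equalityI subsetI)
      fix g assume "g \<in> homotopy_group_map k X' (j x) j (homotopy_class k X x f)"
      then obtain f' where f': "homotopic_with (\<lambda>h. h sphere_base = x) (nsphere k) X f f'" "?h (j \<circ> f') g"
        by (auto simp: homotopy_group_map_def homotopy_class_def)
      have "?h (j \<circ> f) (j \<circ> f')"
        by (rule homotopic_with_compose_continuous_map_left[OF f'(1) j]) simp
      with f'(2) show "g \<in> {g. ?h (j \<circ> f) g}"
        using homotopic_with_trans by blast
    next
      fix g assume "g \<in> {g. ?h (j \<circ> f) g}"
      moreover have "homotopic_with (\<lambda>h. h sphere_base = x) (nsphere k) X f f"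
        using f by simp
      ultimately show "g \<in> homotopy_group_map k X' (j x) j (homotopy_class k X x f)"
        unfolding homotopy_group_map_def homotopy_class_def by blast
    qed
    moreover have "{g. ?h (j \<circ> f) g} = {g. ?h (\<lambda>_. j x) g} \<longleftrightarrow> ?h (j \<circ> f) (\<lambda>_. j x)"
    proof
      assume eq: "{g. ?h (j \<circ> f) g} = {g. ?h (\<lambda>_. j x) g}"
      have "?h (j \<circ> f) (j \<circ> f)"
        using f j by (simp add: continuous_map_compose)
      then have "?h (\<lambda>_. j x) (j \<circ> f)"
        using eq by blast
      then show "?h (j \<circ> f) (\<lambda>_. j x)"
        by (rule homotopic_with_symD)
    next
      assume "?h (j \<circ> f) (\<lambda>_. j x)"
      then show "{g. ?h (j \<circ> f) g} = {g. ?h (\<lambda>_. j x) g}"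
        using homotopic_with_trans homotopic_with_symD by blast
    qed
    ultimately show ?thesis
      by (simp add: homotopy_class_def)
  qed
  then show ?thesis
    unfolding trivial_on_homotopy_group_def homotopy_group_def by auto
qed

lemma sphere_base_in_nsphere: "sphere_base \<in> topspace (nsphere k)"
  by (simp add: nsphere sphere_base_def power2_eq_square if_distrib[where f = "\<lambda>x. x * _"] cong: if_cong)

text \<open>The induced map of realizations is \<open>point_class Q\<close> after
  \<open>realization_point\<close>, that is, the identity in terms of normal forms. Spheres and
  homotopies are carried back and forth by these two maps.\<close>

lemma trivial_on_homotopy_group_model:
  assumes P: "hereditary P" and Q: "hereditary Q" and PQ: "\<And>s. P s \<Longrightarrow> Q s" and v: "P {v}"
  shows "trivial_on_homotopy_group k
      (realization (full_complex P)) (realization_vertex (full_complex P) [v])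
      (realization (full_complex Q)) (realization_inclusion (full_complex Q)) \<longleftrightarrow>
    (\<forall>f. continuous_map (nsphere k) (model P) f \<and> f sphere_base = vertex_point v \<longrightarrow>
       homotopic_with (\<lambda>h. h sphere_base = vertex_point v) (nsphere k) (model Q) f (\<lambda>_. vertex_point v))"
    (is "?L \<longleftrightarrow> ?R")
proof -
  let ?X = "realization (full_complex P)" and ?Y = "realization (full_complex Q)"
  let ?x = "realization_vertex (full_complex P) [v]"
  let ?j = "realization_inclusion (full_complex Q)"
  have sub: "topspace (model P) \<subseteq> topspace (model Q)"
    using PQ by (auto simp: topspace_model_eq[OF P] topspace_model_eq[OF Q])
  have vP: "vertex_point v \<in> topspace (model P)"
    using v by (simp add: topspace_model_eq[OF P] vertex_point_in_points)
  have x: "?x = point_class P (vertex_point v)"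
    using P v by (rule realization_vertex_eq)
  have xX: "?x \<in> topspace ?X"
    unfolding x using continuous_map_point_class[OF P] vP by (force simp: continuous_map_def)
  have "continuous_map ?X ?Y (point_class Q \<circ> realization_point)"
    using continuous_map_model_mono[OF P Q PQ continuous_map_realization_point]
    by (rule continuous_map_compose[OF _ continuous_map_point_class[OF Q]])
  then have j: "continuous_map ?X ?Y ?j"
    by (rule continuous_map_eq) (simp add: realization_inclusion_eq[OF P Q PQ])
  have jx: "?j ?x = point_class Q (vertex_point v)"
    using realization_inclusion_eq[OF P Q PQ xX] by (simp add: x realization_point_point_class[OF P vP])
  show ?thesis
    unfolding trivial_on_homotopy_group_iff[OF j]
  proof (intro iffI allI impI; elim conjE)
    fix f
    assume L: "\<forall>f. continuous_map (nsphere k) ?X f \<and> f sphere_base = ?x \<longrightarrow>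
        homotopic_with (\<lambda>h. h sphere_base = ?j ?x) (nsphere k) ?Y (?j \<circ> f) (\<lambda>_. ?j ?x)"
      and f: "continuous_map (nsphere k) (model P) f" "f sphere_base = vertex_point v"
    have fP: "f z \<in> topspace (model P)" if "z \<in> topspace (nsphere k)" for z
      using f(1) that by (force simp: continuous_map_def)
    have "continuous_map (nsphere k) ?X (point_class P \<circ> f)"
      using f(1) continuous_map_point_class[OF P] by (rule continuous_map_compose)
    with L f have "homotopic_with (\<lambda>h. h sphere_base = ?j ?x) (nsphere k) ?Y
        (?j \<circ> (point_class P \<circ> f)) (\<lambda>_. ?j ?x)"
      by (simp add: x)
    from homotopic_with_compose_continuous_map_left[OF this continuous_map_realization_point[of Q],
        of "\<lambda>h. h sphere_base = vertex_point v"]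
    have "homotopic_with (\<lambda>h. h sphere_base = vertex_point v) (nsphere k) (model Q)
        (realization_point \<circ> (?j \<circ> (point_class P \<circ> f))) (realization_point \<circ> (\<lambda>_. ?j ?x))"
      using vP sub by (simp add: jx realization_point_point_class[OF Q] subset_iff)
    then show "homotopic_with (\<lambda>h. h sphere_base = vertex_point v) (nsphere k) (model Q) f (\<lambda>_. vertex_point v)"
    proof (rule homotopic_with_eq)
      fix z assume z: "z \<in> topspace (nsphere k)"
      have "point_class P (f z) \<in> topspace ?X"
        using fP[OF z] continuous_map_point_class[OF P] by (force simp: continuous_map_def)
      then show "f z = (realization_point \<circ> (?j \<circ> (point_class P \<circ> f))) z"
        using fP[OF z] sub
        by (auto simp: realization_inclusion_eq[OF P Q PQ] realization_point_point_class[OF P]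
            realization_point_point_class[OF Q] subset_iff)
    next
      show "vertex_point v = (realization_point \<circ> (\<lambda>_. ?j ?x)) z" for z
        using vP sub by (simp add: jx realization_point_point_class[OF Q] subset_iff)
    qed (auto simp: sphere_base_in_nsphere)
  next
    fix f
    assume R: ?R and f: "continuous_map (nsphere k) ?X f" "f sphere_base = ?x"
    have fX: "f z \<in> topspace ?X" if "z \<in> topspace (nsphere k)" for z
      using f(1) that by (force simp: continuous_map_def)
    have "continuous_map (nsphere k) (model P) (realization_point \<circ> f)"
      using f(1) continuous_map_realization_point by (rule continuous_map_compose)
    with R f have "homotopic_with (\<lambda>h. h sphere_base = vertex_point v) (nsphere k) (model Q)
        (realization_point \<circ> f) (\<lambda>_. vertex_point v)"
      by (simp add: x realization_point_point_class[OF P vP])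
    from homotopic_with_compose_continuous_map_left[OF this continuous_map_point_class[OF Q],
        of "\<lambda>h. h sphere_base = ?j ?x"]
    have "homotopic_with (\<lambda>h. h sphere_base = ?j ?x) (nsphere k) ?Y
        (point_class Q \<circ> (realization_point \<circ> f)) (point_class Q \<circ> (\<lambda>_. vertex_point v))"
      by (simp add: jx)
    then show "homotopic_with (\<lambda>h. h sphere_base = ?j ?x) (nsphere k) ?Y (?j \<circ> f) (\<lambda>_. ?j ?x)"
      by (rule homotopic_with_eq) (auto simp: fX realization_inclusion_eq[OF P Q PQ] jx sphere_base_in_nsphere)
  qed
qed

section \<open>Cubes and spheres\<close>

definition sphere_set :: "nat \<Rightarrow> (nat \<Rightarrow> real) set" where
  "sphere_set k = {x. (\<Sum>i\<le>k. x i ^ 2) = 1 \<and> (\<forall>i>k. x i = 0)}"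

definition cube :: "nat \<Rightarrow> (nat \<Rightarrow> real) set" where
  "cube d = {x. (\<forall>i<d. \<bar>x i\<bar> \<le> 1) \<and> (\<forall>i\<ge>d. x i = 0)}"

definition cube_boundary :: "nat \<Rightarrow> (nat \<Rightarrow> real) set" where
  "cube_boundary d = {x \<in> cube d. \<exists>i<d. \<bar>x i\<bar> = 1}"

lemma nsphere_eq: "nsphere k = top_of_set (sphere_set k)"
  unfolding nsphere sphere_set_def euclidean_product_topology ..

lemma continuous_on_coordinate [continuous_intros]: "continuous_on S (\<lambda>x. x i :: real)"
  by (rule continuous_on_subset[OF continuous_on_product_coordinates]) simp

primrec maxnorm :: "nat \<Rightarrow> (nat \<Rightarrow> real) \<Rightarrow> real" where
  "maxnorm 0 x = 0"
| "maxnorm (Suc d) x = max (maxnorm d x) \<bar>x d\<bar>"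

lemma continuous_on_maxnorm [continuous_intros]: "continuous_on S (maxnorm d)"
proof (induction d)
  case 0
  have "maxnorm 0 = (\<lambda>x. 0)"
    by (rule ext) simp
  then show ?case
    by simp
next
  case (Suc d)
  have "maxnorm (Suc d) = (\<lambda>x. max (maxnorm d x) \<bar>x d\<bar>)"
    by (rule ext) simp
  then show ?case
    using Suc by (simp only:) (intro continuous_intros)
qed

lemma maxnorm_le_iff: "0 \<le> c \<Longrightarrow> maxnorm d x \<le> c \<longleftrightarrow> (\<forall>i<d. \<bar>x i\<bar> \<le> c)"
  by (induction d) (auto simp: less_Suc_eq)

lemma le_maxnorm: "i < d \<Longrightarrow> \<bar>x i\<bar> \<le> maxnorm d x"
  by (induction d) (auto simp: less_Suc_eq le_max_iff_disj)

lemma maxnorm_attained: "0 < maxnorm d x \<Longrightarrow> \<exists>i<d. \<bar>x i\<bar> = maxnorm d x"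
proof (induction d)
  case (Suc d)
  show ?case
  proof (cases "maxnorm d x \<le> \<bar>x d\<bar>")
    case True
    then show ?thesis
      by (intro exI[of _ d]) simp
  next
    case False
    then have "0 < maxnorm d x"
      by linarith
    then obtain i where "i < d" "\<bar>x i\<bar> = maxnorm d x"
      using Suc.IH by auto
    then show ?thesis
      using False by (intro exI[of _ i]) simp
  qed
qed simp

lemma maxnorm_divide: "0 < c \<Longrightarrow> maxnorm d (\<lambda>i. x i / c) = maxnorm d x / c"
  by (induction d) (simp_all add: max_divide_distrib_right)

lemma maxnorm_cube_boundary:
  assumes "x \<in> cube_boundary d"
  shows "maxnorm d x = 1"
proof (rule antisym)
  show "maxnorm d x \<le> 1"
    using assms by (subst maxnorm_le_iff) (auto simp: cube_boundary_def cube_def)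
  obtain i where "i < d" "\<bar>x i\<bar> = 1"
    using assms by (auto simp: cube_boundary_def)
  then show "1 \<le> maxnorm d x"
    using le_maxnorm[of i d x] by simp
qed

declare maxnorm.simps [simp del]

text \<open>Radial projections: \<open>to_cube\<close> divides by the sup norm and
  \<open>to_sphere\<close> by the Euclidean norm of the first k + 1 coordinates. They are inverse to
  each other between the sphere and the cube boundary, and both fix
  \<open>sphere_base\<close>.\<close>

definition to_cube :: "nat \<Rightarrow> (nat \<Rightarrow> real) \<Rightarrow> nat \<Rightarrow> real" where
  "to_cube k x = (\<lambda>i. x i / maxnorm (Suc k) x)"

definition to_sphere :: "nat \<Rightarrow> (nat \<Rightarrow> real) \<Rightarrow> nat \<Rightarrow> real" where
  "to_sphere k x = (\<lambda>i. x i / sqrt (\<Sum>i\<le>k. x i ^ 2))"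

lemma maxnorm_sphere_pos:
  assumes "x \<in> sphere_set k"
  shows "0 < maxnorm (Suc k) x"
proof (rule ccontr)
  assume "\<not> 0 < maxnorm (Suc k) x"
  then have "\<bar>x i\<bar> \<le> 0" if "i \<le> k" for i
    using le_maxnorm[of i "Suc k" x] that by (simp)
  then have "(\<Sum>i\<le>k. x i ^ 2) = 0"
    by simp
  then show False
    using assms by (simp add: sphere_set_def)
qed

lemma to_cube_in:
  assumes "x \<in> sphere_set k"
  shows "to_cube k x \<in> cube_boundary (Suc k)"
proof -
  have pos: "0 < maxnorm (Suc k) x"
    using assms by (rule maxnorm_sphere_pos)
  then obtain i where "i < Suc k" "\<bar>x i\<bar> = maxnorm (Suc k) x"
    using maxnorm_attained by blast
  then have "\<exists>i<Suc k. \<bar>to_cube k x i\<bar> = 1"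
    using pos by (intro exI[of _ i]) (simp add: to_cube_def)
  moreover have "to_cube k x \<in> cube (Suc k)"
    using assms pos le_maxnorm[of _ "Suc k" x]
    by (auto simp: cube_def to_cube_def sphere_set_def Suc_le_eq)
  ultimately show ?thesis
    by (simp add: cube_boundary_def)
qed

lemma sum_squares_pos:
  assumes "0 < maxnorm (Suc k) x"
  shows "0 < (\<Sum>i\<le>k. x i ^ 2)"
proof -
  obtain i where i: "i < Suc k" "\<bar>x i\<bar> = maxnorm (Suc k) x"
    using maxnorm_attained[OF assms] by blast
  then have "0 < x i ^ 2"
    using assms by (simp)
  also have "\<dots> \<le> (\<Sum>i\<le>k. x i ^ 2)"
    using i by (intro member_le_sum) auto
  finally show ?thesis .
qed

lemma to_sphere_in:
  assumes "0 < maxnorm (Suc k) x" "\<forall>i>k. x i = 0"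
  shows "to_sphere k x \<in> sphere_set k"
proof -
  have "(\<Sum>i\<le>k. (to_sphere k x i)\<^sup>2) = (\<Sum>i\<le>k. x i ^ 2) / (\<Sum>i\<le>k. x i ^ 2)"
    by (simp add: to_sphere_def power_divide sum_nonneg flip: sum_divide_distrib)
  then show ?thesis
    using sum_squares_pos[OF assms(1)] assms(2) by (simp add: sphere_set_def to_sphere_def)
qed

lemma cube_boundary_tail: "x \<in> cube_boundary (Suc k) \<Longrightarrow> \<forall>i>k. x i = 0"
  by (auto simp: cube_boundary_def cube_def)

lemma to_sphere_cube_boundary: "x \<in> cube_boundary (Suc k) \<Longrightarrow> to_sphere k x \<in> sphere_set k"
  using maxnorm_cube_boundary[of x "Suc k"] cube_boundary_tail by (intro to_sphere_in) auto

lemma to_sphere_to_cube: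
  assumes "x \<in> sphere_set k"
  shows "to_sphere k (to_cube k x) = x"
proof -
  have pos: "0 < maxnorm (Suc k) x"
    using assms by (rule maxnorm_sphere_pos)
  have "(\<Sum>i\<le>k. (to_cube k x i)\<^sup>2) = (\<Sum>i\<le>k. x i ^ 2) / (maxnorm (Suc k) x)\<^sup>2"
    by (simp add: to_cube_def power_divide flip: sum_divide_distrib)
  also have "\<dots> = (1 / maxnorm (Suc k) x)\<^sup>2"
    using assms by (simp add: sphere_set_def power_divide)
  finally have "sqrt (\<Sum>i\<le>k. (to_cube k x i)\<^sup>2) = 1 / maxnorm (Suc k) x"
    using pos by (simp)
  then show ?thesis
    using pos by (simp add: to_sphere_def) (simp add: to_cube_def fun_eq_iff)
qed

lemma to_cube_to_sphere:
  assumes "x \<in> cube_boundary (Suc k)"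
  shows "to_cube k (to_sphere k x) = x"
proof -
  have 1: "maxnorm (Suc k) x = 1"
    using assms by (rule maxnorm_cube_boundary)
  have pos: "0 < sqrt (\<Sum>i\<le>k. x i ^ 2)"
    using sum_squares_pos[of k x] 1 by (simp)
  have "maxnorm (Suc k) (to_sphere k x) = 1 / sqrt (\<Sum>i\<le>k. x i ^ 2)"
    unfolding to_sphere_def maxnorm_divide[OF pos] 1 ..
  then show ?thesis
    using pos by (simp add: to_cube_def[of k "to_sphere k x"]) (simp add: to_sphere_def fun_eq_iff)
qed

lemma continuous_on_to_cube: "continuous_on (sphere_set k) (to_cube k)"
  unfolding to_cube_def using maxnorm_sphere_pos
  by (intro continuous_intros) (auto simp: less_le)

lemma continuous_on_to_sphere:
  assumes "\<And>x. x \<in> S \<Longrightarrow> 0 < maxnorm (Suc k) x"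
  shows "continuous_on S (to_sphere k)"
  unfolding to_sphere_def using sum_squares_pos[OF assms]
  by (intro continuous_intros) (auto simp: less_le)

lemma continuous_map_to_cube:
  "continuous_map (nsphere k) (top_of_set (cube_boundary (Suc k))) (to_cube k)"
  unfolding nsphere_eq using to_cube_in continuous_on_to_cube by (auto simp: continuous_map_in_subtopology)

lemma continuous_map_to_sphere:
  "continuous_map (top_of_set (cube_boundary (Suc k))) (nsphere k) (to_sphere k)"
  unfolding nsphere_eq using to_sphere_cube_boundary maxnorm_cube_boundary[of _ "Suc k"]
  by (auto simp: continuous_map_in_subtopology intro!: continuous_on_to_sphere)

lemma sphere_base_in_sphere_set: "sphere_base \<in> sphere_set k"
  using sphere_base_in_nsphere[of k] by (simp add: nsphere_eq)

lemma to_cube_base [simp]: "to_cube k sphere_base = sphere_base"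
proof -
  have "maxnorm (Suc d) sphere_base = 1" for d
    by (induction d) (auto simp: sphere_base_def maxnorm.simps)
  then show ?thesis
    by (simp add: to_cube_def)
qed

lemma sphere_base_in_cube_boundary: "sphere_base \<in> cube_boundary (Suc k)"
  using to_cube_in[OF sphere_base_in_sphere_set, of k] by simp

lemma to_sphere_base [simp]: "to_sphere k sphere_base = sphere_base"
  using to_sphere_to_cube[OF sphere_base_in_sphere_set, of k] by simp

lemma homotopic_with_trueE:
  assumes "homotopic_with (\<lambda>_. True) Z X f g"
  obtains H where "continuous_map (prod_topology (top_of_set {0..1::real}) Z) X H"
    "\<And>x. H (0, x) = f x" "\<And>x. H (1, x) = g x"
proof -
  from assms[unfolded homotopic_with_def]
  obtain H where "continuous_map (prod_topology (top_of_set {0..1::real}) Z) X H \<and> (\<forall>x. H (0, x) = f x) \<and>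
      (\<forall>x. H (1, x) = g x) \<and> (\<forall>t\<in>{0..1::real}. True)" ..
  then show ?thesis
    using that[of H] by simp
qed

lemma homotopic_with_trueI:
  assumes "continuous_map (prod_topology (top_of_set {0..1::real}) Z) X H"
    "\<And>x. x \<in> topspace Z \<Longrightarrow> H (0, x) = f x" "\<And>x. x \<in> topspace Z \<Longrightarrow> H (1, x) = g x"
  shows "homotopic_with (\<lambda>_. True) Z X f g"
proof (subst homotopic_with)
  show "\<exists>h. continuous_map (prod_topology (top_of_set {0..1::real}) Z) X h \<and>
      (\<forall>x\<in>topspace Z. h (0, x) = f x) \<and> (\<forall>x\<in>topspace Z. h (1, x) = g x) \<and> (\<forall>t\<in>{0..1::real}. True)"
    using assms by (intro exI[of _ H]) simp
qed simp

lemma continuous_on_snd_coordinate: "continuous_on S (\<lambda>p. snd p i :: real)"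
  by (rule continuous_on_product_then_coordinatewise[OF continuous_on_snd[OF continuous_on_id]])

lemma pasting_two_closed:
  assumes "closedin X A" "closedin X B" "topspace X \<subseteq> A \<union> B"
    and f: "continuous_map (subtopology X A) Y f" and g: "continuous_map (subtopology X B) Y g"
    and fg: "\<And>x. x \<in> A \<Longrightarrow> x \<in> B \<Longrightarrow> f x = g x"
  shows "continuous_map X Y (\<lambda>x. if x \<in> A then f x else g x)"
proof (rule pasting_lemma_closed[where I = "{True, False}" and T = "\<lambda>b. if b then A else B"
      and f = "\<lambda>b. if b then f else g"])
  show "\<exists>j. j \<in> {True, False} \<and> x \<in> (if j then A else B) \<and>
      (if x \<in> A then f x else g x) = (if j then f else g) x" if "x \<in> topspace X" for x
    using that assms(3) by (cases "x \<in> A") (auto intro: exI[of _ True] exI[of _ False])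
qed (use assms in auto)

text \<open>The null homotopy is spread along the radii of the outer shell, and the inner cube of
  half size is sent to its end value. This keeps \<open>to_sphere\<close> away from the origin,
  where it is not continuous.\<close>

lemma extend_over_cube:
  assumes f: "continuous_map (top_of_set (cube_boundary (Suc k))) X f"
    and null: "homotopic_with (\<lambda>_. True) (nsphere k) X (f \<circ> to_cube k) (\<lambda>_. c)"
  obtains F where "continuous_map (top_of_set (cube (Suc k))) X F"
    "\<And>x. x \<in> cube_boundary (Suc k) \<Longrightarrow> F x = f x"
proof -
  let ?d = "Suc k"
  obtain H where H: "continuous_map (prod_topology (top_of_set {0..1::real}) (nsphere k)) X H"
    "\<And>x. H (0, x) = f (to_cube k x)" "\<And>x. H (1, x) = c"
    using null by (rule homotopic_with_trueE) (simp add: o_def)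
  have "H (1, sphere_base) \<in> topspace X"
    using H(1) sphere_base_in_nsphere[of k] unfolding continuous_map_def by force
  then have c: "c \<in> topspace X"
    by (simp add: H(3))
  let ?A = "{x \<in> cube ?d. maxnorm ?d x \<le> 1/2}" and ?B = "{x \<in> cube ?d. 1/2 \<le> maxnorm ?d x}"
  \<comment> \<open>The time is 0 on the boundary and 1 where the sup norm is 1/2.\<close>
  define G where "G x = H (2 - 2 * maxnorm ?d x, to_sphere k x)" for x
  have cl: "closedin (top_of_set (cube ?d)) {x \<in> cube ?d. maxnorm ?d x \<in> C}" if "closed C" for C
  proof -
    have "{x \<in> cube ?d. maxnorm ?d x \<in> C} = cube ?d \<inter> maxnorm ?d -` C"
      by auto
    then show ?thesis
      using continuous_closedin_preimage[OF continuous_on_maxnorm that] by simp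
  qed
  have "continuous_map (top_of_set (cube ?d)) X (\<lambda>x. if x \<in> ?A then c else G x)"
  proof (rule pasting_two_closed)
    show "closedin (top_of_set (cube ?d)) ?A" "closedin (top_of_set (cube ?d)) ?B"
      using cl[of "{..1/2}"] cl[of "{1/2..}"] by simp_all
    have "continuous_map (top_of_set ?B) (prod_topology (top_of_set {0..1::real}) (nsphere k))
        (\<lambda>x. (2 - 2 * maxnorm ?d x, to_sphere k x))"
    proof (intro continuous_map_pairedI)
      have "maxnorm ?d x \<le> 1" if "x \<in> cube ?d" for x
        using that maxnorm_le_iff[of 1 ?d x] by (simp add: cube_def)
      then show "continuous_map (top_of_set ?B) (top_of_set {0..1::real}) (\<lambda>x. 2 - 2 * maxnorm ?d x)"
        by (auto simp: continuous_map_in_subtopology intro!: continuous_intros)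
      show "continuous_map (top_of_set ?B) (nsphere k) (to_sphere k)"
        unfolding nsphere_eq
        by (auto simp: continuous_map_in_subtopology cube_def
            intro!: continuous_on_to_sphere to_sphere_in)
    qed
    from continuous_map_compose[OF this H(1)]
    have "continuous_map (top_of_set ?B) X G"
      by (simp add: o_def G_def[abs_def])
    moreover have "subtopology (top_of_set (cube ?d)) ?B = top_of_set ?B"
      by (simp add: subtopology_subtopology Int_def)
    ultimately show "continuous_map (subtopology (top_of_set (cube ?d)) ?B) X G"
      by simp
    show "c = G x" if "x \<in> ?A" "x \<in> ?B" for x
    proof -
      have "2 - 2 * maxnorm ?d x = 1"
        using that by simp
      then show ?thesis
        by (simp only: G_def H(3))
    qed
  qed (use c in auto)
  moreover have "(if x \<in> ?A then c else G x) = f x" if "x \<in> cube_boundary ?d" for x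
    using that maxnorm_cube_boundary[OF that] to_cube_to_sphere[OF that]
    by (simp add: G_def H(2))
  ultimately show ?thesis
    using that by blast
qed

text \<open>The straight-line contraction of the cube to \<open>sphere_base\<close> keeps this point
  fixed, so the resulting homotopy is based.\<close>

lemma null_homotopic_from_cube:
  assumes F: "continuous_map (top_of_set (cube (Suc k))) X F"
  shows "homotopic_with (\<lambda>h. h sphere_base = F sphere_base) (nsphere k) X (F \<circ> to_cube k)
    (\<lambda>_. F sphere_base)"
proof -
  let ?l = "\<lambda>(s, x) i. (1 - s) * to_cube k x i + s * sphere_base i"
  have "continuous_on ({0..1} \<times> sphere_set k) (\<lambda>p::real \<times> (nat \<Rightarrow> real). to_cube k (snd p))"
    by (rule continuous_on_compose2[OF continuous_on_to_cube continuous_on_snd[OF continuous_on_id]]) auto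
  note tc = continuous_on_product_then_coordinatewise[OF this]
  have "continuous_on ({0..1} \<times> sphere_set k) ?l"
    unfolding case_prod_beta
    by (intro continuous_on_coordinatewise_then_product continuous_on_add continuous_on_mult
        continuous_on_diff continuous_on_const continuous_on_fst continuous_on_id tc)
  moreover have "?l (s, x) \<in> cube (Suc k)" if "s \<in> {0..1}" "x \<in> sphere_set k" for s x
  proof -
    have "\<bar>(1 - s) * to_cube k x i + s * sphere_base i\<bar> \<le> 1" if i: "i < Suc k" for i
    proof -
      have "\<bar>to_cube k x i\<bar> \<le> 1" "\<bar>sphere_base i\<bar> \<le> 1"
        using to_cube_in[OF \<open>x \<in> _\<close>] i by (auto simp: cube_boundary_def cube_def sphere_base_def)
      then have "\<bar>(1 - s) * to_cube k x i\<bar> \<le> 1 - s" "\<bar>s * sphere_base i\<bar> \<le> s"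
        using \<open>s \<in> _\<close> by (auto simp: abs_mult mult_left_le)
      then show ?thesis
        by linarith
    qed
    moreover have "to_cube k x i = 0" "sphere_base i = 0" if "i \<ge> Suc k" for i
      using to_cube_in[OF \<open>x \<in> _\<close>] that by (auto simp: cube_boundary_def cube_def sphere_base_def)
    ultimately show ?thesis
      by (simp add: cube_def)
  qed
  ultimately have "continuous_map (prod_topology (top_of_set {0..1::real}) (nsphere k)) (top_of_set (cube (Suc k))) ?l"
    unfolding nsphere_eq by (auto simp: continuous_map_in_subtopology)
  from continuous_map_compose[OF this F] show ?thesis
    unfolding homotopic_with_def by (intro exI[of _ "F \<circ> ?l"]) (auto simp: algebra_simps)
qed

section \<open>Changing the base point\<close>

text \<open>\<open>sphere_base\<close> is the centre of the face where coordinate 0 equals 1.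
  Coordinate 0 is stretched so that [0, 1] goes to 1, every other coordinate so that [-1/2, 1/2]
  goes to 0. The values 1 and -1 stay fixed, so each face of the cube is mapped to itself.\<close>

definition squeeze :: "nat \<Rightarrow> real \<Rightarrow> real" where
  "squeeze i t = (if i = 0 then min 1 (2 * t + 1) else max 0 (2 * t - 1) + min 0 (2 * t + 1))"

definition centrality :: "nat \<Rightarrow> real \<Rightarrow> real" where
  "centrality i t = (if i = 0 then t else 1 - 2 * \<bar>t\<bar>)"

lemma squeeze_facts:
  "\<bar>t\<bar> \<le> 1 \<Longrightarrow> \<bar>squeeze i t\<bar> \<le> 1" "squeeze i 1 = 1" "squeeze i (-1) = -1"
  by (auto simp: squeeze_def abs_if min_def max_def)

lemma squeeze_central: "0 \<le> centrality i t \<Longrightarrow> squeeze i t = sphere_base i"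
  by (cases "i = 0") (auto simp: squeeze_def centrality_def sphere_base_def abs_if split: if_splits)

lemma continuous_on_squeeze [continuous_intros]:
  "continuous_on S f \<Longrightarrow> continuous_on S (\<lambda>x. squeeze i (f x))"
  unfolding squeeze_def by (cases "i = 0") (auto intro!: continuous_intros)

lemma continuous_on_centrality [continuous_intros]:
  "continuous_on S f \<Longrightarrow> continuous_on S (\<lambda>x. centrality i (f x))"
  unfolding centrality_def by (cases "i = 0") (auto intro!: continuous_intros)

text \<open>
  \<open>squeeze\<close> collapses a neighbourhood of the base point, where \<open>centrality\<close> is nonnegative in
  every coordinate, to the base point; the path is inserted there.
\<close>

lemma change_base_cube:
  assumes f: "continuous_map (top_of_set (cube_boundary d)) X f"
    and \<gamma>: "continuous_map (top_of_set {0..1::real}) X \<gamma>" "\<gamma> 0 = f sphere_base"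
    and d: "0 < d"
  obtains f' where "homotopic_with (\<lambda>_. True) (top_of_set (cube_boundary d)) X f f'"
    "f' sphere_base = \<gamma> 1"
proof -
  let ?B = "cube_boundary d"
  \<comment> \<open>The linear homotopy from the identity to the squeeze. A coordinate equal to 1 or
    -1 never moves, so the homotopy stays in the boundary.\<close>
  define \<phi> where "\<phi> = (\<lambda>(s, x) i. if i < d then (1 - s) * x i + s * squeeze i (x i) else 0)"
  \<comment> \<open>\<open>r\<close> is 1 at the base point and 0 as soon as some coordinate is not
    central. On the rim of the central region the inserted value \<gamma> 0 therefore matches
    \<open>f sphere_base\<close>, and at time 1 the base point goes to \<gamma> 1.\<close>
  define r where "r x = (\<Prod>i<d. max 0 (centrality i (x i)))" for x
  have \<phi>_in: "\<phi> (s, x) \<in> ?B" if s: "0 \<le> s" "s \<le> 1" and x: "x \<in> ?B" for s x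
  proof -
    have "\<bar>(1 - s) * x i + s * squeeze i (x i)\<bar> \<le> 1" if i: "i < d" for i
    proof -
      have "\<bar>x i\<bar> \<le> 1"
        using x i by (auto simp: cube_boundary_def cube_def)
      then have "\<bar>(1 - s) * x i\<bar> \<le> 1 - s" "\<bar>s * squeeze i (x i)\<bar> \<le> s"
        using s squeeze_facts(1) by (auto simp: abs_mult mult_left_le)
      then show ?thesis
        by linarith
    qed
    moreover obtain i where i: "i < d" "\<bar>x i\<bar> = 1"
      using x by (auto simp: cube_boundary_def)
    then have "x i = 1 \<or> x i = -1"
      by linarith
    then have "\<bar>(1 - s) * x i + s * squeeze i (x i)\<bar> = 1"
      using squeeze_facts(2,3)[of i] by auto
    ultimately show ?thesis
      using i unfolding cube_boundary_def cube_def \<phi>_def by auto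
  qed
  have "continuous_on ({0..1} \<times> ?B) \<phi>"
  proof (rule continuous_on_coordinatewise_then_product)
    fix i
    have "continuous_on ({0..1} \<times> ?B) (\<lambda>p. (1 - fst p) * snd p i + fst p * squeeze i (snd p i))"
      by (intro continuous_intros continuous_on_snd_coordinate)
    then show "continuous_on ({0..1} \<times> ?B) (\<lambda>p. \<phi> p i)"
      unfolding \<phi>_def case_prod_beta by (cases "i < d") auto
  qed
  then have \<phi>: "continuous_map (prod_topology (top_of_set {0..1::real}) (top_of_set ?B)) (top_of_set ?B) \<phi>"
    using \<phi>_in by (auto simp: continuous_map_in_subtopology)
  have h1: "homotopic_with (\<lambda>_. True) (top_of_set ?B) X f (\<lambda>x. f (\<phi> (1, x)))"
  proof -
    have "\<phi> (0, x) = x" if "x \<in> ?B" for x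
      using that by (auto simp: \<phi>_def fun_eq_iff cube_boundary_def cube_def)
    then show ?thesis
      by (intro homotopic_with_trueI[OF continuous_map_compose[OF \<phi> f]]) auto
  qed
  let ?Z = "prod_topology (top_of_set {0..1::real}) (top_of_set ?B)"
  let ?C = "{p \<in> {0..1::real} \<times> ?B. \<forall>i<d. 0 \<le> centrality i (snd p i)}"
  let ?D = "{p \<in> {0..1::real} \<times> ?B. \<exists>i<d. centrality i (snd p i) \<le> 0}"
  have Z: "?Z = top_of_set ({0..1} \<times> ?B)"
    by simp
  have cont_c: "continuous_on ({0..1} \<times> ?B) (\<lambda>p. centrality i (snd p i))" for i
    by (intro continuous_intros continuous_on_snd_coordinate)
  have clc: "closedin ?Z {p \<in> {0..1::real} \<times> ?B. centrality i (snd p i) \<in> K}" if "closed K" for i K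
    unfolding Z using continuous_closedin_preimage[OF cont_c that, of i] by (simp add: vimage_def Int_def)
  have r1: "r x \<in> {0..1}" if "x \<in> ?B" for x
  proof -
    have "max 0 (centrality i (x i)) \<le> 1" if "i < d" for i
      using \<open>x \<in> ?B\<close> that by (force simp: cube_boundary_def cube_def centrality_def)
    then have "r x \<le> (\<Prod>i<d. 1)"
      unfolding r_def by (intro prod_mono) auto
    then show ?thesis
      by (simp add: r_def prod_nonneg)
  qed
  have cont_r: "continuous_on ({0..1} \<times> ?B) (\<lambda>p. r (snd p))"
    unfolding r_def by (intro continuous_intros continuous_on_snd_coordinate)
  have \<phi>_central: "\<phi> (1, x) = sphere_base" if "\<forall>i<d. 0 \<le> centrality i (x i)" for x
    using that squeeze_central d by (auto simp: \<phi>_def fun_eq_iff sphere_base_def)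
  define H where "H p = (if p \<in> ?C then \<gamma> (fst p * r (snd p)) else f (\<phi> (1, snd p)))" for p
  have "continuous_map ?Z X H"
    unfolding H_def
  proof (rule pasting_two_closed)
    have "?C = {0..1} \<times> ?B \<inter> (\<Inter>i\<in>{..<d}. {p \<in> {0..1::real} \<times> ?B. centrality i (snd p i) \<in> {0..}})"
      by auto
    moreover have "closedin ?Z ({0..1} \<times> ?B \<inter> (\<Inter>i\<in>{..<d}. {p \<in> {0..1::real} \<times> ?B. centrality i (snd p i) \<in> {0..}}))"
      using d by (intro closedin_Int closedin_INT clc) (auto simp: Z)
    ultimately show "closedin ?Z ?C"
      by (simp only:)
    have "?D = (\<Union>i\<in>{..<d}. {p \<in> {0..1::real} \<times> ?B. centrality i (snd p i) \<in> {..0}})"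
      by auto
    moreover have "closedin ?Z (\<Union>i\<in>{..<d}. {p \<in> {0..1::real} \<times> ?B. centrality i (snd p i) \<in> {..0}})"
      by (intro closedin_Union) (use clc[of "{..0}"] in auto)
    ultimately show "closedin ?Z ?D"
      by simp
    have "continuous_on ({0..1} \<times> ?B) (\<lambda>p. fst p * r (snd p))"
      using cont_r by (intro continuous_intros)
    moreover have "fst p * r (snd p) \<in> {0..1}" if "p \<in> {0..1} \<times> ?B" for p
      using that r1[of "snd p"] by (auto simp: mult_le_one)
    ultimately have "continuous_map ?Z (top_of_set {0..1::real}) (\<lambda>p. fst p * r (snd p))"
      unfolding Z by (auto simp: continuous_map_in_subtopology)
    from continuous_map_compose[OF this \<gamma>(1)]
    show "continuous_map (subtopology ?Z ?C) X (\<lambda>p. \<gamma> (fst p * r (snd p)))"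
      by (intro continuous_map_from_subtopology) (simp add: o_def)
    have "continuous_map ?Z ?Z (\<lambda>p. (1, snd p))"
      by (intro continuous_map_pairedI continuous_map_snd) (auto simp: continuous_map_in_subtopology)
    from continuous_map_compose[OF continuous_map_compose[OF this \<phi>] f]
    show "continuous_map (subtopology ?Z ?D) X (\<lambda>p. f (\<phi> (1, snd p)))"
      by (intro continuous_map_from_subtopology) (simp add: o_def)
    show "topspace ?Z \<subseteq> ?C \<union> ?D"
      by (auto simp: not_le)
    fix p assume p: "p \<in> ?C" "p \<in> ?D"
    then have "\<phi> (1, snd p) = sphere_base"
      by (intro \<phi>_central) simp
    moreover have "r (snd p) = 0"
    proof -
      obtain i where i: "i < d" "centrality i (snd p i) \<le> 0"
        using p(2) by blast
      then have "max 0 (centrality i (snd p i)) = 0"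
        by simp
      with i show ?thesis
        unfolding r_def by (intro prod_zero bexI[of _ i]) simp_all
    qed
    ultimately show "\<gamma> (fst p * r (snd p)) = f (\<phi> (1, snd p))"
      by (simp add: \<gamma>(2))
  qed
  then have "homotopic_with (\<lambda>_. True) (top_of_set ?B) X (\<lambda>x. f (\<phi> (1, x))) (\<lambda>x. H (1, x))"
  proof (rule homotopic_with_trueI)
    fix x assume "x \<in> topspace (top_of_set ?B)"
    then show "H (0, x) = f (\<phi> (1, x))"
      using \<phi>_central[of x] by (simp add: H_def \<gamma>(2))
  qed simp
  with h1 have "homotopic_with (\<lambda>_. True) (top_of_set ?B) X f (\<lambda>x. H (1, x))"
    by (rule homotopic_with_trans)
  moreover have "H (1, sphere_base) = \<gamma> 1"
  proof -
    obtain k where k: "d = Suc k"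
      using d by (cases d) auto
    have "centrality i (sphere_base i) = 1" for i
      by (auto simp: centrality_def sphere_base_def)
    then show ?thesis
      using sphere_base_in_cube_boundary[of k] by (simp add: H_def r_def k)
  qed
  ultimately show ?thesis
    using that by blast
qed

lemma change_base_sphere:
  assumes f: "continuous_map (nsphere k) X f"
    and \<gamma>: "continuous_map (top_of_set {0..1::real}) X \<gamma>" "\<gamma> 0 = f sphere_base"
  obtains f' where "homotopic_with (\<lambda>_. True) (nsphere k) X f f'" "f' sphere_base = \<gamma> 1"
proof -
  have "continuous_map (top_of_set (cube_boundary (Suc k))) X (f \<circ> to_sphere k)"
    using continuous_map_to_sphere f by (rule continuous_map_compose)
  then obtain f' where f': "homotopic_with (\<lambda>_. True) (top_of_set (cube_boundary (Suc k))) X (f \<circ> to_sphere k) f'"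
    "f' sphere_base = \<gamma> 1"
    using change_base_cube[OF _ \<gamma>(1), of "Suc k" "f \<circ> to_sphere k"] \<gamma>(2) by auto
  have "homotopic_with (\<lambda>_. True) (nsphere k) X (f \<circ> to_sphere k \<circ> to_cube k) (f' \<circ> to_cube k)"
    by (rule homotopic_with_compose_continuous_map_right[OF f'(1) continuous_map_to_cube]) auto
  then have "homotopic_with (\<lambda>_. True) (nsphere k) X f (f' \<circ> to_cube k)"
    by (rule homotopic_with_eq) (auto simp: nsphere_eq to_sphere_to_cube)
  then show ?thesis
    using that f'(2) by simp
qed

section \<open>Boxes and grids\<close>

definition box_set :: "(nat \<Rightarrow> real) \<Rightarrow> (nat \<Rightarrow> real) \<Rightarrow> (nat \<Rightarrow> real) set" where
  "box_set l u = {x. \<forall>i. l i \<le> x i \<and> x i \<le> u i}"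

text \<open>Degenerate coordinates are allowed, so boxes of all dimensions lie in one ambient space.
  The boundary is the relative one and is empty for a single point.\<close>

definition box_boundary :: "(nat \<Rightarrow> real) \<Rightarrow> (nat \<Rightarrow> real) \<Rightarrow> (nat \<Rightarrow> real) set" where
  "box_boundary l u = {x \<in> box_set l u. \<exists>i. l i < u i \<and> (x i = l i \<or> x i = u i)}"

text \<open>No inclusion map occurs because the models of two nested complexes share their points.
  The homotopy is free and its end \<open>c\<close> depends on the sphere.\<close>

definition sphere_null :: "nat \<Rightarrow> 'a topology \<Rightarrow> 'a topology \<Rightarrow> bool" where
  "sphere_null k X' X \<longleftrightarrow>
     (\<forall>f. continuous_map (nsphere k) X' f \<longrightarrow>
        (\<exists>c. homotopic_with (\<lambda>_. True) (nsphere k) X f (\<lambda>_. c)))"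

lemma closed_box_set: "closed (box_set l u)"
proof -
  have "box_set l u = (\<Inter>i. {x. l i \<le> x i \<and> x i \<le> u i})"
    by (auto simp: box_set_def)
  moreover have "closed {x. l i \<le> x i \<and> x i \<le> u i}" for i
    by (intro closed_Collect_conj closed_Collect_le continuous_on_const continuous_on_coordinate)
  ultimately show ?thesis
    by auto
qed

text \<open>Affine rescaling of the nondegenerate coordinates, enumerated by \<open>e\<close>.
  \<open>B\<close> restores the degenerate coordinates as constants, which is why it inverts
  \<open>A\<close> on the box only.\<close>

lemma box_cube_maps:
  assumes lu: "\<And>i. l i \<le> u i" and fin: "finite {i. l i < u i}" and d: "card {i. l i < u i} = d"
  obtains A B where
    "continuous_on UNIV A" "continuous_on UNIV B"
    "\<And>x. x \<in> box_set l u \<Longrightarrow> A x \<in> cube d"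
    "\<And>x. x \<in> box_boundary l u \<Longrightarrow> A x \<in> cube_boundary d"
    "\<And>y. y \<in> cube_boundary d \<Longrightarrow> B y \<in> box_boundary l u"
    "\<And>x. x \<in> box_set l u \<Longrightarrow> B (A x) = x"
proof -
  define J where "J = {i. l i < u i}"
  obtain e where e: "bij_betw e {..<d} J"
    using ex_bij_betw_nat_finite[OF fin] d by (auto simp: J_def atLeast0LessThan)
  define e' where "e' = inv_into {..<d} e"
  have eJ: "e i \<in> J" if "i < d" for i
    using e that by (auto simp: bij_betw_def)
  have e'd: "e' j < d" "e (e' j) = j" if "j \<in> J" for j
    using bij_betw_inv_into_right[OF e that] bij_betw_apply[OF bij_betw_inv_into[OF e] that]
    by (auto simp: e'_def)
  have e'e: "e' (e i) = i" if "i < d" for i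
    using bij_betw_inv_into_left[OF e] that by (simp add: e'_def)
  have pos: "0 < u j - l j" if "j \<in> J" for j
    using that by (simp add: J_def)
  define A where "A x i = (if i < d then (2 * x (e i) - l (e i) - u (e i)) / (u (e i) - l (e i)) else 0)" for x i
  define B where "B y j = (if j \<in> J then (l j + u j + y (e' j) * (u j - l j)) / 2 else l j)" for y j
  have A1: "continuous_on UNIV A"
  proof (rule continuous_on_coordinatewise_then_product)
    fix i
    show "continuous_on UNIV (\<lambda>x. A x i)"
      using pos[OF eJ, of i] unfolding A_def by (cases "i < d") (auto intro!: continuous_intros)
  qed
  have B1: "continuous_on UNIV B"
  proof (rule continuous_on_coordinatewise_then_product)
    fix j
    show "continuous_on UNIV (\<lambda>y. B y j)"
      unfolding B_def by (cases "j \<in> J") (auto intro!: continuous_intros)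
  qed
  have bound: "\<bar>A x i\<bar> \<le> 1" if "x \<in> box_set l u" "i < d" for x i
  proof -
    have "l (e i) \<le> x (e i)" "x (e i) \<le> u (e i)"
      using that(1) by (auto simp: box_set_def)
    then have "\<bar>2 * x (e i) - l (e i) - u (e i)\<bar> \<le> u (e i) - l (e i)"
      by linarith
    then show ?thesis
      using pos[OF eJ[OF that(2)]] that(2) by (simp add: A_def abs_divide)
  qed
  have A2: "A x \<in> cube d" if "x \<in> box_set l u" for x
    using bound[OF that] by (auto simp: cube_def A_def[of x])
  have A3: "A x \<in> cube_boundary d" if x: "x \<in> box_boundary l u" for x
  proof -
    obtain j where j: "j \<in> J" "x j = l j \<or> x j = u j"
      using x by (auto simp: box_boundary_def J_def)
    have "A x (e' j) = -1 \<or> A x (e' j) = 1"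
      using j(2) pos[OF j(1)] e'd[OF j(1)] by (auto simp: A_def field_simps)
    then have "\<bar>A x (e' j)\<bar> = 1"
      by auto
    then show ?thesis
      using A2[of x] x e'd(1)[OF j(1)] by (auto simp: cube_boundary_def box_boundary_def)
  qed
  have B3: "B y \<in> box_boundary l u" if y: "y \<in> cube_boundary d" for y
  proof -
    have yb: "\<bar>y i\<bar> \<le> 1" if "i < d" for i
      using y that by (auto simp: cube_boundary_def cube_def)
    have "l j \<le> B y j \<and> B y j \<le> u j" for j
    proof (cases "j \<in> J")
      case True
      define z where "z = y (e' j) * (u j - l j)"
      have "\<bar>z\<bar> \<le> 1 * (u j - l j)"
        unfolding z_def abs_mult using yb[OF e'd(1)[OF True]] pos[OF True] by (intro mult_mono) auto
      then have "z \<le> u j - l j" "- z \<le> u j - l j"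
        unfolding mult_1 by (rule abs_le_D1, rule abs_le_D2)
      then have "2 * l j \<le> l j + u j + z" "l j + u j + z \<le> 2 * u j"
        by simp_all
      then show ?thesis
        using True by (simp add: B_def flip: z_def)
    next
      case False
      then show ?thesis
        using lu[of j] by (simp add: B_def)
    qed
    moreover obtain i where i: "i < d" "\<bar>y i\<bar> = 1"
      using y by (auto simp: cube_boundary_def)
    have "y i = 1 \<or> y i = -1"
      using i by linarith
    then have "B y (e i) = l (e i) \<or> B y (e i) = u (e i)"
      using eJ[OF i(1)] e'e[OF i(1)] by (auto simp: B_def field_simps)
    ultimately show ?thesis
      using eJ[OF i(1)] unfolding box_boundary_def box_set_def J_def by blast
  qed
  have BA: "B (A x) = x" if x: "x \<in> box_set l u" for x
  proof
    fix j
    show "B (A x) j = x j"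
    proof (cases "j \<in> J")
      case True
      have "A x (e' j) = (2 * x j - l j - u j) / (u j - l j)"
        using e'd[OF True] by (simp add: A_def)
      then have "A x (e' j) * (u j - l j) = 2 * x j - l j - u j"
        using pos[OF True] by simp
      then show ?thesis
        using True by (simp add: B_def)
    next
      case False
      then have "l j = u j"
        using lu[of j] by (simp add: J_def)
      then show ?thesis
        using False x by (simp add: B_def box_set_def) (metis antisym)
    qed
  qed
  show ?thesis
    using that[OF A1 B1 A2 A3 B3 BA] .
qed

lemma extend_over_box:
  assumes lu: "\<And>i. l i \<le> u i" and fin: "finite {i. l i < u i}" and d: "card {i. l i < u i} = Suc k"
    and null: "sphere_null k X' X"
    and f: "continuous_map (top_of_set (box_boundary l u)) X' f"
  obtains F where "continuous_map (top_of_set (box_set l u)) X F"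
    "\<And>x. x \<in> box_boundary l u \<Longrightarrow> F x = f x"
proof -
  obtain A B where AB: "continuous_on UNIV A" "continuous_on UNIV B"
    "\<And>x. x \<in> box_set l u \<Longrightarrow> A x \<in> cube (Suc k)"
    "\<And>x. x \<in> box_boundary l u \<Longrightarrow> A x \<in> cube_boundary (Suc k)"
    "\<And>y. y \<in> cube_boundary (Suc k) \<Longrightarrow> B y \<in> box_boundary l u"
    "\<And>x. x \<in> box_set l u \<Longrightarrow> B (A x) = x"
    using box_cube_maps[OF lu fin d] by blast
  have "continuous_map (top_of_set (cube_boundary (Suc k))) (top_of_set (box_boundary l u)) B"
    using AB(5) continuous_on_subset[OF AB(2)] by (auto simp: continuous_map_in_subtopology)
  then have fB: "continuous_map (top_of_set (cube_boundary (Suc k))) X' (f \<circ> B)"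
    using f by (rule continuous_map_compose)
  have "continuous_map (nsphere k) X' (f \<circ> B \<circ> to_cube k)"
    using continuous_map_to_cube fB by (rule continuous_map_compose)
  then obtain c where c: "homotopic_with (\<lambda>_. True) (nsphere k) X (f \<circ> B \<circ> to_cube k) (\<lambda>_. c)"
    using null unfolding sphere_null_def by blast
  \<comment> \<open>Continuity into \<open>X\<close> instead of X' is read off from the homotopy,
    since no relation between the two topologies is assumed.\<close>
  have "continuous_map (nsphere k) X (f \<circ> B \<circ> to_cube k)"
    using homotopic_with_imp_continuous_maps[OF c] by blast
  then have "continuous_map (top_of_set (cube_boundary (Suc k))) X (f \<circ> B \<circ> to_cube k \<circ> to_sphere k)"
    by (rule continuous_map_compose[OF continuous_map_to_sphere])
  then have "continuous_map (top_of_set (cube_boundary (Suc k))) X (f \<circ> B)"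
    by (rule continuous_map_eq) (simp add: to_cube_to_sphere)
  then obtain F where F: "continuous_map (top_of_set (cube (Suc k))) X F"
    "\<And>x. x \<in> cube_boundary (Suc k) \<Longrightarrow> F x = (f \<circ> B) x"
    using extend_over_cube[OF _ c] by blast
  have "continuous_map (top_of_set (box_set l u)) (top_of_set (cube (Suc k))) A"
    using AB(3) continuous_on_subset[OF AB(1)] by (auto simp: continuous_map_in_subtopology)
  then have "continuous_map (top_of_set (box_set l u)) X (F \<circ> A)"
    using F(1) by (rule continuous_map_compose)
  moreover have "(F \<circ> A) x = f x" if "x \<in> box_boundary l u" for x
    using AB(4)[OF that] AB(6)[of x] that F(2) by (simp add: box_boundary_def)
  ultimately show ?thesis
    by (rule that)
qed

definition grid_point :: "nat \<Rightarrow> nat \<Rightarrow> (nat \<Rightarrow> nat) \<Rightarrow> nat \<Rightarrow> real" where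
  "grid_point d N a = (\<lambda>i. if i < d then 2 * real (a i) / real N - 1 else 0)"

text \<open>In each coordinate a cell is either a grid value or one interval of length 2 / N, so
  cells of all dimensions are covered. Beyond \<open>d\<close> the corners are 0, where
  \<open>grid_point\<close> ignores them anyway.\<close>

definition grid_corners :: "nat \<Rightarrow> nat \<Rightarrow> (nat \<Rightarrow> nat) \<Rightarrow> (nat \<Rightarrow> nat) \<Rightarrow> bool" where
  "grid_corners d N a b \<longleftrightarrow>
     (\<forall>i. a i \<le> b i \<and> b i \<le> Suc (a i) \<and> b i \<le> N \<and> (d \<le> i \<longrightarrow> b i = 0))"

definition cells :: "nat \<Rightarrow> nat \<Rightarrow> (nat \<Rightarrow> real) set set" where
  "cells d N = {box_set (grid_point d N a) (grid_point d N b) | a b. grid_corners d N a b}"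

definition cell_dim :: "(nat \<Rightarrow> real) set \<Rightarrow> nat" where
  "cell_dim Q = card {i. \<exists>x\<in>Q. \<exists>y\<in>Q. x i \<noteq> y i}"

lemma grid_cornersD:
  assumes "grid_corners d N a b"
  shows "a i \<le> b i" "b i \<le> Suc (a i)" "b i \<le> N" "d \<le> i \<Longrightarrow> b i = 0" "d \<le> i \<Longrightarrow> a i = 0"
  using assms by (auto simp: grid_corners_def)

lemma grid_point_le_iff:
  assumes "0 < N"
  shows "grid_point d N a i \<le> grid_point d N b i \<longleftrightarrow> i < d \<longrightarrow> a i \<le> b i"
  using assms by (auto simp: grid_point_def divide_le_cancel)

lemma grid_point_less_iff:
  assumes "0 < N"
  shows "grid_point d N a i < grid_point d N b i \<longleftrightarrow> i < d \<and> a i < b i"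
  using assms by (auto simp: grid_point_def divide_less_cancel)

lemma grid_point_eq_iff:
  assumes "0 < N"
  shows "grid_point d N a i = grid_point d N b i \<longleftrightarrow> i < d \<longrightarrow> a i = b i"
  using assms by (auto simp: grid_point_def)

lemma grid_point_upd:
  "i < d \<Longrightarrow> grid_point d N (a(i := c)) j = (if j = i then 2 * real c / real N - 1 else grid_point d N a j)"
  by (auto simp: grid_point_def)

lemma finite_cells: "finite (cells d N)"
proof -
  let ?G = "{a :: nat \<Rightarrow> nat. \<forall>i. (i \<in> {..<d} \<longrightarrow> a i \<in> {..N}) \<and> (i \<notin> {..<d} \<longrightarrow> a i = 0)}"
  have "finite ?G"
    by (rule finite_set_of_finite_funs) auto
  moreover have "cells d N \<subseteq> (\<lambda>(a, b). box_set (grid_point d N a) (grid_point d N b)) ` (?G \<times> ?G)"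
  proof
    fix Q assume "Q \<in> cells d N"
    then obtain a b where ab: "Q = box_set (grid_point d N a) (grid_point d N b)" "grid_corners d N a b"
      by (auto simp: cells_def)
    have "b \<in> ?G" "a \<in> ?G"
      using grid_cornersD[OF ab(2)] le_trans[OF grid_cornersD(1,3)[OF ab(2)]] by auto
    then show "Q \<in> (\<lambda>(a, b). box_set (grid_point d N a) (grid_point d N b)) ` (?G \<times> ?G)"
      using ab(1) by (intro image_eqI[of _ _ "(a, b)"]) auto
  qed
  ultimately show ?thesis
    using finite_subset[OF _ finite_imageI[OF finite_cartesian_product[OF \<open>finite ?G\<close> \<open>finite ?G\<close>]]] by blast
qed

lemma closed_cells: "Q \<in> cells d N \<Longrightarrow> closed Q"
  by (auto simp: cells_def closed_box_set)

lemma grid_corners_le: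
  assumes "0 < N" "grid_corners d N a b"
  shows "grid_point d N a i \<le> grid_point d N b i"
  using assms grid_cornersD(1)[OF assms(2)] by (simp add: grid_point_le_iff)

lemma grid_point_in_box:
  assumes "0 < N" "grid_corners d N a b"
  shows "grid_point d N a \<in> box_set (grid_point d N a) (grid_point d N b)"
    "grid_point d N b \<in> box_set (grid_point d N a) (grid_point d N b)"
  using grid_corners_le[OF assms] by (auto simp: box_set_def)

lemma cells_nonempty: "0 < N \<Longrightarrow> Q \<in> cells d N \<Longrightarrow> Q \<noteq> {}"
  unfolding cells_def using grid_point_in_box by blast

lemma box_set_Int: "box_set l u \<inter> box_set l' u' = box_set (\<lambda>i. max (l i) (l' i)) (\<lambda>i. min (u i) (u' i))"
  by (auto simp: box_set_def)

lemma grid_point_max: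
  assumes "0 < N"
  shows "max (grid_point d N a i) (grid_point d N b i) = grid_point d N (\<lambda>i. max (a i) (b i)) i"
    "min (grid_point d N a i) (grid_point d N b i) = grid_point d N (\<lambda>i. min (a i) (b i)) i"
  using assms by (auto simp: grid_point_def max_def min_def divide_le_cancel)

lemma cells_Int:
  assumes N: "0 < N" and Q: "Q \<in> cells d N" "Q' \<in> cells d N" and ne: "Q \<inter> Q' \<noteq> {}"
  shows "Q \<inter> Q' \<in> cells d N"
proof -
  obtain a b a' b' where
    ab: "Q = box_set (grid_point d N a) (grid_point d N b)" "grid_corners d N a b" and
    ab': "Q' = box_set (grid_point d N a') (grid_point d N b')" "grid_corners d N a' b'"
    using Q by (auto simp: cells_def)
  define m where "m i = max (a i) (a' i)" for i
  define M where "M i = min (b i) (b' i)" for i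
  have eq: "Q \<inter> Q' = box_set (grid_point d N m) (grid_point d N M)"
    unfolding ab(1) ab'(1) box_set_Int grid_point_max[OF N] m_def[abs_def] M_def[abs_def] ..
  then obtain x where "x \<in> box_set (grid_point d N m) (grid_point d N M)"
    using ne by auto
  then have "grid_point d N m i \<le> grid_point d N M i" for i
    unfolding box_set_def using order_trans by blast
  then have mM: "m i \<le> M i" if "i < d" for i
    using that grid_point_le_iff[OF N] by blast
  have "grid_corners d N m M"
    unfolding grid_corners_def
  proof (intro allI conjI impI)
    fix i
    show "m i \<le> M i"
      using mM[of i] grid_cornersD(4,5)[OF ab(2), of i] grid_cornersD(4,5)[OF ab'(2), of i]
      by (cases "i < d") (auto simp: m_def M_def)
    show "M i \<le> Suc (m i)" "M i \<le> N"
      using grid_cornersD(2,3)[OF ab(2), of i] by (auto simp: m_def M_def)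
    show "M i = 0" if "d \<le> i"
      using grid_cornersD(4)[OF ab(2) that] by (simp add: M_def)
  qed
  then show ?thesis
    unfolding cells_def eq by blast
qed

lemma cell_proper_face:
  assumes N: "0 < N" and ab: "grid_corners d N a b" and ab': "grid_corners d N a' b'"
    and sub: "box_set (grid_point d N a') (grid_point d N b') \<subset> box_set (grid_point d N a) (grid_point d N b)"
  shows "\<exists>i<d. a i < b i \<and> a' i = b' i \<and> (a' i = a i \<or> a' i = b i)"
    "\<And>i. i < d \<Longrightarrow> a i \<le> a' i \<and> b' i \<le> b i"
proof -
  have le: "a i \<le> a' i" "b' i \<le> b i" if "i < d" for i
  proof -
    have "grid_point d N a' \<in> box_set (grid_point d N a) (grid_point d N b)"
      "grid_point d N b' \<in> box_set (grid_point d N a) (grid_point d N b)"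
      using sub grid_point_in_box[OF N ab'] by auto
    then show "a i \<le> a' i" "b' i \<le> b i"
      using that grid_point_le_iff[OF N] unfolding box_set_def by blast+
  qed
  then show "\<And>i. i < d \<Longrightarrow> a i \<le> a' i \<and> b' i \<le> b i"
    by blast
  have "\<exists>i<d. a' i \<noteq> a i \<or> b' i \<noteq> b i"
  proof (rule ccontr)
    assume "\<not> (\<exists>i<d. a' i \<noteq> a i \<or> b' i \<noteq> b i)"
    then have "grid_point d N a' = grid_point d N a" "grid_point d N b' = grid_point d N b"
      by (auto simp: grid_point_def fun_eq_iff)
    then show False
      using sub by simp
  qed
  then obtain i where i: "i < d" "a' i \<noteq> a i \<or> b' i \<noteq> b i"
    by blast
  then show "\<exists>i<d. a i < b i \<and> a' i = b' i \<and> (a' i = a i \<or> a' i = b i)"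
    using le[OF i(1)] grid_cornersD(1,2)[OF ab, of i] grid_cornersD(1)[OF ab', of i]
    by (intro exI[of _ i]) linarith
qed

text \<open>A point of the boundary sits at an end of some nondegenerate coordinate; freezing this
  coordinate there gives a proper face through the point. Conversely a proper face is constant in
  some such coordinate, by \<open>cell_proper_face\<close>.\<close>

lemma union_proper_faces:
  assumes N: "0 < N" and ab: "grid_corners d N a b"
    and Q: "Q = box_set (grid_point d N a) (grid_point d N b)"
  shows "\<Union>{R \<in> cells d N. R \<subset> Q} = box_boundary (grid_point d N a) (grid_point d N b)"
proof (intro equalityI subsetI)
  fix x assume "x \<in> \<Union>{R \<in> cells d N. R \<subset> Q}"
  then obtain R where R: "x \<in> R" "R \<in> cells d N" "R \<subset> Q"
    by blast
  then obtain a' b' where ab': "R = box_set (grid_point d N a') (grid_point d N b')" "grid_corners d N a' b'"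
    by (auto simp: cells_def)
  obtain i where i: "i < d" "a i < b i" "a' i = b' i" "a' i = a i \<or> a' i = b i"
    using cell_proper_face(1)[OF N ab ab'(2) R(3)[unfolded ab'(1) Q]] by blast
  have "grid_point d N a' i \<le> x i" "x i \<le> grid_point d N b' i"
    using R(1) unfolding ab'(1) box_set_def by auto
  moreover have "grid_point d N b' i = grid_point d N a' i"
    using i(3) by (simp add: grid_point_def)
  ultimately have "x i = grid_point d N a' i"
    by linarith
  then have "x i = grid_point d N a i \<or> x i = grid_point d N b i"
    using i(4) by (auto simp: grid_point_def)
  moreover have "grid_point d N a i < grid_point d N b i"
    using i by (simp add: grid_point_less_iff[OF N])
  ultimately show "x \<in> box_boundary (grid_point d N a) (grid_point d N b)"
    using R(1,3) Q unfolding box_boundary_def by blast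
next
  fix x assume "x \<in> box_boundary (grid_point d N a) (grid_point d N b)"
  then obtain i where x: "x \<in> Q" and i: "grid_point d N a i < grid_point d N b i"
    "x i = grid_point d N a i \<or> x i = grid_point d N b i"
    by (auto simp: box_boundary_def Q)
  have id: "i < d" "a i < b i"
    using i(1) by (auto simp: grid_point_less_iff[OF N])
  define c where "c = (if x i = grid_point d N a i then a i else b i)"
  have c: "c = a i \<or> c = b i" "x i = 2 * real c / real N - 1"
    using i(2) id(1) by (auto simp: c_def grid_point_def)
  define R where "R = box_set (grid_point d N (a(i := c))) (grid_point d N (b(i := c)))"
  have "grid_corners d N (a(i := c)) (b(i := c))"
    unfolding grid_corners_def
  proof
    fix j
    show "(a(i := c)) j \<le> (b(i := c)) j \<and> (b(i := c)) j \<le> Suc ((a(i := c)) j) \<and>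
        (b(i := c)) j \<le> N \<and> (d \<le> j \<longrightarrow> (b(i := c)) j = 0)"
      using grid_cornersD[OF ab, of j] c(1) id by auto
  qed
  then have "R \<in> cells d N"
    unfolding cells_def R_def by blast
  moreover have "x \<in> R"
    using x c(2) id(1) unfolding R_def Q box_set_def by (simp add: grid_point_upd)
  moreover have "R \<subseteq> Q"
  proof
    fix y assume y: "y \<in> R"
    have "grid_point d N a j \<le> y j \<and> y j \<le> grid_point d N b j" for j
    proof (cases "j = i")
      case True
      have "2 * real c / real N - 1 \<le> y i \<and> y i \<le> 2 * real c / real N - 1"
        using y id(1) unfolding R_def box_set_def mem_Collect_eq by (auto simp: grid_point_upd dest: spec[of _ i])
      then have "y i = x i"
        using c(2) by linarith
      then have "y j = grid_point d N a i \<or> y j = grid_point d N b i"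
        using i(2) True by simp
      then show ?thesis
        using i(1) True by auto
    next
      case False
      then show ?thesis
        using y id(1) unfolding R_def box_set_def mem_Collect_eq by (auto simp: grid_point_upd dest: spec[of _ j])
    qed
    then show "y \<in> Q"
      by (simp add: Q box_set_def)
  qed
  moreover have "R \<noteq> Q"
  proof
    assume "R = Q"
    then have "grid_point d N a \<in> R" "grid_point d N b \<in> R"
      using grid_point_in_box[OF N ab] Q by auto
    then have "grid_point d N a i = x i" "grid_point d N b i = x i"
      using id(1) c(2) unfolding R_def box_set_def mem_Collect_eq
      by (auto simp: grid_point_upd dest!: spec[of _ i])
    then show False
      using i(1) by simp
  qed
  ultimately show "x \<in> \<Union>{R \<in> cells d N. R \<subset> Q}"
    by blast
qed

lemma varying_coordinates:
  assumes "0 < N" "grid_corners d N a b"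
  shows "{i. \<exists>x\<in>box_set (grid_point d N a) (grid_point d N b). \<exists>y\<in>box_set (grid_point d N a) (grid_point d N b). x i \<noteq> y i} =
    {i. grid_point d N a i < grid_point d N b i}" (is "?L = ?R")
proof (intro equalityI subsetI)
  fix i assume "i \<in> ?L"
  then obtain x y where xy: "x \<in> box_set (grid_point d N a) (grid_point d N b)"
    "y \<in> box_set (grid_point d N a) (grid_point d N b)" "x i \<noteq> y i"
    by blast
  then have "grid_point d N a i \<le> x i" "x i \<le> grid_point d N b i"
    "grid_point d N a i \<le> y i" "y i \<le> grid_point d N b i"
    by (auto simp: box_set_def)
  with xy(3) have "grid_point d N a i < grid_point d N b i"
    by linarith
  then show "i \<in> ?R"
    by simp
next
  fix i assume "i \<in> ?R"
  then have "grid_point d N a i \<noteq> grid_point d N b i"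
    by simp
  then show "i \<in> ?L"
    using grid_point_in_box[OF assms] by blast
qed

lemma cell_dim_eq:
  assumes "0 < N" "grid_corners d N a b" "Q = box_set (grid_point d N a) (grid_point d N b)"
  shows "cell_dim Q = card {i. i < d \<and> a i < b i}"
  unfolding cell_dim_def assms(3) varying_coordinates[OF assms(1,2)] grid_point_less_iff[OF assms(1)] ..

lemma cell_dim_less:
  assumes N: "0 < N" and "R \<in> cells d N" "Q \<in> cells d N" and sub: "R \<subset> Q"
  shows "cell_dim R < cell_dim Q"
proof -
  obtain a b a' b' where
    ab: "Q = box_set (grid_point d N a) (grid_point d N b)" "grid_corners d N a b" and
    ab': "R = box_set (grid_point d N a') (grid_point d N b')" "grid_corners d N a' b'"
    using assms by (auto simp: cells_def)
  note face = cell_proper_face[OF N ab(2) ab'(2) sub[unfolded ab(1) ab'(1)]]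
  have "a i < b i" if "i < d" "a' i < b' i" for i
    using face(2)[OF that(1)] that(2) by linarith
  then have "{i. i < d \<and> a' i < b' i} \<subseteq> {i. i < d \<and> a i < b i}"
    by blast
  moreover obtain i where "i < d" "a i < b i" "a' i = b' i"
    using face(1) by blast
  then have "i \<in> {i. i < d \<and> a i < b i}" "i \<notin> {i. i < d \<and> a' i < b' i}"
    by auto
  ultimately have "{i. i < d \<and> a' i < b' i} \<subset> {i. i < d \<and> a i < b i}"
    by blast
  then show ?thesis
    unfolding cell_dim_eq[OF N ab(2,1)] cell_dim_eq[OF N ab'(2,1)] by (intro psubset_card_mono) auto
qed

lemma cell_dim_le:
  assumes "0 < N" "Q \<in> cells d N"
  shows "cell_dim Q \<le> d"
proof -
  obtain a b where ab: "Q = box_set (grid_point d N a) (grid_point d N b)" "grid_corners d N a b"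
    using assms by (auto simp: cells_def)
  have "card {i. i < d \<and> a i < b i} \<le> card {..<d}"
    by (intro card_mono) auto
  then show ?thesis
    by (simp add: cell_dim_eq[OF assms(1) ab(2,1)])
qed

lemma cell_subset_cube:
  assumes N: "0 < N" and "Q \<in> cells d N"
  shows "Q \<subseteq> cube d"
proof -
  obtain a b where ab: "Q = box_set (grid_point d N a) (grid_point d N b)" "grid_corners d N a b"
    using assms by (auto simp: cells_def)
  show ?thesis
  proof
    fix x assume x: "x \<in> Q"
    have "\<bar>x i\<bar> \<le> 1" if "i < d" for i
    proof -
      have "2 * real (a i) / real N - 1 \<le> x i" "x i \<le> 2 * real (b i) / real N - 1"
        using x that unfolding ab(1) box_set_def by (auto simp: grid_point_def split: if_splits dest!: spec[of _ i])
      moreover have "0 \<le> real (a i) / real N" "real (b i) / real N \<le> 1"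
        using grid_cornersD(3)[OF ab(2), of i] N by auto
      ultimately show ?thesis
        by linarith
    qed
    moreover have "x i = 0" if "d \<le> i" for i
    proof -
      have "grid_point d N a i \<le> x i \<and> x i \<le> grid_point d N b i"
        using x unfolding ab(1) box_set_def by blast
      then show ?thesis
        using that by (simp add: grid_point_def)
    qed
    ultimately show "x \<in> cube d"
      by (simp add: cube_def)
  qed
qed

text \<open>The midpoint of the cell has some coordinate 1 or -1. The corners lie in [-1, 1], so
  they agree in this coordinate, which is lost for the dimension. This gains the extra degree when a
  sphere rather than a cube is lifted.\<close>

lemma cell_dim_boundary:
  assumes N: "0 < N" and "Q \<in> cells d N" and sub: "Q \<subseteq> cube_boundary d"
  shows "cell_dim Q < d"
proof -
  obtain a b where ab: "Q = box_set (grid_point d N a) (grid_point d N b)" "grid_corners d N a b"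
    using assms by (auto simp: cells_def)
  let ?l = "grid_point d N a" and ?u = "grid_point d N b"
  have "?l \<in> cube d" "?u \<in> cube d"
    using grid_point_in_box[OF N ab(2)] ab(1) sub by (auto simp: cube_boundary_def)
  then have lu: "\<bar>?l i\<bar> \<le> 1" "\<bar>?u i\<bar> \<le> 1" if "i < d" for i
    using that by (auto simp: cube_def)
  have "(\<lambda>i. (?l i + ?u i) / 2) \<in> Q"
    using grid_corners_le[OF N ab(2)] unfolding ab(1) box_set_def by (simp add: field_simps)
  then obtain i where i: "i < d" "\<bar>(?l i + ?u i) / 2\<bar> = 1"
    using sub by (auto simp: cube_boundary_def)
  then have "(?l i + ?u i) / 2 = 1 \<or> (?l i + ?u i) / 2 = -1"
    by linarith
  then have "?l i = ?u i"
    using lu[OF i(1)] by (auto simp: abs_le_iff)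
  then have "i \<notin> {i. i < d \<and> a i < b i}"
    using i(1) by (simp add: grid_point_eq_iff[OF N])
  then have "{i. i < d \<and> a i < b i} \<subset> {..<d}"
    using i(1) by blast
  then have "card {i. i < d \<and> a i < b i} < card {..<d}"
    by (intro psubset_card_mono) auto
  then show ?thesis
    by (simp add: cell_dim_eq[OF N ab(2,1)])
qed

lemma cell_small:
  assumes N: "0 < N" and "Q \<in> cells d N" "x \<in> Q" "y \<in> Q"
  shows "\<bar>x i - y i\<bar> \<le> 2 / real N"
proof -
  obtain a b where ab: "Q = box_set (grid_point d N a) (grid_point d N b)" "grid_corners d N a b"
    using assms by (auto simp: cells_def)
  have "grid_point d N a i \<le> x i" "x i \<le> grid_point d N b i"
    "grid_point d N a i \<le> y i" "y i \<le> grid_point d N b i"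
    using assms(3,4) by (auto simp: ab(1) box_set_def)
  moreover have "grid_point d N b i - grid_point d N a i \<le> 2 / real N"
  proof (cases "i < d")
    case True
    have "real (b i) - real (a i) \<le> 1"
      using grid_cornersD(2)[OF ab(2), of i] by linarith
    then have "2 * (real (b i) - real (a i)) / real N \<le> 2 / real N"
      by (intro divide_right_mono) auto
    then show ?thesis
      using True by (simp add: grid_point_def diff_divide_distrib right_diff_distrib)
  qed (simp add: grid_point_def)
  ultimately show ?thesis
    by linarith
qed

text \<open>Rounding the rescaled coordinates down and up gives the two corners. An integral
  coordinate rounds to itself both ways, so the cell is constant in it; for the values 1 and -1 this
  keeps the cell inside the faces of the cube that contain the point.\<close>

lemma minimal_cell:
  assumes N: "0 < N" and x: "x \<in> cube d"
  obtains Q where "Q \<in> cells d N" "x \<in> Q" "\<And>i y. i < d \<Longrightarrow> \<bar>x i\<bar> = 1 \<Longrightarrow> y \<in> Q \<Longrightarrow> y i = x i"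
proof -
  define t where "t i = (if i < d then (x i + 1) * real N / 2 else 0)" for i
  have t: "0 \<le> t i" "t i \<le> real N" for i
    using x N by (auto simp: t_def cube_def abs_le_iff)
  define a where "a i = nat \<lfloor>t i\<rfloor>" for i
  define b where "b i = nat \<lceil>t i\<rceil>" for i
  have ab: "real (a i) \<le> t i" "t i \<le> real (b i)" for i
    using t by (auto simp: a_def b_def)
  have corners: "grid_corners d N a b"
    unfolding grid_corners_def
  proof (intro allI conjI impI)
    fix i
    show "a i \<le> b i"
      using ab[of i] by linarith
    show "b i \<le> Suc (a i)"
      unfolding a_def b_def using t(1)[of i] by linarith
    show "b i \<le> N"
      unfolding b_def using t(2)[of i] by linarith
    show "b i = 0" if "d \<le> i"
      using that by (simp add: b_def t_def)
  qed
  define Q where "Q = box_set (grid_point d N a) (grid_point d N b)"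
  have "Q \<in> cells d N"
    using corners unfolding Q_def cells_def by blast
  moreover have xt: "x i = 2 * t i / real N - 1" if "i < d" for i
    using that N by (simp add: t_def)
  have "x \<in> Q"
    unfolding Q_def box_set_def
  proof (intro CollectI allI)
    fix i
    show "grid_point d N a i \<le> x i \<and> x i \<le> grid_point d N b i"
    proof (cases "i < d")
      case True
      have "2 * real (a i) / real N \<le> 2 * t i / real N" "2 * t i / real N \<le> 2 * real (b i) / real N"
        using ab[of i] by (auto intro!: divide_right_mono)
      then show ?thesis
        using True xt[OF True] by (simp add: grid_point_def)
    next
      case False
      then show ?thesis
        using x by (simp add: grid_point_def cube_def)
    qed
  qed
  moreover have "y i = x i" if i: "i < d" "\<bar>x i\<bar> = 1" and y: "y \<in> Q" for i y
  proof -
    have "x i = 1 \<or> x i = -1"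
      using i(2) by linarith
    then have "t i = real N \<or> t i = 0"
      using i(1) by (auto simp: t_def)
    then have "real (a i) = t i" "real (b i) = t i"
      by (auto simp: a_def b_def)
    then have "grid_point d N a i = x i" "grid_point d N b i = x i"
      using i(1) xt[OF i(1)] by (auto simp: grid_point_def)
    moreover have "grid_point d N a i \<le> y i" "y i \<le> grid_point d N b i"
      using y by (auto simp: Q_def box_set_def)
    ultimately show ?thesis
      by linarith
  qed
  ultimately show ?thesis
    by (rule that)
qed

section \<open>Extending maps cell by cell\<close>

definition cellular :: "nat \<Rightarrow> nat \<Rightarrow> (nat \<Rightarrow> real) set \<Rightarrow> bool" where
  "cellular d N S \<longleftrightarrow> (\<forall>x\<in>S. \<exists>Q\<in>cells d N. x \<in> Q \<and> Q \<subseteq> S)"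

lemma cellular_Union: "cellular d N S \<Longrightarrow> S = \<Union>{Q \<in> cells d N. Q \<subseteq> S}"
  by (auto simp: cellular_def)

lemma closed_cellular:
  assumes "cellular d N S"
  shows "closed S"
proof -
  have "closed (\<Union>{Q \<in> cells d N. Q \<subseteq> S})"
    using finite_cells[of d N] closed_cells by (intro closed_Union) auto
  then show ?thesis
    using cellular_Union[OF assms] by simp
qed

text \<open>Obstruction theory with carriers: \<open>A Q\<close> is the region in which the values
  over \<open>Q\<close> must stay, and \<open>ext\<close> solves the problem over one cell from its
  boundary. Induction over face-closed families of cells, removing a maximal cell: it meets the
  remaining part in proper faces only, so its extension can be pasted.\<close>

lemma cell_extension:
  fixes X :: "'p topology" and g :: "(nat \<Rightarrow> real) \<Rightarrow> 'p"
  assumes N: "0 < N" and S: "cellular d N S" and S0: "cellular d N S0" "S0 \<subseteq> S"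
    and g: "continuous_map (top_of_set S0) X g" "\<And>Q. Q \<in> cells d N \<Longrightarrow> Q \<subseteq> S0 \<Longrightarrow> g ` Q \<subseteq> A Q"
    and ext: "\<And>Q h. Q \<in> cells d N \<Longrightarrow> Q \<subseteq> S \<Longrightarrow>
        continuous_map (top_of_set (\<Union>{R \<in> cells d N. R \<subset> Q})) X h \<Longrightarrow>
        (\<And>R. R \<in> cells d N \<Longrightarrow> R \<subset> Q \<Longrightarrow> h ` R \<subseteq> A R) \<Longrightarrow>
        \<exists>h'. continuous_map (top_of_set Q) X h' \<and> (\<forall>x\<in>\<Union>{R \<in> cells d N. R \<subset> Q}. h' x = h x) \<and> h' ` Q \<subseteq> A Q"
  obtains G where "continuous_map (top_of_set S) X G" "\<And>x. x \<in> S0 \<Longrightarrow> G x = g x"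
    "\<And>Q. Q \<in> cells d N \<Longrightarrow> Q \<subseteq> S \<Longrightarrow> G ` Q \<subseteq> A Q"
proof -
  have step: "\<exists>G. continuous_map (top_of_set (S0 \<union> \<Union>K)) X G \<and> (\<forall>x\<in>S0. G x = g x) \<and> (\<forall>Q\<in>K. G ` Q \<subseteq> A Q)"
    if "K \<subseteq> {Q \<in> cells d N. Q \<subseteq> S}" "\<forall>Q\<in>K. \<forall>R\<in>cells d N. R \<subseteq> Q \<longrightarrow> R \<in> K" for K
    using that
  proof (induction "card K" arbitrary: K rule: less_induct)
    case less
    have finK: "finite K"
      using less.prems(1) finite_cells[of d N] by (auto intro: finite_subset)
    show ?case
    proof (cases "K = {}")
      case True
      then show ?thesis
        using g(1) by (intro exI[of _ g]) auto
    next
      case False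
      then obtain Q where Q: "Q \<in> K" "\<And>Q'. Q' \<in> K \<Longrightarrow> Q \<subseteq> Q' \<Longrightarrow> Q' = Q"
        using finite_has_maximal[OF finK False] by auto
      have Qc: "Q \<in> cells d N" "Q \<subseteq> S"
        using Q(1) less.prems(1) by auto
      define K' where "K' = K - {Q}"
      have KK': "K = insert Q K'" "Q \<notin> K'"
        using Q(1) by (auto simp: K'_def)
      have "card K' < card K"
        unfolding K'_def using Q(1) finK by (rule card_Diff1_less[rotated])
      moreover have "K' \<subseteq> {Q \<in> cells d N. Q \<subseteq> S}"
        using less.prems(1) by (auto simp: K'_def)
      moreover have "\<forall>Q'\<in>K'. \<forall>R\<in>cells d N. R \<subseteq> Q' \<longrightarrow> R \<in> K'"
        using less.prems(2) Q(2) unfolding K'_def by blast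
      ultimately obtain G where G: "continuous_map (top_of_set (S0 \<union> \<Union>K')) X G"
        "\<And>x. x \<in> S0 \<Longrightarrow> G x = g x" "\<And>Q. Q \<in> K' \<Longrightarrow> G ` Q \<subseteq> A Q"
        using less.hyps[of K'] by auto
      show ?thesis
      proof (cases "Q \<subseteq> S0")
        case True
        then have "S0 \<union> \<Union>K = S0 \<union> \<Union>K'"
          unfolding KK' by blast
        moreover have "G ` Q \<subseteq> A Q"
          using g(2)[OF Qc(1) True] G(2) True by (simp add: image_subset_iff subset_iff)
        ultimately show ?thesis
          using G unfolding KK' by (intro exI[of _ G]) auto
      next
        case False
        let ?bd = "\<Union>{R \<in> cells d N. R \<subset> Q}"
        have bdK': "R \<in> K'" if "R \<in> cells d N" "R \<subset> Q" for R
          using less.prems(2) Q(1) that unfolding K'_def by blast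
        \<comment> \<open>The part already treated contains \<open>x\<close> in a cell Q' that does
          not contain \<open>Q\<close>; hence the intersection of \<open>Q\<close> with Q' is a
          proper face of \<open>Q\<close>.\<close>
        have meet: "x \<in> ?bd" if x: "x \<in> Q" "x \<in> S0 \<union> \<Union>K'" for x
        proof -
          obtain Q' where Q': "Q' \<in> cells d N" "x \<in> Q'" "\<not> Q \<subseteq> Q'"
          proof (cases "x \<in> S0")
            case True
            then obtain Q' where "Q' \<in> cells d N" "x \<in> Q'" "Q' \<subseteq> S0"
              using S0(1) by (auto simp: cellular_def)
            then show ?thesis
              using that \<open>\<not> Q \<subseteq> S0\<close> by blast
          next
            case False
            then obtain Q' where "x \<in> Q'" "Q' \<in> K'"
              using x(2) by blast
            moreover then have "\<not> Q \<subseteq> Q'"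
              using Q(2)[of Q'] KK' by blast
            ultimately show ?thesis
              using that less.prems(1) KK'(1) by blast
          qed
          have "Q \<inter> Q' \<in> cells d N"
            using cells_Int[OF N Qc(1) Q'(1)] x(1) Q'(2) by blast
          moreover have "Q \<inter> Q' \<subset> Q"
            using Q'(3) by blast
          ultimately show ?thesis
            using x(1) Q'(2) by blast
        qed
        have "?bd \<subseteq> S0 \<union> \<Union>K'"
          using bdK' by blast
        then have "continuous_map (top_of_set ?bd) X G"
          using continuous_map_from_subtopology_mono[OF G(1)] by blast
        moreover have "G ` R \<subseteq> A R" if "R \<in> cells d N" "R \<subset> Q" for R
          using G(3) bdK'[OF that] by blast
        ultimately obtain h where h: "continuous_map (top_of_set Q) X h" "\<And>x. x \<in> ?bd \<Longrightarrow> h x = G x" "h ` Q \<subseteq> A Q"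
          using ext[OF Qc, of G] by blast
        define G' where "G' x = (if x \<in> Q then h x else G x)" for x
        have G'G: "G' x = G x" if "x \<in> S0 \<union> \<Union>K'" for x
          using h(2) meet[OF _ that] by (simp add: G'_def)
        have dom: "S0 \<union> \<Union>K = Q \<union> (S0 \<union> \<Union>K')"
          unfolding KK' by blast
        have "continuous_map (top_of_set (S0 \<union> \<Union>K)) X G'"
          unfolding G'_def
        proof (rule pasting_two_closed)
          have "closed Q" "closed (S0 \<union> \<Union>K')"
            using closed_cells[OF Qc(1)] closed_cellular[OF S0(1)] finK less.prems(1) closed_cells
            by (auto simp: K'_def intro!: closed_Un closed_Union)
          then show "closedin (top_of_set (S0 \<union> \<Union>K)) Q" "closedin (top_of_set (S0 \<union> \<Union>K)) (S0 \<union> \<Union>K')"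
            unfolding dom by (auto intro!: closed_subset)
          show "topspace (top_of_set (S0 \<union> \<Union>K)) \<subseteq> Q \<union> (S0 \<union> \<Union>K')"
            unfolding dom by simp
          have "(S0 \<union> \<Union>K) \<inter> Q = Q" "(S0 \<union> \<Union>K) \<inter> (S0 \<union> \<Union>K') = S0 \<union> \<Union>K'"
            unfolding dom by blast+
          then show "continuous_map (subtopology (top_of_set (S0 \<union> \<Union>K)) Q) X h"
            "continuous_map (subtopology (top_of_set (S0 \<union> \<Union>K)) (S0 \<union> \<Union>K')) X G"
            using h(1) G(1) by (simp_all add: subtopology_subtopology)
          show "h x = G x" if "x \<in> Q" "x \<in> S0 \<union> \<Union>K'" for x
            using h(2) meet[OF that] by blast
        qed
        moreover have "G' x = g x" if "x \<in> S0" for x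
          using G'G[of x] G(2) that by simp
        moreover have "G' ` Q' \<subseteq> A Q'" if "Q' \<in> K" for Q'
        proof (cases "Q' = Q")
          case True
          then show ?thesis
            using h(3) by (simp add: G'_def)
        next
          case False
          then have "Q' \<in> K'"
            using that by (simp add: K'_def)
          moreover then have "G' ` Q' = G ` Q'"
            using G'G by (intro image_cong) auto
          ultimately show ?thesis
            using G(3) by simp
        qed
        ultimately show ?thesis
          by blast
      qed
    qed
  qed
  have "S0 \<union> \<Union>{Q \<in> cells d N. Q \<subseteq> S} = S"
    using S0(2) cellular_Union[OF S] by blast
  moreover have "\<forall>Q\<in>{Q \<in> cells d N. Q \<subseteq> S}. \<forall>R\<in>cells d N. R \<subseteq> Q \<longrightarrow> R \<in> {Q \<in> cells d N. Q \<subseteq> S}"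
    by blast
  note step[OF subset_refl this]
  ultimately obtain G where "continuous_map (top_of_set S) X G \<and> (\<forall>x\<in>S0. G x = g x) \<and>
      (\<forall>Q\<in>{Q \<in> cells d N. Q \<subseteq> S}. G ` Q \<subseteq> A Q)"
    by auto
  then show ?thesis
    using that[of G] by simp
qed

lemma cellular_cube: "0 < N \<Longrightarrow> cellular d N (cube d)"
  unfolding cellular_def by (meson minimal_cell cell_subset_cube)

lemma cellular_cube_boundary:
  assumes "0 < N"
  shows "cellular d N (cube_boundary d)"
  unfolding cellular_def
proof
  fix x assume x: "x \<in> cube_boundary d"
  then obtain i where i: "i < d" "\<bar>x i\<bar> = 1"
    by (auto simp: cube_boundary_def)
  obtain Q where Q: "Q \<in> cells d N" "x \<in> Q" "\<And>i y. i < d \<Longrightarrow> \<bar>x i\<bar> = 1 \<Longrightarrow> y \<in> Q \<Longrightarrow> y i = x i"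
    using minimal_cell[OF assms, of x d] x by (auto simp: cube_boundary_def)
  have "Q \<subseteq> cube_boundary d"
    using cell_subset_cube[OF assms Q(1)] Q(3)[OF i] i by (auto simp: cube_boundary_def)
  then show "\<exists>Q\<in>cells d N. x \<in> Q \<and> Q \<subseteq> cube_boundary d"
    using Q by blast
qed

section \<open>Fine grids\<close>

text \<open>Size is bounded coordinatewise, so that it passes from a cell of a prism to its
  projection onto the base.\<close>

definition small :: "nat \<Rightarrow> (nat \<Rightarrow> real) set \<Rightarrow> bool" where
  "small N S \<longleftrightarrow> (\<forall>x\<in>S. \<forall>y\<in>S. \<forall>i. \<bar>x i - y i\<bar> \<le> 2 / real N)"

lemma small_cell: "0 < N \<Longrightarrow> Q \<in> cells d N \<Longrightarrow> small N Q"
  using cell_small by (auto simp: small_def)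

lemma compact_cube: "compact (cube d)"
proof -
  let ?I = "\<lambda>i. if i < d then {-1..1} else {0 :: real}"
  have "x \<in> cube d \<longleftrightarrow> (\<forall>i. x i \<in> ?I i)" for x
  proof
    assume x: "x \<in> cube d"
    show "\<forall>i. x i \<in> ?I i"
    proof
      fix i show "x i \<in> ?I i"
        using x by (cases "i < d") (simp_all add: cube_def abs_le_iff)
    qed
  next
    assume x: "\<forall>i. x i \<in> ?I i"
    have "\<bar>x i\<bar> \<le> 1" if "i < d" for i
      using x[rule_format, of i] that by (simp add: abs_le_iff)
    moreover have "x i = 0" if "d \<le> i" for i
      using x[rule_format, of i] that by simp
    ultimately show "x \<in> cube d"
      by (simp add: cube_def)
  qed
  then have eq: "cube d = (\<Pi>\<^sub>E i\<in>UNIV. ?I i)"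
    unfolding PiE_UNIV_domain Pi_def by blast
  have "compactin (powertop_real UNIV) (\<Pi>\<^sub>E i\<in>UNIV. ?I i)"
    unfolding compactin_PiE
  proof (intro disjI2 ballI)
    fix i show "compactin euclideanreal (?I i)"
      by (cases "i < d") simp_all
  qed
  then show ?thesis
    unfolding eq euclidean_product_topology by simp
qed

lemma compact_cube_boundary: "compact (cube_boundary d)"
proof -
  have "cube d \<inter> cube_boundary d = cube_boundary d"
    by (auto simp: cube_boundary_def)
  then show ?thesis
    using compact_Int_closed[OF compact_cube closed_cellular[OF cellular_cube_boundary[of 1 d]], of d]
    by simp
qed

text \<open>The distance of functions is a series with weights (1/2)^n, and these weights sum to
  2.\<close>

lemma dist_fun_le:
  fixes x y :: "nat \<Rightarrow> real"
  assumes "\<And>i. \<bar>x i - y i\<bar> \<le> c"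
  shows "dist x y \<le> 2 * c"
proof -
  have c: "0 \<le> c"
    using assms[of 0] by linarith
  have geo: "summable (\<lambda>n. (1 / 2) ^ n * c :: real)" "suminf (\<lambda>n. (1 / 2) ^ n * c) = 2 * c"
    using suminf_mult2[of "\<lambda>n. (1 / 2 :: real) ^ n" c] suminf_geometric[of "1 / 2 :: real"]
    by (auto intro: summable_mult2 summable_geometric)
  have le: "(1 / 2) ^ n * min (dist (x (from_nat n)) (y (from_nat n))) 1 \<le> (1 / 2) ^ n * c" for n :: nat
    using assms[of "from_nat n"] by (intro mult_left_mono) (auto simp: dist_real_def)
  have "summable (\<lambda>n. (1 / 2) ^ n * min (dist (x (from_nat n)) (y (from_nat n))) 1)"
    using geo(1) le by (intro summable_comparison_test[OF _ geo(1)]) auto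
  then have "dist x y \<le> suminf (\<lambda>n. (1 / 2) ^ n * c)"
    unfolding dist_fun_def using le geo(1) by (intro suminf_le) auto
  then show ?thesis
    by (simp add: geo(2))
qed

text \<open>Lebesgue number of the open cover of \<open>K\<close> by the preimages of the open stars
  of vertices. A set below that size lies in one star, so all its images share a vertex.\<close>

lemma fine_grid:
  fixes h :: "(nat \<Rightarrow> real) \<Rightarrow> ('x \<times> real) list"
  assumes K: "compact K" and h: "continuous_map (top_of_set K) points h"
  obtains N where "0 < N" "\<And>S. S \<noteq> {} \<Longrightarrow> S \<subseteq> K \<Longrightarrow> small N S \<Longrightarrow> \<exists>v. \<forall>x\<in>S. v \<in> supp (h x)"
proof -
  have hp: "h x \<in> topspace points" if "x \<in> K" for x
    using h that by (force simp: continuous_map_def)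
  have "\<exists>B. open B \<and> {x \<in> K. v \<in> supp (h x)} = K \<inter> B" for v
  proof -
    have "continuous_map (top_of_set K) euclideanreal (\<lambda>x. weight v (h x))"
      using continuous_map_compose[OF h continuous_map_weight] by (simp add: o_def)
    then have "openin (top_of_set K) {x \<in> topspace (top_of_set K). weight v (h x) \<in> {0<..}}"
      by (rule openin_continuous_map_preimage) simp
    moreover have "{x \<in> topspace (top_of_set K). weight v (h x) \<in> {0<..}} = {x \<in> K. v \<in> supp (h x)}"
      using weight_pos_points[OF hp] by auto
    ultimately show ?thesis
      by (auto simp: openin_open)
  qed
  then have "\<forall>v. \<exists>B. open B \<and> {x \<in> K. v \<in> supp (h x)} = K \<inter> B"
    by blast
  from choice[OF this] obtain B where "\<forall>v. open (B v) \<and> {x \<in> K. v \<in> supp (h x)} = K \<inter> B v" ..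
  then have B: "\<And>v. open (B v)" "\<And>v. {x \<in> K. v \<in> supp (h x)} = K \<inter> B v"
    by auto
  have cover: "K \<subseteq> \<Union>(range B)"
  proof
    fix x assume x: "x \<in> K"
    then obtain v where "v \<in> supp (h x)"
      using points_facts(4)[OF hp] by blast
    then show "x \<in> \<Union>(range B)"
      using B(2)[of v] x by blast
  qed
  obtain e where e: "e > 0" "\<And>x. x \<in> K \<Longrightarrow> \<exists>G\<in>range B. ball x e \<subseteq> G"
    using Heine_Borel_lemma[OF K cover] B(1) by blast
  \<comment> \<open>Two points of a small set have distance at most 2 * (2 / N) by
    \<open>dist_fun_le\<close>, and this must be less than the Lebesgue number
    \<open>e\<close>.\<close>
  obtain N where N: "0 < N" "4 / e < real N"
  proof -
    obtain N where "4 / e < real N"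
      using reals_Archimedean2[of "4 / e"] by blast
    moreover have "0 < 4 / e"
      using e(1) by simp
    then have "0 < real N"
      using \<open>4 / e < real N\<close> by linarith
    ultimately show ?thesis
      using that[of N] by simp
  qed
  show ?thesis
  proof (rule that[OF N(1)])
    fix S assume S: "S \<noteq> {}" "S \<subseteq> K" "small N S"
    then obtain x0 where x0: "x0 \<in> S"
      by blast
    obtain v where v: "ball x0 e \<subseteq> B v"
      using e(2)[of x0] x0 S(2) by blast
    have "v \<in> supp (h x)" if "x \<in> S" for x
    proof -
      have "dist x0 x \<le> 2 * (2 / real N)"
        using S(3) x0 that by (intro dist_fun_le) (auto simp: small_def)
      also have "\<dots> < e"
        using N e(1) by (simp add: field_simps)
      finally have "x \<in> B v"
        using v by auto
      then show ?thesis
        using B(2)[of v] that S(2) by blast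
    qed
    then show "\<exists>v. \<forall>x\<in>S. v \<in> supp (h x)"
      by blast
  qed
qed

lemma homotopic_model_mono:
  assumes "hereditary P" "hereditary Q" "\<And>s. P s \<Longrightarrow> Q s"
    and "homotopic_with (\<lambda>_. True) Z (model P) f g"
  shows "homotopic_with (\<lambda>_. True) Z (model Q) f g"
proof -
  have "continuous_map (model P) (model Q) id"
    using continuous_map_model_mono[OF assms(1-3) continuous_map_id] .
  from homotopic_with_compose_continuous_map_left[OF assms(4) this, of "\<lambda>_. True"] show ?thesis
    by simp
qed

text \<open>A free null homotopy extends the map over the cube, and contracting the cube to
  \<open>sphere_base\<close> yields a based one.\<close>

lemma null_homotopic_based:
  assumes "homotopic_with (\<lambda>_. True) (nsphere k) X f (\<lambda>_. c)"
  shows "homotopic_with (\<lambda>h. h sphere_base = f sphere_base) (nsphere k) X f (\<lambda>_. f sphere_base)"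
proof -
  have f: "continuous_map (nsphere k) X f"
    using homotopic_with_imp_continuous_maps[OF assms] by blast
  have 1: "continuous_map (top_of_set (cube_boundary (Suc k))) X (f \<circ> to_sphere k)"
    using continuous_map_to_sphere f by (rule continuous_map_compose)
  have 2: "homotopic_with (\<lambda>_. True) (nsphere k) X (f \<circ> to_sphere k \<circ> to_cube k) (\<lambda>_. c)"
    using assms by (rule homotopic_with_eq) (auto simp: nsphere_eq to_sphere_to_cube)
  show ?thesis
  proof (rule extend_over_cube[OF 1 2])
    fix F
    assume F: "continuous_map (top_of_set (cube (Suc k))) X F"
      "\<And>x. x \<in> cube_boundary (Suc k) \<Longrightarrow> F x = (f \<circ> to_sphere k) x"
    have Fb: "F sphere_base = f sphere_base"
      using F(2)[OF sphere_base_in_cube_boundary] by simp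
    show ?thesis
      using null_homotopic_from_cube[OF F(1)] unfolding Fb
    proof (rule homotopic_with_eq)
      fix x assume "x \<in> topspace (nsphere k)"
      then have x: "x \<in> sphere_set k"
        by (simp add: nsphere_eq)
      show "f x = (F \<circ> to_cube k) x"
        using F(2)[OF to_cube_in[OF x]] to_sphere_to_cube[OF x] by simp
    qed (auto simp: sphere_base_in_nsphere)
  qed
qed

section \<open>Essential connectedness of translate filtrations\<close>

definition in_translate :: "('g \<Rightarrow> 'x \<Rightarrow> 'x) \<Rightarrow> 'g set \<Rightarrow> 'x set \<Rightarrow> 'x set \<Rightarrow> bool" where
  "in_translate \<phi> S C s \<longleftrightarrow> (\<exists>g\<in>S. s \<subseteq> \<phi> g ` C)"

lemma hereditary_in_translate: "hereditary (in_translate \<phi> S C)"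
  by (auto simp: hereditary_def in_translate_def)

lemma in_translate_mono: "in_translate \<phi> S C s \<Longrightarrow> C \<subseteq> C' \<Longrightarrow> in_translate \<phi> S C' s"
  unfolding in_translate_def by (meson image_mono subset_trans)

lemma translates_E_eq: "translates_E \<phi> S C = full_complex (in_translate \<phi> S C)"
proof -
  have "(\<Union>g\<in>S. map (\<phi> g) ` {xs. length xs = Suc k \<and> set xs \<subseteq> C}) =
      {xs. length xs = Suc k \<and> in_translate \<phi> S C (set xs)}" for k
  proof (intro equalityI subsetI)
    fix xs assume "xs \<in> {xs. length xs = Suc k \<and> in_translate \<phi> S C (set xs)}"
    then obtain g where g: "g \<in> S" "length xs = Suc k" "set xs \<subseteq> \<phi> g ` C"
      by (auto simp: in_translate_def)
    then have "xs \<in> lists (\<phi> g ` C)"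
      by (simp add: in_lists_conv_set subset_iff)
    then obtain ys where "xs = map (\<phi> g) ys" "ys \<in> lists C"
      unfolding lists_image by blast
    then show "xs \<in> (\<Union>g\<in>S. map (\<phi> g) ` {xs. length xs = Suc k \<and> set xs \<subseteq> C})"
      using g by (intro UN_I[of g]) auto
  next
    fix xs assume "xs \<in> (\<Union>g\<in>S. map (\<phi> g) ` {xs. length xs = Suc k \<and> set xs \<subseteq> C})"
    then obtain g ys where g: "g \<in> S" "xs = map (\<phi> g) ys" "length ys = Suc k" "set ys \<subseteq> C"
      by blast
    then have "set xs \<subseteq> \<phi> g ` C"
      by auto
    then show "xs \<in> {xs. length xs = Suc k \<and> in_translate \<phi> S C (set xs)}"
      using g(1-3) unfolding in_translate_def by auto
  qed
  then show ?thesis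
    by (simp add: translates_E_def full_complex_def simplicial_E_def)
qed

text \<open>Any two points form a 0-sphere; a null homotopy of it supplies the path along which a
  base point is moved.\<close>

lemma two_point_map:
  assumes "p \<in> topspace X" "q \<in> topspace X"
  shows "continuous_map (nsphere 0) X (\<lambda>x. if x \<in> {x \<in> sphere_set 0. 0 \<le> x 0} then p else q)"
proof (rule pasting_two_closed)
  have cl: "closedin (top_of_set (sphere_set 0)) {x \<in> sphere_set 0. x 0 \<in> K}" if "closed K" for K :: "real set"
  proof -
    have "{x \<in> sphere_set 0. x 0 \<in> K} = sphere_set 0 \<inter> (\<lambda>x. x 0) -` K"
      by auto
    then show ?thesis
      using continuous_closedin_preimage[OF continuous_on_coordinate that] by simp
  qed
  show "closedin (nsphere 0) {x \<in> sphere_set 0. 0 \<le> x 0}" "closedin (nsphere 0) {x \<in> sphere_set 0. x 0 \<le> 0}"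
    using cl[of "{0..}"] cl[of "{..0}"] by (simp_all add: nsphere_eq)
  show "p = q" if "x \<in> {x \<in> sphere_set 0. 0 \<le> x 0}" "x \<in> {x \<in> sphere_set 0. x 0 \<le> 0}" for x
    using that by (auto simp: sphere_set_def)
qed (use assms in \<open>auto simp: nsphere_eq\<close>)

text \<open>Base points are removed at the price of a second enlargement: the case of degree 0 gives
  a compact set in which every sphere can be joined to \<open>v\<close>, and after a change of base
  point the case of degree \<open>k\<close> applies. The converse is
  \<open>null_homotopic_based\<close>. \<open>ne\<close> provides the vertex demanded on the left,
  also for m = 0.\<close>

lemma essentially_connected_iff:
  fixes X :: "'x topology" and \<phi> :: "'g \<Rightarrow> 'x \<Rightarrow> 'x"
  assumes e: "e \<in> S" "\<And>x. x \<in> topspace X \<Longrightarrow> \<phi> e x = x" and ne: "topspace X \<noteq> {}"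
  shows "essentially_connected (int m - 1) (simplicial_E (topspace X)) (compacts X) (translates_E \<phi> S) \<longleftrightarrow>
    (\<forall>k<m. \<forall>C. compactin X C \<longrightarrow> (\<exists>C'. compactin X C' \<and> C \<subseteq> C' \<and>
       sphere_null k (model (in_translate \<phi> S C)) (model (in_translate \<phi> S C'))))"
proof -
  let ?P = "in_translate \<phi> S"
  note her = hereditary_in_translate[of \<phi> S]
  define based where "based k v C C' \<longleftrightarrow>
    (\<forall>f. continuous_map (nsphere k) (model (?P C)) f \<and> f sphere_base = vertex_point v \<longrightarrow>
       homotopic_with (\<lambda>h. h sphere_base = vertex_point v) (nsphere k) (model (?P C')) f (\<lambda>_. vertex_point v))"
    for k v C C'
  have iff: "essentially_connected (int m - 1) (simplicial_E (topspace X)) (compacts X) (translates_E \<phi> S) \<longleftrightarrow>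
      (\<exists>v\<in>topspace X. \<forall>k<m. \<forall>C. compactin X C \<longrightarrow> ?P C {v} \<longrightarrow>
         (\<exists>C'. compactin X C' \<and> C \<subseteq> C' \<and> based k v C C'))" (is "?L \<longleftrightarrow> ?R")
  proof -
    have triv: "trivial_on_homotopy_group k
        (realization (translates_E \<phi> S C)) (realization_vertex (translates_E \<phi> S C) [v])
        (realization (translates_E \<phi> S C')) (realization_inclusion (translates_E \<phi> S C')) \<longleftrightarrow> based k v C C'"
      if "?P C {v}" "C \<subseteq> C'" for k v C C'
      unfolding translates_E_eq based_def
      by (rule trivial_on_homotopy_group_model[OF her her]) (use that in_translate_mono in blast)+
    have simp0: "simplices (translates_E \<phi> S C) 0 = {xs. \<exists>v. xs = [v] \<and> ?P C {v}}" for C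
      unfolding translates_E_eq by (auto simp: length_Suc_conv)
    have simpX: "simplices (simplicial_E (topspace X)) 0 = (\<lambda>v. [v]) ` topspace X"
      by (auto simp: simplicial_E_def length_Suc_conv)
    have int: "int k \<le> int m - 1 \<longleftrightarrow> k < m" for k
      by linarith
    show ?thesis
    proof
      assume ?L
      then obtain v where v: "v \<in> topspace X" and L: "\<And>k C. k < m \<Longrightarrow> compactin X C \<Longrightarrow> ?P C {v} \<Longrightarrow>
          \<exists>C'\<in>compacts X. C \<le> C' \<and> trivial_on_homotopy_group k
            (realization (translates_E \<phi> S C)) (realization_vertex (translates_E \<phi> S C) [v])
            (realization (translates_E \<phi> S C')) (realization_inclusion (translates_E \<phi> S C'))"
        unfolding essentially_connected_def simpX int simp0 by (auto simp: compacts_def)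
      show ?R
      proof (intro bexI[OF _ v] allI impI)
        fix k C assume *: "k < m" "compactin X C" "?P C {v}"
        from L[OF this] triv[OF *(3)] show "\<exists>C'. compactin X C' \<and> C \<subseteq> C' \<and> based k v C C'"
          by (auto simp: compacts_def)
      qed
    next
      assume ?R
      then obtain v where v: "v \<in> topspace X" and R: "\<And>k C. k < m \<Longrightarrow> compactin X C \<Longrightarrow> ?P C {v} \<Longrightarrow>
          \<exists>C'. compactin X C' \<and> C \<subseteq> C' \<and> based k v C C'"
        by blast
      show ?L
        unfolding essentially_connected_def simpX int
      proof (intro bexI[of _ "[v]"] allI impI ballI)
        fix k C assume "k < m" "C \<in> compacts X" "[v] \<in> simplices (translates_E \<phi> S C) 0"
        then have *: "k < m" "compactin X C" "?P C {v}"
          by (auto simp: simp0 compacts_def)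
        from R[OF this] obtain C' where C': "compactin X C'" "C \<subseteq> C'" "based k v C C'"
          by blast
        show "\<exists>\<beta>\<in>compacts X. C \<le> \<beta> \<and> trivial_on_homotopy_group k
            (realization (translates_E \<phi> S C)) (realization_vertex (translates_E \<phi> S C) [v])
            (realization (translates_E \<phi> S \<beta>)) (realization_inclusion (translates_E \<phi> S \<beta>))"
          using C' triv[OF *(3) C'(2)] by (intro bexI[of _ C']) (auto simp: compacts_def)
      qed (use v in auto)
    qed
  qed
  show ?thesis
    unfolding iff
  proof
    assume "\<exists>v\<in>topspace X. \<forall>k<m. \<forall>C. compactin X C \<longrightarrow> ?P C {v} \<longrightarrow>
         (\<exists>C'. compactin X C' \<and> C \<subseteq> C' \<and> based k v C C')"
    then obtain v where v: "v \<in> topspace X" and b: "\<And>k C. k < m \<Longrightarrow> compactin X C \<Longrightarrow> ?P C {v} \<Longrightarrow>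
         \<exists>C'. compactin X C' \<and> C \<subseteq> C' \<and> based k v C C'"
      by blast
    show "\<forall>k<m. \<forall>C. compactin X C \<longrightarrow> (\<exists>C'. compactin X C' \<and> C \<subseteq> C' \<and>
        sphere_null k (model (?P C)) (model (?P C')))"
    proof (intro allI impI)
      fix k C assume k: "k < m" and C: "compactin X C"
      \<comment> \<open>The based condition speaks only of members of the filtration that contain
        \<open>v\<close>.\<close>
      define C0 where "C0 = insert v C"
      have C0: "compactin X C0"
        unfolding C0_def using compactin_Un[OF _ C, of "{v}"] v by (simp add: finite_imp_compactin)
      have "?P C0 {v}"
        unfolding in_translate_def using e(1) e(2)[OF v] by (auto simp: C0_def intro!: bexI[of _ e] rev_image_eqI[of v])
      obtain C1 where C1: "compactin X C1" "C0 \<subseteq> C1" "based 0 v C0 C1"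
        using b[of 0 C0] k C0 \<open>?P C0 {v}\<close> by auto
      have "?P C1 {v}"
        using in_translate_mono[OF \<open>?P C0 {v}\<close> C1(2)] .
      then obtain C2 where C2: "compactin X C2" "C1 \<subseteq> C2" "based k v C1 C2"
        using b[OF k C1(1)] by auto
      have sub: "\<And>s. ?P C s \<Longrightarrow> ?P C0 s" "\<And>s. ?P C0 s \<Longrightarrow> ?P C1 s" "\<And>s. ?P C1 s \<Longrightarrow> ?P C2 s"
        using in_translate_mono[of \<phi> S C _ C0] in_translate_mono[OF _ C1(2)] in_translate_mono[OF _ C2(2)]
        by (auto simp: C0_def)
      have "sphere_null k (model (?P C)) (model (?P C2))"
        unfolding sphere_null_def
      proof (intro allI impI)
        fix f assume "continuous_map (nsphere k) (model (?P C)) f"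
        then have f0: "continuous_map (nsphere k) (model (?P C0)) f"
          using continuous_map_model_mono[of "?P C" "?P C0", OF her her sub(1)] by blast
        then have f1: "continuous_map (nsphere k) (model (?P C1)) f"
          using continuous_map_model_mono[of "?P C0" "?P C1", OF her her sub(2)] by blast
        have q: "f sphere_base \<in> topspace (model (?P C0))"
          using f0 sphere_base_in_nsphere by (force simp: continuous_map_def)
        have p: "vertex_point v \<in> topspace (model (?P C0))"
          using \<open>?P C0 {v}\<close> by (simp add: topspace_model_eq[OF her] vertex_point_in_points)
        define g where "g x = (if x \<in> {x \<in> sphere_set 0. 0 \<le> x 0} then vertex_point v else f sphere_base)"
          for x :: "nat \<Rightarrow> real"
        have "continuous_map (nsphere 0) (model (?P C0)) g"
          unfolding g_def using p q by (rule two_point_map)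
        moreover have "g sphere_base = vertex_point v"
          using sphere_base_in_sphere_set[of 0] by (simp add: g_def sphere_base_def)
        ultimately have "homotopic_with (\<lambda>h. h sphere_base = vertex_point v) (nsphere 0) (model (?P C1)) g (\<lambda>_. vertex_point v)"
          using C1(3) unfolding based_def by blast
        then have "homotopic_with (\<lambda>_. True) (nsphere 0) (model (?P C1)) g (\<lambda>_. vertex_point v)"
          by (rule homotopic_with_mono) simp
        then obtain H where H: "continuous_map (prod_topology (top_of_set {0..1::real}) (nsphere 0)) (model (?P C1)) H"
          "\<And>x. H (0, x) = g x" "\<And>x. H (1, x) = vertex_point v"
          by (rule homotopic_with_trueE) simp
        \<comment> \<open>The second point of the 0-sphere; its track under \<open>H\<close> is a
          path from \<open>f sphere_base\<close> to \<open>v\<close>.\<close>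
        define x' :: "nat \<Rightarrow> real" where "x' = (\<lambda>i. if i = 0 then -1 else 0)"
        have x': "x' \<in> topspace (nsphere 0)" "g x' = f sphere_base"
          by (auto simp: nsphere_eq sphere_set_def x'_def g_def)
        have "continuous_map (top_of_set {0..1}) (prod_topology (top_of_set {0..1::real}) (nsphere 0)) (\<lambda>s. (s, x'))"
          using x'(1) by (intro continuous_map_pairedI) auto
        from continuous_map_compose[OF this H(1)]
        have "continuous_map (top_of_set {0..1}) (model (?P C1)) (\<lambda>s. H (s, x'))"
          by (simp add: o_def)
        moreover have "H (0, x') = f sphere_base"
          using H(2) x'(2) by simp
        ultimately obtain f' where f': "homotopic_with (\<lambda>_. True) (nsphere k) (model (?P C1)) f f'"
          "f' sphere_base = vertex_point v"
          using change_base_sphere[OF f1, of "\<lambda>s. H (s, x')"] H(3) by auto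
        have "continuous_map (nsphere k) (model (?P C1)) f'"
          using homotopic_with_imp_continuous_maps[OF f'(1)] by blast
        then have "homotopic_with (\<lambda>h. h sphere_base = vertex_point v) (nsphere k) (model (?P C2)) f' (\<lambda>_. vertex_point v)"
          using C2(3) f'(2) unfolding based_def by blast
        then have "homotopic_with (\<lambda>_. True) (nsphere k) (model (?P C2)) f' (\<lambda>_. vertex_point v)"
          by (rule homotopic_with_mono) simp
        with homotopic_model_mono[OF her her sub(3) f'(1)]
        have "homotopic_with (\<lambda>_. True) (nsphere k) (model (?P C2)) f (\<lambda>_. vertex_point v)"
          by (rule homotopic_with_trans)
        then show "\<exists>c. homotopic_with (\<lambda>_. True) (nsphere k) (model (?P C2)) f (\<lambda>_. c)"
          by blast
      qed
      then show "\<exists>C'. compactin X C' \<and> C \<subseteq> C' \<and> sphere_null k (model (?P C)) (model (?P C'))"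
        using C1(2) C2(1,2) by (intro exI[of _ C2]) (auto simp: C0_def)
    qed
  next
    assume R: "\<forall>k<m. \<forall>C. compactin X C \<longrightarrow> (\<exists>C'. compactin X C' \<and> C \<subseteq> C' \<and>
        sphere_null k (model (?P C)) (model (?P C')))"
    obtain v where v: "v \<in> topspace X"
      using ne by blast
    have "based k v C C'" if null: "sphere_null k (model (?P C)) (model (?P C'))" for k C C'
      unfolding based_def
    proof (intro allI impI; elim conjE)
      fix f assume f: "continuous_map (nsphere k) (model (?P C)) f" "f sphere_base = vertex_point v"
      then obtain c where "homotopic_with (\<lambda>_. True) (nsphere k) (model (?P C')) f (\<lambda>_. c)"
        using null unfolding sphere_null_def by blast
      from null_homotopic_based[OF this] f(2)
      show "homotopic_with (\<lambda>h. h sphere_base = vertex_point v) (nsphere k) (model (?P C')) f (\<lambda>_. vertex_point v)"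
        by simp
    qed
    with R v show "\<exists>v\<in>topspace X. \<forall>k<m. \<forall>C. compactin X C \<longrightarrow> ?P C {v} \<longrightarrow>
         (\<exists>C'. compactin X C' \<and> C \<subseteq> C' \<and> based k v C C')"
      by blast
  qed
qed

section \<open>Homotopies through contractible carriers\<close>

lemma foldr_wcons_const:
  assumes "\<And>i. i \<in> set is \<Longrightarrow> 0 \<le> t i"
  shows "foldr wcons (map (\<lambda>i. (v, t i)) is) [] =
    (if sum_list (map t is) = 0 then [] else [(v, sum_list (map t is))])"
  using assms
proof (induction "is")
  case (Cons i "is")
  have "0 \<le> t i" "0 \<le> sum_list (map t is)"
    using Cons.prems by (simp, intro sum_list_nonneg) auto
  then show ?case
    using Cons by (auto simp: add_nonneg_eq_0_iff)
qed simp

lemma vertex_map_const: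
  assumes "l \<in> topspace points"
  shows "vertex_map (\<lambda>_. v) l = vertex_point v"
proof -
  obtain k xs t where *: "l = normal_form (k, xs, t)" "length xs = Suc k" "t \<in> standard_simplex k"
    using assms by (auto simp: topspace_model)
  have t: "0 \<le> t i" "(\<Sum>i\<le>k. t i) = 1" for i
    using *(3) by (auto simp: standard_simplex_def)
  have "weighted_tuple k (map (\<lambda>_. v) xs) t = map (\<lambda>i. (v, t i)) [0..<Suc k]"
    using *(2) by (auto simp: weighted_tuple_def simp del: upt_Suc)
  moreover have "sum_list (map t [0..<Suc k]) = 1"
    using t(2) by (simp add: sum_list_distinct_conv_sum_set atLeast0LessThan lessThan_Suc_atMost del: upt_Suc)
  ultimately have "normal_form (k, map (\<lambda>_. v) xs, t) = vertex_point v"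
    using foldr_wcons_const[of "[0..<Suc k]" t v] t(1)
    by (simp add: wnorm_def vertex_point_def del: upt_Suc)
  then show ?thesis
    unfolding *(1) vertex_map_normal_form[OF *(2,3)] .
qed

text \<open>In a full simplex the identity is contiguous to the constant map at any vertex.\<close>

lemma sphere_null_simplex:
  assumes "U \<noteq> {}"
  shows "sphere_null k (model (\<lambda>s. s \<subseteq> U)) (model (\<lambda>s. s \<subseteq> U))"
  unfolding sphere_null_def
proof (intro allI impI)
  have her: "hereditary (\<lambda>s. s \<subseteq> U)"
    by (auto simp: hereditary_def)
  fix f assume "continuous_map (nsphere k) (model (\<lambda>s. s \<subseteq> U)) f"
  then have f: "continuous_map (nsphere k) points f" "\<And>z. z \<in> topspace (nsphere k) \<Longrightarrow> supp (f z) \<subseteq> U"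
    by (auto simp: continuous_map_into_model[OF her])
  have fp: "f z \<in> topspace points" if "z \<in> topspace (nsphere k)" for z
    using f(1) that by (force simp: continuous_map_def)
  obtain v where "v \<in> U"
    using assms by blast
  then have "homotopic_with (\<lambda>_. True) (nsphere k) (model (\<lambda>s. s \<subseteq> U))
      (vertex_map id \<circ> f) (vertex_map (\<lambda>_. v) \<circ> f)"
    using f(2) by (intro homotopic_contiguous f(1) her) auto
  then have "homotopic_with (\<lambda>_. True) (nsphere k) (model (\<lambda>s. s \<subseteq> U)) f (\<lambda>_. vertex_point v)"
    by (rule homotopic_with_eq) (auto simp: fp vertex_map_ident vertex_map_const)
  then show "\<exists>c. homotopic_with (\<lambda>_. True) (nsphere k) (model (\<lambda>s. s \<subseteq> U)) f (\<lambda>_. c)"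
    by blast
qed

text \<open>
  The homotopy is an extension problem over the prism \<open>cube_boundary d \<times> [-1, 1]\<close>; the carrier
  of a cell is the full simplex on all vertices which the two maps use over that cell.
\<close>

lemma homotopic_small_carriers:
  assumes f: "continuous_map (top_of_set (cube_boundary d)) points f"
    and f': "continuous_map (top_of_set (cube_boundary d)) points f'"
    and P: "hereditary P" and N: "0 < N"
    and small: "\<And>S. S \<noteq> {} \<Longrightarrow> S \<subseteq> cube_boundary d \<Longrightarrow> small N S \<Longrightarrow>
      P (\<Union>x\<in>S. supp (f x) \<union> supp (f' x))"
  shows "homotopic_with (\<lambda>_. True) (top_of_set (cube_boundary d)) (model P) f f'"
proof -
  \<comment> \<open>\<open>pr\<close> projects the prism \<open>S\<close> to its base and coordinate
    \<open>d\<close> is the time. \<open>S0\<close> consists of the two ends, where \<open>f\<close>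
    is prescribed at -1 and f' at 1.\<close>
  define pr :: "(nat \<Rightarrow> real) \<Rightarrow> nat \<Rightarrow> real" where "pr x i = (if i < d then x i else 0)" for x i
  define S where "S = {x \<in> cube (Suc d). pr x \<in> cube_boundary d}"
  define S0 where "S0 = {x \<in> S. \<bar>x d\<bar> = 1}"
  have pr: "continuous_on R pr" for R
  proof (rule continuous_on_coordinatewise_then_product)
    show "continuous_on R (\<lambda>x. pr x i)" for i
      unfolding pr_def by (cases "i < d") (auto intro: continuous_on_coordinate)
  qed
  have fp: "f x \<in> topspace points" "f' x \<in> topspace points" if "x \<in> cube_boundary d" for x
    using f f' that by (auto simp: continuous_map_def)
  have cellwise: "\<exists>Q\<in>cells (Suc d) N. x \<in> Q \<and> Q \<subseteq> S \<and> (\<bar>x d\<bar> = 1 \<longrightarrow> (\<forall>y\<in>Q. y d = x d))" if x: "x \<in> S" for x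
  proof -
    obtain Q where Q: "Q \<in> cells (Suc d) N" "x \<in> Q"
      "\<And>i y. i < Suc d \<Longrightarrow> \<bar>x i\<bar> = 1 \<Longrightarrow> y \<in> Q \<Longrightarrow> y i = x i"
      using minimal_cell[OF N, of x "Suc d"] x unfolding S_def by blast
    obtain i where i: "i < d" "\<bar>x i\<bar> = 1"
      using x by (auto simp: S_def cube_boundary_def pr_def)
    have "y \<in> S" if "y \<in> Q" for y
    proof -
      have y: "y \<in> cube (Suc d)"
        using cell_subset_cube[OF N Q(1)] that by blast
      then have "pr y \<in> cube d"
        by (simp add: pr_def cube_def)
      moreover have "\<bar>pr y i\<bar> = 1"
        using Q(3)[OF _ i(2) that] i by (simp add: pr_def)
      ultimately show ?thesis
        using y i(1) unfolding S_def cube_boundary_def by blast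
    qed
    then show ?thesis
      using Q(1,2) Q(3)[of d] by (intro bexI[of _ Q]) auto
  qed
  have cS: "cellular (Suc d) N S"
    unfolding cellular_def using cellwise by blast
  have cS0: "cellular (Suc d) N S0"
    unfolding cellular_def
  proof
    fix x assume "x \<in> S0"
    then have x: "x \<in> S" "\<bar>x d\<bar> = 1"
      by (auto simp: S0_def)
    then obtain Q where Q: "Q \<in> cells (Suc d) N" "x \<in> Q" "Q \<subseteq> S" "\<And>y. y \<in> Q \<Longrightarrow> y d = x d"
      using cellwise[OF x(1)] by blast
    have "Q \<subseteq> S0"
      using Q(3,4) x(2) by (auto simp: S0_def)
    then show "\<exists>Q\<in>cells (Suc d) N. x \<in> Q \<and> Q \<subseteq> S0"
      using Q by blast
  qed
  have S0S: "S0 \<subseteq> S"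
    by (auto simp: S0_def)
  define g where "g x = (if x \<in> {x \<in> S0. 0 \<le> x d} then f' (pr x) else f (pr x))" for x
  define U where "U Q = (\<Union>x\<in>Q. supp (f (pr x)) \<union> supp (f' (pr x)))" for Q
  define A where "A Q = {l \<in> topspace points. supp l \<subseteq> U Q}" for Q
  have prS: "continuous_map (top_of_set R) (top_of_set (cube_boundary d)) pr" if "R \<subseteq> S" for R
    using pr[of R] that by (auto simp: continuous_map_in_subtopology S_def)
  have g: "continuous_map (top_of_set S0) points g"
    unfolding g_def
  proof (rule pasting_two_closed)
    have cl: "closedin (top_of_set S0) {x \<in> S0. x d \<in> K}" if "closed K" for K
    proof -
      have "{x \<in> S0. x d \<in> K} = S0 \<inter> (\<lambda>x. x d) -` K"
        by auto
      then show ?thesis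
        using continuous_closedin_preimage[OF continuous_on_coordinate that] by simp
    qed
    show "closedin (top_of_set S0) {x \<in> S0. 0 \<le> x d}" "closedin (top_of_set S0) {x \<in> S0. x d \<le> 0}"
      using cl[of "{0..}"] cl[of "{..0}"] by simp_all
    show "continuous_map (subtopology (top_of_set S0) {x \<in> S0. 0 \<le> x d}) points (\<lambda>x. f' (pr x))"
      "continuous_map (subtopology (top_of_set S0) {x \<in> S0. x d \<le> 0}) points (\<lambda>x. f (pr x))"
      using continuous_map_compose[OF prS[OF S0S] f'] continuous_map_compose[OF prS[OF S0S] f]
      by (auto simp: o_def intro: continuous_map_from_subtopology)
  qed (auto simp: S0_def)
  have gA: "g ` Q \<subseteq> A Q" if Q: "Q \<in> cells (Suc d) N" "Q \<subseteq> S0" for Q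
  proof
    fix l assume "l \<in> g ` Q"
    then obtain x where x: "x \<in> Q" "l = g x"
      by blast
    then have "pr x \<in> cube_boundary d"
      using Q(2) by (auto simp: S0_def S_def)
    then have "l \<in> topspace points"
      using fp by (simp add: x(2) g_def)
    moreover have "supp l \<subseteq> U Q"
      using x(1) unfolding x(2) g_def U_def by auto
    ultimately show "l \<in> A Q"
      by (simp add: A_def)
  qed
  have ext: "\<exists>h'. continuous_map (top_of_set Q) points h' \<and>
      (\<forall>x\<in>\<Union>{R \<in> cells (Suc d) N. R \<subset> Q}. h' x = h x) \<and> h' ` Q \<subseteq> A Q"
    if Q: "Q \<in> cells (Suc d) N" "Q \<subseteq> S"
      and h: "continuous_map (top_of_set (\<Union>{R \<in> cells (Suc d) N. R \<subset> Q})) points h"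
        "\<And>R. R \<in> cells (Suc d) N \<Longrightarrow> R \<subset> Q \<Longrightarrow> h ` R \<subseteq> A R" for Q h
  proof -
    obtain a b where ab: "Q = box_set (grid_point (Suc d) N a) (grid_point (Suc d) N b)" "grid_corners (Suc d) N a b"
      using Q(1) by (auto simp: cells_def)
    obtain x where x: "x \<in> Q"
      using cells_nonempty[OF N Q(1)] by blast
    then have fx: "f (pr x) \<in> topspace points"
      using Q(2) fp by (auto simp: S_def)
    have her: "hereditary (\<lambda>s. s \<subseteq> U Q)"
      by (auto simp: hereditary_def)
    show ?thesis
    proof (cases "cell_dim Q")
      case 0
      then have "{R \<in> cells (Suc d) N. R \<subset> Q} = {}"
        using cell_dim_less[OF N _ Q(1)] by fastforce
      moreover have "f (pr x) \<in> A Q"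
        using fx x by (auto simp: A_def U_def)
      ultimately show ?thesis
        using fx by (intro exI[of _ "\<lambda>_. f (pr x)"]) auto
    next
      case (Suc k)
      have "supp (f (pr x)) \<subseteq> U Q"
        using x by (auto simp: U_def)
      then have "U Q \<noteq> {}"
        using points_facts(4)[OF fx] by blast
      then have null: "sphere_null k (model (\<lambda>s. s \<subseteq> U Q)) (model (\<lambda>s. s \<subseteq> U Q))"
        by (rule sphere_null_simplex)
      note bd = union_proper_faces[OF N ab(2,1)]
      have hU: "supp (h y) \<subseteq> U Q" if "y \<in> \<Union>{R \<in> cells (Suc d) N. R \<subset> Q}" for y
      proof -
        obtain R where R: "R \<in> cells (Suc d) N" "R \<subset> Q" "y \<in> R"
          using \<open>y \<in> _\<close> by blast
        then have "supp (h y) \<subseteq> U R"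
          using h(2)[OF R(1,2)] by (auto simp: A_def)
        also have "U R \<subseteq> U Q"
          unfolding U_def using R(2) by blast
        finally show ?thesis .
      qed
      have cont: "continuous_map (top_of_set (box_boundary (grid_point (Suc d) N a) (grid_point (Suc d) N b)))
          (model (\<lambda>s. s \<subseteq> U Q)) h"
        using h(1) hU unfolding bd continuous_map_into_model[OF her] by simp
      have card: "card {i. grid_point (Suc d) N a i < grid_point (Suc d) N b i} = Suc k"
        using Suc unfolding cell_dim_def ab(1) varying_coordinates[OF N ab(2)] .
      have fin: "finite {i. grid_point (Suc d) N a i < grid_point (Suc d) N b i}"
        by (rule card_ge_0_finite) (simp add: card)
      show ?thesis
      proof (rule extend_over_box[OF grid_corners_le[OF N ab(2)] fin card null cont], fold ab(1))
        fix h' assume h': "continuous_map (top_of_set Q) (model (\<lambda>s. s \<subseteq> U Q)) h'"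
          "\<And>x. x \<in> box_boundary (grid_point (Suc d) N a) (grid_point (Suc d) N b) \<Longrightarrow> h' x = h x"
        then have "continuous_map (top_of_set Q) points h'" "\<And>y. y \<in> Q \<Longrightarrow> supp (h' y) \<subseteq> U Q"
          by (simp_all add: continuous_map_into_model[OF her])
        moreover then have "h' y \<in> topspace points" if "y \<in> Q" for y
          using that by (force simp: continuous_map_def)
        ultimately show ?thesis
          using h'(2) unfolding bd by (intro exI[of _ h']) (auto simp: A_def)
      qed
    qed
  qed
  have "\<exists>G. continuous_map (top_of_set S) points G \<and> (\<forall>x\<in>S0. G x = g x) \<and>
      (\<forall>Q\<in>cells (Suc d) N. Q \<subseteq> S \<longrightarrow> G ` Q \<subseteq> A Q)"
    by (rule cell_extension[where g = g and A = A, OF N cS cS0 S0S g gA ext]) blast+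
  then obtain G where G: "continuous_map (top_of_set S) points G" "\<And>x. x \<in> S0 \<Longrightarrow> G x = g x"
    "\<And>Q. Q \<in> cells (Suc d) N \<Longrightarrow> Q \<subseteq> S \<Longrightarrow> G ` Q \<subseteq> A Q"
    by auto
  have GP: "P (supp (G x))" if x: "x \<in> S" for x
  proof -
    obtain Q where Q: "Q \<in> cells (Suc d) N" "x \<in> Q" "Q \<subseteq> S"
      using cellwise[OF x] by blast
    have "small N (pr ` Q)"
      using small_cell[OF N Q(1)] by (auto simp: small_def pr_def)
    moreover have "pr ` Q \<subseteq> cube_boundary d"
      using Q(3) by (auto simp: S_def)
    ultimately have "P (\<Union>x\<in>pr ` Q. supp (f x) \<union> supp (f' x))"
      using Q(2) by (intro small) auto
    moreover have "supp (G x) \<subseteq> (\<Union>x\<in>pr ` Q. supp (f x) \<union> supp (f' x))"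
      using G(3)[OF Q(1,3)] Q(2) by (auto simp: A_def U_def)
    ultimately show ?thesis
      by (rule hereditaryD[OF P])
  qed
  \<comment> \<open>Homotopy time in [0, 1] is rescaled to the time coordinate in [-1, 1] of the
    prism.\<close>
  define lift :: "real \<times> (nat \<Rightarrow> real) \<Rightarrow> nat \<Rightarrow> real"
    where "lift p i = (if i = d then 2 * fst p - 1 else snd p i)" for p i
  have pr_lift: "pr (lift (s, x)) = x" if "x \<in> cube_boundary d" for s x
    using that by (auto simp: pr_def lift_def cube_boundary_def cube_def)
  have lift_S: "lift (s, x) \<in> S" if "x \<in> cube_boundary d" "0 \<le> s" "s \<le> 1" for s x
    using that pr_lift[OF that(1), of s]
    by (auto simp: S_def cube_def cube_boundary_def lift_def abs_le_iff less_Suc_eq)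
  have "continuous_on ({0..1} \<times> cube_boundary d) lift"
  proof (rule continuous_on_coordinatewise_then_product)
    show "continuous_on ({0..1} \<times> cube_boundary d) (\<lambda>p. lift p i)" for i
      unfolding lift_def by (cases "i = d") (auto intro!: continuous_intros continuous_on_snd_coordinate)
  qed
  then have "continuous_map (prod_topology (top_of_set {0..1::real}) (top_of_set (cube_boundary d))) (top_of_set S) lift"
    using lift_S by (auto simp: continuous_map_in_subtopology)
  from continuous_map_compose[OF this G(1)]
  have "continuous_map (prod_topology (top_of_set {0..1::real}) (top_of_set (cube_boundary d))) points (G \<circ> lift)" .
  then have "continuous_map (prod_topology (top_of_set {0..1::real}) (top_of_set (cube_boundary d))) (model P) (G \<circ> lift)"
    unfolding continuous_map_into_model[OF P] using GP lift_S by auto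
  then show ?thesis
  proof (rule homotopic_with_trueI)
    fix x assume "x \<in> topspace (top_of_set (cube_boundary d))"
    then have x: "x \<in> cube_boundary d"
      by simp
    have "lift (0, x) \<in> S0" "lift (1, x) \<in> S0"
      using lift_S[OF x] by (auto simp: S0_def lift_def)
    then show "(G \<circ> lift) (0, x) = f x" "(G \<circ> lift) (1, x) = f' x"
      using G(2) pr_lift[OF x] by (auto simp: g_def) (auto simp: lift_def)
  qed
qed

section \<open>Subgroups almost commuting with compacts\<close>

locale commuting_subgroup = topological_group G T for G (structure) and T +
  fixes \<Lambda> :: "'a set"
  assumes locally_compact: "locally_compact_space T"
    and subgroup: "subgroup \<Lambda> G"
    and closed: "closedin T \<Lambda>"
    and commutes: "almost_commutes_with_compacts G T \<Lambda>"
begin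

abbreviation cosets :: "'a set topology" where
  "cosets \<equiv> coset_space G T \<Lambda>"

definition proj :: "'a \<Rightarrow> 'a set" where
  "proj x = x <# \<Lambda>"

text \<open>The vertex sets of g\<Lambda> \<cdot> E C. A single element of \<Lambda> serves the
  whole set, so that the set remains a simplex of a translate when \<open>g\<close> is exchanged for
  another centre.\<close>

definition near :: "'a \<Rightarrow> 'a set \<Rightarrow> 'a set \<Rightarrow> bool" where
  "near g C s \<longleftrightarrow> (\<exists>\<nu>\<in>\<Lambda>. s \<subseteq> (\<lambda>c. g \<otimes> (\<nu> \<otimes> c)) ` C)"

text \<open>The translates by g and g' of the image of \<open>C\<close> in the coset space
  intersect.\<close>

definition meets :: "'a set \<Rightarrow> 'a \<Rightarrow> 'a \<Rightarrow> bool" where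
  "meets C g g' \<longleftrightarrow> (\<exists>c\<in>C. \<exists>c'\<in>C. proj (g \<otimes> c) = proj (g' \<otimes> c'))"

lemma subgroup_in: "x \<in> \<Lambda> \<Longrightarrow> x \<in> carrier G"
  using subgroup.mem_carrier[OF subgroup] .

lemma one_subgroup: "\<one> \<in> \<Lambda>"
  using subgroup.one_closed[OF subgroup] .

lemma mult_subgroup: "x \<in> \<Lambda> \<Longrightarrow> y \<in> \<Lambda> \<Longrightarrow> x \<otimes> y \<in> \<Lambda>"
  using subgroup.m_closed[OF subgroup] .

lemma inv_subgroup: "x \<in> \<Lambda> \<Longrightarrow> inv x \<in> \<Lambda>"
  using subgroup.m_inv_closed[OF subgroup] .

lemma compact_in: "compactin T C \<Longrightarrow> x \<in> C \<Longrightarrow> x \<in> carrier G"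
  using compactin_subset_topspace topspace_eq by blast

lemma set_mult_iff: "x \<in> A <#> B \<longleftrightarrow> (\<exists>a\<in>A. \<exists>b\<in>B. x = a \<otimes> b)"
  by (auto simp: set_mult_def)

lemma compact_set_mult:
  assumes "compactin T C" "compactin T D"
  shows "compactin T (C <#> D)"
proof -
  have "compactin (prod_topology T T) (C \<times> D)"
    using assms by (simp add: compactin_Times)
  moreover have "C <#> D = (\<lambda>(x, y). x \<otimes> y) ` (C \<times> D)"
  proof (intro equalityI subsetI)
    fix x assume "x \<in> C <#> D"
    then obtain a b where "a \<in> C" "b \<in> D" "x = a \<otimes> b"
      unfolding set_mult_iff by blast
    then show "x \<in> (\<lambda>(x, y). x \<otimes> y) ` (C \<times> D)"
      by (intro image_eqI[of _ _ "(a, b)"]) auto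
  next
    fix x assume "x \<in> (\<lambda>(x, y). x \<otimes> y) ` (C \<times> D)"
    then show "x \<in> C <#> D"
      unfolding set_mult_iff by auto
  qed
  ultimately show ?thesis
    using image_compactin[OF _ continuous_mult] by metis
qed

lemma compact_inv: "compactin T C \<Longrightarrow> compactin T ((\<lambda>x. inv x) ` C)"
  using image_compactin[OF _ continuous_inv] .

lemma compact_one: "compactin T {\<one>}"
  by (simp add: finite_imp_compactin topspace_eq)

lemma commute_right:
  assumes "compactin T C"
  obtains C' where "compactin T C'" "\<And>c \<nu>. c \<in> C \<Longrightarrow> \<nu> \<in> \<Lambda> \<Longrightarrow> \<exists>\<nu>'\<in>\<Lambda>. \<exists>c'\<in>C'. c \<otimes> \<nu> = \<nu>' \<otimes> c'"
proof -
  obtain C' where C': "compactin T C'" "C <#> \<Lambda> \<subseteq> \<Lambda> <#> C'"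
    using commutes assms unfolding almost_commutes_with_compacts_def by blast
  have "\<exists>\<nu>'\<in>\<Lambda>. \<exists>c'\<in>C'. c \<otimes> \<nu> = \<nu>' \<otimes> c'" if "c \<in> C" "\<nu> \<in> \<Lambda>" for c \<nu>
    using C'(2) that unfolding set_mult_iff subset_iff by blast
  then show ?thesis
    using that C'(1) by blast
qed

lemma commute_left:
  assumes "compactin T C"
  obtains C' where "compactin T C'" "\<And>c \<nu>. c \<in> C \<Longrightarrow> \<nu> \<in> \<Lambda> \<Longrightarrow> \<exists>\<nu>'\<in>\<Lambda>. \<exists>c'\<in>C'. \<nu> \<otimes> c = c' \<otimes> \<nu>'"
proof -
  obtain C' where C': "compactin T C'" "\<Lambda> <#> C \<subseteq> C' <#> \<Lambda>"
    using commutes assms unfolding almost_commutes_with_compacts_def by blast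
  have "\<exists>\<nu>'\<in>\<Lambda>. \<exists>c'\<in>C'. \<nu> \<otimes> c = c' \<otimes> \<nu>'" if "c \<in> C" "\<nu> \<in> \<Lambda>" for c \<nu>
    using C'(2) that unfolding set_mult_iff subset_iff by blast
  then show ?thesis
    using that C'(1) by blast
qed

section \<open>The projection to the coset space and its compact sets\<close>

lemma proj_mult: "g \<in> carrier G \<Longrightarrow> x \<in> carrier G \<Longrightarrow> g <# proj x = proj (g \<otimes> x)"
  unfolding proj_def using lcos_m_assoc[of \<Lambda> g x] subgroup.subset[OF subgroup] by simp

lemma proj_subgroup:
  assumes "x \<in> carrier G" "\<nu> \<in> \<Lambda>"
  shows "proj (x \<otimes> \<nu>) = proj x"
proof -
  have "proj \<nu> = \<Lambda>"
  proof (intro equalityI subsetI)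
    fix x assume "x \<in> proj \<nu>"
    then show "x \<in> \<Lambda>"
      using mult_subgroup[OF assms(2)] by (auto simp: proj_def l_coset_def)
  next
    fix x assume x: "x \<in> \<Lambda>"
    then have "x = \<nu> \<otimes> (inv \<nu> \<otimes> x)"
      using subgroup_in[OF assms(2)] subgroup_in[OF x] by (simp flip: m_assoc)
    then show "x \<in> proj \<nu>"
      using mult_subgroup[OF inv_subgroup[OF assms(2)] x] unfolding proj_def l_coset_def by blast
  qed
  then show ?thesis
    using proj_mult[OF assms(1) subgroup_in[OF assms(2)]] by (simp add: proj_def)
qed

lemma proj_eqD:
  assumes "x \<in> carrier G" "y \<in> carrier G" "proj x = proj y"
  obtains \<nu> where "\<nu> \<in> \<Lambda>" "y = x \<otimes> \<nu>"
proof -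
  have "y \<in> proj y"
    using assms(2) one_subgroup by (auto simp: proj_def l_coset_def intro!: bexI[of _ \<one>])
  then have "y \<in> proj x"
    using assms(3) by simp
  then show ?thesis
    using that by (auto simp: proj_def l_coset_def)
qed

lemma topspace_cosets: "topspace cosets = proj ` carrier G"
  by (simp add: coset_space_def topspace_eq proj_def[abs_def])

lemma quotient_map_proj: "quotient_map T cosets proj"
  unfolding coset_space_def proj_def[abs_def] by (rule quotient_map_quotient_topology)

lemma compact_proj: "compactin T C \<Longrightarrow> compactin cosets (proj ` C)"
  using image_compactin[OF _ quotient_imp_continuous_map[OF quotient_map_proj]] .

text \<open>The preimage of the image of \<open>U\<close> is the union of the right translates of
  \<open>U\<close> by elements of \<Lambda>, each of them open.\<close>

lemma open_proj:
  assumes U: "openin T U"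
  shows "openin cosets (proj ` U)"
proof -
  have Uc: "U \<subseteq> carrier G"
    using openin_subset[OF U] topspace_eq by simp
  have "openin T {x \<in> topspace T. x \<otimes> \<nu> \<in> U}" if "\<nu> \<in> \<Lambda>" for \<nu>
  proof -
    have "continuous_map T (prod_topology T T) (\<lambda>x. (x, \<nu>))"
      using that subgroup_in by (intro continuous_map_pairedI) (auto simp: topspace_eq)
    from continuous_map_compose[OF this continuous_mult]
    have "continuous_map T T (\<lambda>x. x \<otimes> \<nu>)"
      by (simp add: o_def)
    then show ?thesis
      using U by (rule openin_continuous_map_preimage)
  qed
  then have "openin T (\<Union>\<nu>\<in>\<Lambda>. {x \<in> topspace T. x \<otimes> \<nu> \<in> U})"
    by blast
  moreover have "(\<Union>\<nu>\<in>\<Lambda>. {x \<in> topspace T. x \<otimes> \<nu> \<in> U}) = {x \<in> topspace T. proj x \<in> proj ` U}"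
  proof (intro equalityI subsetI)
    fix x assume "x \<in> (\<Union>\<nu>\<in>\<Lambda>. {x \<in> topspace T. x \<otimes> \<nu> \<in> U})"
    then obtain \<nu> where "\<nu> \<in> \<Lambda>" "x \<in> topspace T" "x \<otimes> \<nu> \<in> U"
      by blast
    moreover then have "proj x = proj (x \<otimes> \<nu>)"
      by (simp add: proj_subgroup topspace_eq)
    ultimately show "x \<in> {x \<in> topspace T. proj x \<in> proj ` U}"
      by blast
  next
    fix x assume "x \<in> {x \<in> topspace T. proj x \<in> proj ` U}"
    then obtain u where u: "x \<in> carrier G" "u \<in> U" "proj x = proj u"
      by (auto simp: topspace_eq)
    then obtain \<nu> where "\<nu> \<in> \<Lambda>" "u = x \<otimes> \<nu>"
      using proj_eqD[of x u] Uc by blast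
    then show "x \<in> (\<Union>\<nu>\<in>\<Lambda>. {x \<in> topspace T. x \<otimes> \<nu> \<in> U})"
      using u by (auto simp: topspace_eq)
  qed
  ultimately have "openin T {x \<in> topspace T. proj x \<in> proj ` U}"
    by simp
  moreover have "proj ` U \<subseteq> topspace cosets"
    using Uc by (auto simp: topspace_cosets)
  ultimately show ?thesis
    using quotient_map_proj unfolding quotient_map_def by blast
qed

text \<open>The open sets that lie in compact sets cover the locally compact group, and their images
  are open. Finitely many images cover \<open>F\<close>; the union of the corresponding compact sets
  is \<open>C\<close>.\<close>

lemma compact_lift:
  assumes F: "compactin cosets F"
  obtains C where "compactin T C" "F \<subseteq> proj ` C"
proof -
  define \<U> where "\<U> = {U. openin T U \<and> (\<exists>K. compactin T K \<and> U \<subseteq> K)}"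
  have "F \<subseteq> \<Union>((\<lambda>U. proj ` U) ` \<U>)"
  proof
    fix y assume "y \<in> F"
    then obtain x where x: "x \<in> topspace T" "y = proj x"
      using compactin_subset_topspace[OF F] by (auto simp: topspace_cosets topspace_eq)
    then obtain U K where "openin T U" "compactin T K" "x \<in> U" "U \<subseteq> K"
      using locally_compact unfolding locally_compact_space_def by blast
    then have "U \<in> \<U>" "x \<in> U"
      by (auto simp: \<U>_def)
    then show "y \<in> \<Union>((\<lambda>U. proj ` U) ` \<U>)"
      using x(2) by blast
  qed
  moreover have "openin cosets V" if "V \<in> (\<lambda>U. proj ` U) ` \<U>" for V
    using that open_proj by (auto simp: \<U>_def)
  ultimately obtain \<F> where \<F>: "finite \<F>" "\<F> \<subseteq> (\<lambda>U. proj ` U) ` \<U>" "F \<subseteq> \<Union>\<F>"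
    using compactinD[OF F, of "(\<lambda>U. proj ` U) ` \<U>"] by blast
  obtain \<V> where \<V>: "\<V> \<subseteq> \<U>" "finite \<V>" "\<F> = (\<lambda>U. proj ` U) ` \<V>"
    using finite_subset_image[OF \<F>(1,2)] by blast
  have "\<forall>U\<in>\<V>. \<exists>K. compactin T K \<and> U \<subseteq> K"
    using \<V>(1) by (auto simp: \<U>_def)
  from bchoice[OF this] obtain K where K: "\<forall>U\<in>\<V>. compactin T (K U) \<and> U \<subseteq> K U" ..
  have "compactin T (\<Union>(K ` \<V>))"
    using K \<V>(2) by (intro compactin_Union) auto
  moreover have "F \<subseteq> proj ` \<Union>(K ` \<V>)"
  proof
    fix y assume "y \<in> F"
    then obtain U x where "U \<in> \<V>" "x \<in> U" "y = proj x"
      using \<F>(3) \<V>(3) by blast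
    then show "y \<in> proj ` \<Union>(K ` \<V>)"
      using K by blast
  qed
  ultimately show ?thesis
    by (rule that)
qed

text \<open>From g'c' = gc\<mu> with \<mu> in \<Lambda> one gets g'\<nu> = gc\<mu>(inv c')\<nu>.
  Moving elements of \<Lambda> to the left, past inv c' and then past c, leaves a factor in
  \<Lambda> followed by one in \<open>E1 <#> E2\<close>. These sets depend on \<open>C\<close> only,
  not on g and g'.\<close>

lemma transition:
  assumes C: "compactin T C"
  obtains E where "compactin T E" "\<one> \<in> E"
    "\<And>g g' \<nu>. g \<in> carrier G \<Longrightarrow> g' \<in> carrier G \<Longrightarrow> meets C g g' \<Longrightarrow> \<nu> \<in> \<Lambda> \<Longrightarrow>
       \<exists>\<nu>'\<in>\<Lambda>. \<exists>x\<in>E. g' \<otimes> \<nu> = g \<otimes> (\<nu>' \<otimes> x)"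
proof -
  obtain E1 where E1: "compactin T E1"
    "\<And>c \<nu>. c \<in> C \<Longrightarrow> \<nu> \<in> \<Lambda> \<Longrightarrow> \<exists>\<nu>'\<in>\<Lambda>. \<exists>c'\<in>E1. c \<otimes> \<nu> = \<nu>' \<otimes> c'"
    by (rule commute_right[OF C]) blast
  obtain E2 where E2: "compactin T E2"
    "\<And>c \<nu>. c \<in> (\<lambda>x. inv x) ` C \<Longrightarrow> \<nu> \<in> \<Lambda> \<Longrightarrow> \<exists>\<nu>'\<in>\<Lambda>. \<exists>c'\<in>E2. c \<otimes> \<nu> = \<nu>' \<otimes> c'"
    by (rule commute_right[OF compact_inv[OF C]]) blast
  show ?thesis
  \<comment> \<open>With the unit in \<open>E\<close>, left multiplication by \<open>E\<close>
    enlarges every compact set.\<close>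
  proof (rule that[of "(E1 <#> E2) \<union> {\<one>}"])
    show "compactin T ((E1 <#> E2) \<union> {\<one>})"
      by (intro compactin_Un compact_set_mult E1 E2 compact_one)
  next
    fix g g' \<nu>
    assume g: "g \<in> carrier G" "g' \<in> carrier G" "meets C g g'" and \<nu>: "\<nu> \<in> \<Lambda>"
    then obtain c c' where c: "c \<in> C" "c' \<in> C" "proj (g \<otimes> c) = proj (g' \<otimes> c')"
      by (auto simp: meets_def)
    note cc = compact_in[OF C c(1)] compact_in[OF C c(2)]
    obtain \<mu> where \<mu>: "\<mu> \<in> \<Lambda>" "g' \<otimes> c' = g \<otimes> c \<otimes> \<mu>"
      using proj_eqD[of "g \<otimes> c" "g' \<otimes> c'"] c(3) g cc by blast
    obtain \<nu>2 e2 where 2: "\<nu>2 \<in> \<Lambda>" "e2 \<in> E2" "inv c' \<otimes> \<nu> = \<nu>2 \<otimes> e2"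
      using E2(2)[OF imageI[OF c(2)] \<nu>] by blast
    obtain \<nu>1 e1 where 1: "\<nu>1 \<in> \<Lambda>" "e1 \<in> E1" "c \<otimes> (\<mu> \<otimes> \<nu>2) = \<nu>1 \<otimes> e1"
      using E1(2)[OF c(1) mult_subgroup[OF \<mu>(1) 2(1)]] by blast
    note mem = g cc subgroup_in[OF \<nu>] subgroup_in[OF \<mu>(1)] subgroup_in[OF 2(1)] subgroup_in[OF 1(1)]
      compact_in[OF E1(1) 1(2)] compact_in[OF E2(1) 2(2)]
    have "g' \<otimes> \<nu> = g' \<otimes> c' \<otimes> (inv c' \<otimes> \<nu>)"
      using mem by (simp add: m_assoc) (simp flip: m_assoc)
    also have "\<dots> = g \<otimes> c \<otimes> \<mu> \<otimes> (\<nu>2 \<otimes> e2)"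
      unfolding \<mu>(2) 2(3) ..
    also have "\<dots> = g \<otimes> (c \<otimes> (\<mu> \<otimes> \<nu>2)) \<otimes> e2"
      using mem by (simp add: m_assoc)
    also have "\<dots> = g \<otimes> (\<nu>1 \<otimes> (e1 \<otimes> e2))"
      unfolding 1(3) using mem by (simp add: m_assoc)
    finally show "\<exists>\<nu>'\<in>\<Lambda>. \<exists>x\<in>(E1 <#> E2) \<union> {\<one>}. g' \<otimes> \<nu> = g \<otimes> (\<nu>' \<otimes> x)"
      using 1(1,2) 2(2) set_mult_iff[of "e1 \<otimes> e2" E1 E2] by blast
  qed simp
qed

lemma near_mono: "near g C s \<Longrightarrow> C \<subseteq> D \<Longrightarrow> near g D s"
  unfolding near_def by (meson image_mono subset_trans)

lemma near_transition:
  assumes E: "compactin T E" and B: "compactin T B"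
    and trans: "\<And>\<nu>. \<nu> \<in> \<Lambda> \<Longrightarrow> \<exists>\<nu>'\<in>\<Lambda>. \<exists>x\<in>E. g' \<otimes> \<nu> = g \<otimes> (\<nu>' \<otimes> x)"
    and g: "g \<in> carrier G" "g' \<in> carrier G" and near: "near g' B s"
  shows "near g (E <#> B) s"
proof -
  obtain \<nu> where \<nu>: "\<nu> \<in> \<Lambda>" "s \<subseteq> (\<lambda>c. g' \<otimes> (\<nu> \<otimes> c)) ` B"
    using near by (auto simp: near_def)
  obtain \<nu>' x where x: "\<nu>' \<in> \<Lambda>" "x \<in> E" "g' \<otimes> \<nu> = g \<otimes> (\<nu>' \<otimes> x)"
    using trans[OF \<nu>(1)] by blast
  have "y \<in> (\<lambda>c. g \<otimes> (\<nu>' \<otimes> c)) ` (E <#> B)" if y: "y \<in> s" for y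
  proof -
    obtain b where b: "b \<in> B" "y = g' \<otimes> (\<nu> \<otimes> b)"
      using \<nu>(2) y by blast
    note mem = g subgroup_in[OF \<nu>(1)] subgroup_in[OF x(1)] compact_in[OF E x(2)] compact_in[OF B b(1)]
    have "y = g' \<otimes> \<nu> \<otimes> b"
      using b(2) mem by (simp add: m_assoc)
    also have "\<dots> = g \<otimes> (\<nu>' \<otimes> (x \<otimes> b))"
      unfolding x(3) using mem by (simp add: m_assoc)
    finally show ?thesis
      using x(2) b(1) set_mult_iff[of "x \<otimes> b" E B] by blast
  qed
  then show ?thesis
    unfolding near_def using x(1) by blast
qed

text \<open>The vertex sets of \<open>\<Lambda> \<cdot> E C\<close>, for \<open>C\<close> a subset of the whole group.\<close>

abbreviation local :: "'a set \<Rightarrow> 'a set \<Rightarrow> bool" where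
  "local C \<equiv> in_translate (\<otimes>) \<Lambda> C"

lemma near_one: "s \<subseteq> (\<lambda>c. g \<otimes> c) ` C \<Longrightarrow> C \<subseteq> carrier G \<Longrightarrow> near g C s"
  unfolding near_def using one_subgroup by (intro bexI[of _ \<one>]) (auto simp: subset_iff image_iff)

end

section \<open>Filling spheres near a coset and lifting over cells\<close>

locale type_C_subgroup = commuting_subgroup +
  fixes n :: nat
  assumes type_C: "type_C n (G\<lparr>carrier := \<Lambda>\<rparr>) (subtopology T \<Lambda>)"
begin

lemma sphere_null_subgroup:
  assumes k: "k < n" and D: "compactin T D" "D \<subseteq> \<Lambda>"
  obtains D' where "compactin T D'" "D \<subseteq> D'" "sphere_null k (model (local D)) (model (local D'))"
proof -
  have top: "topspace (subtopology T \<Lambda>) = \<Lambda>"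
    using subgroup.subset[OF subgroup] by (auto simp: topspace_eq)
  have "essentially_connected (int n - 1) (simplicial_E (topspace (subtopology T \<Lambda>)))
      (compacts (subtopology T \<Lambda>)) (translates_E (\<otimes>) \<Lambda>)"
    using type_C unfolding type_C_def by simp
  moreover have "essentially_connected (int n - 1) (simplicial_E (topspace (subtopology T \<Lambda>)))
      (compacts (subtopology T \<Lambda>)) (translates_E (\<otimes>) \<Lambda>) \<longleftrightarrow>
    (\<forall>k<n. \<forall>C. compactin (subtopology T \<Lambda>) C \<longrightarrow> (\<exists>C'. compactin (subtopology T \<Lambda>) C' \<and> C \<subseteq> C' \<and>
       sphere_null k (model (local C)) (model (local C'))))"
    by (rule essentially_connected_iff[where e = \<one>]) (use one_subgroup subgroup_in top in auto)
  ultimately obtain D' where "compactin (subtopology T \<Lambda>) D'" "D \<subseteq> D'"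
    "sphere_null k (model (local D)) (model (local D'))"
    using k D unfolding compactin_subtopology by meson
  then show ?thesis
    using that[of D'] by (simp add: compactin_subtopology)
qed

text \<open>
  A vertex \<open>\<nu>c\<close> of \<open>\<Lambda> \<cdot> E C\<close> is contiguous to \<open>\<nu>\<close>; this pushes spheres into \<open>E \<Lambda>\<close>.
\<close>

lemma sphere_null_local:
  assumes k: "k < n" and C: "compactin T C"
  obtains C' where "compactin T C'" "C \<subseteq> C'" "sphere_null k (model (local C)) (model (local C'))"
proof -
  \<comment> \<open>If \<nu>c = \<rho>c' with \<nu>, \<rho> in \<Lambda>, then \<rho> = \<nu>(c inv
    c'); \<open>D\<close> collects these quotients. It is a closed part of a compact set, since
    \<Lambda> is closed.\<close>
  define D where "D = \<Lambda> \<inter> (C <#> (\<lambda>x. inv x) ` C)"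
  have "compactin T D"
    unfolding D_def using closed_Int_compactin[OF closed compact_set_mult[OF C compact_inv[OF C]]] .
  moreover have "D \<subseteq> \<Lambda>"
    by (simp add: D_def)
  ultimately obtain D' where D': "compactin T D'" "D \<subseteq> D'" "sphere_null k (model (local D)) (model (local D'))"
    using sphere_null_subgroup[OF k] by blast
  define C' where "C' = C \<union> D \<union> D'"
  note her = hereditary_in_translate[of "(\<otimes>)" \<Lambda>]
  \<comment> \<open>The choice depends on the vertex alone and not on the simplex around it, so
    \<open>r\<close> induces a map of points.\<close>
  define r where "r \<gamma> = (SOME \<nu>. \<nu> \<in> \<Lambda> \<and> (\<exists>c\<in>C. \<gamma> = \<nu> \<otimes> c))" for \<gamma>
  have r: "r ` s \<subseteq> (\<otimes>) \<nu> ` D" if \<nu>: "\<nu> \<in> \<Lambda>" and s: "s \<subseteq> (\<otimes>) \<nu> ` C" for s \<nu>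
  proof
    fix \<rho> assume "\<rho> \<in> r ` s"
    then obtain \<gamma> where \<gamma>: "\<gamma> \<in> s" "\<rho> = r \<gamma>"
      by blast
    then obtain c where c: "c \<in> C" "\<gamma> = \<nu> \<otimes> c"
      using s by blast
    then have "\<rho> \<in> \<Lambda> \<and> (\<exists>c\<in>C. \<gamma> = \<rho> \<otimes> c)"
      unfolding \<gamma>(2) r_def using \<nu> by (intro someI[of "\<lambda>\<nu>. \<nu> \<in> \<Lambda> \<and> (\<exists>c\<in>C. \<gamma> = \<nu> \<otimes> c)"]) blast
    then obtain c' where c': "\<rho> \<in> \<Lambda>" "c' \<in> C" "\<nu> \<otimes> c = \<rho> \<otimes> c'"
      using c(2) by auto
    note mem = subgroup_in[OF \<nu>] subgroup_in[OF c'(1)] compact_in[OF C c(1)] compact_in[OF C c'(2)]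
    have "\<rho> = \<rho> \<otimes> c' \<otimes> inv c'"
      using mem by (simp add: m_assoc)
    also have "\<dots> = \<nu> \<otimes> (c \<otimes> inv c')"
      unfolding c'(3)[symmetric] using mem by (simp add: m_assoc)
    finally have \<rho>: "\<rho> = \<nu> \<otimes> (c \<otimes> inv c')" .
    then have "c \<otimes> inv c' = inv \<nu> \<otimes> \<rho>"
      using mem by (simp flip: m_assoc)
    then have "c \<otimes> inv c' \<in> \<Lambda>"
      using mult_subgroup[OF inv_subgroup[OF \<nu>] c'(1)] by simp
    then have "c \<otimes> inv c' \<in> D"
      unfolding D_def using c(1) c'(2) set_mult_iff[of "c \<otimes> inv c'" C "(\<lambda>x. inv x) ` C"] by blast
    then show "\<rho> \<in> (\<otimes>) \<nu> ` D"
      using \<rho> by blast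
  qed
  have "sphere_null k (model (local C)) (model (local C'))"
    unfolding sphere_null_def
  proof (intro allI impI)
    fix f assume "continuous_map (nsphere k) (model (local C)) f"
    then have f: "continuous_map (nsphere k) points f" "\<And>z. z \<in> topspace (nsphere k) \<Longrightarrow> local C (supp (f z))"
      by (auto simp: continuous_map_into_model[OF her])
    have fp: "f z \<in> topspace points" if "z \<in> topspace (nsphere k)" for z
      using f(1) that by (force simp: continuous_map_def)
    have "local C' (id ` s \<union> r ` s)" if s: "local C s" for s
    proof -
      obtain \<nu> where "\<nu> \<in> \<Lambda>" "s \<subseteq> (\<otimes>) \<nu> ` C"
        using s by (auto simp: in_translate_def)
      moreover then have "id ` s \<union> r ` s \<subseteq> (\<otimes>) \<nu> ` C'"
        using r[of \<nu> s] unfolding C'_def image_Un by auto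
      ultimately show ?thesis
        unfolding in_translate_def by blast
    qed
    then have "homotopic_with (\<lambda>_. True) (nsphere k) (model (local C')) (vertex_map id \<circ> f) (vertex_map r \<circ> f)"
      using f(2) by (intro homotopic_contiguous f(1) her) blast
    then have h1: "homotopic_with (\<lambda>_. True) (nsphere k) (model (local C')) f (vertex_map r \<circ> f)"
      by (rule homotopic_with_eq) (auto simp: fp vertex_map_ident)
    have "local D (supp (vertex_map r (f z)))" if z: "z \<in> topspace (nsphere k)" for z
    proof -
      obtain \<nu> where "\<nu> \<in> \<Lambda>" "supp (f z) \<subseteq> (\<otimes>) \<nu> ` C"
        using f(2)[OF z] by (auto simp: in_translate_def)
      then show ?thesis
        unfolding supp_vertex_map[OF fp[OF z]] in_translate_def using r by blast
    qed
    then have "continuous_map (nsphere k) (model (local D)) (vertex_map r \<circ> f)"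
      using continuous_map_compose[OF f(1) continuous_map_vertex_map]
      by (simp add: continuous_map_into_model[OF her])
    then obtain c where c: "homotopic_with (\<lambda>_. True) (nsphere k) (model (local D')) (vertex_map r \<circ> f) (\<lambda>_. c)"
      using D'(3) unfolding sphere_null_def by blast
    have "local C' s" if "local D' s" for s
      using in_translate_mono[OF that] by (auto simp: C'_def)
    from homotopic_model_mono[OF her her this c]
    have "homotopic_with (\<lambda>_. True) (nsphere k) (model (local C')) (vertex_map r \<circ> f) (\<lambda>_. c)" .
    with h1 show "\<exists>c. homotopic_with (\<lambda>_. True) (nsphere k) (model (local C')) f (\<lambda>_. c)"
      using homotopic_with_trans by blast
  qed
  moreover have "compactin T C'"
    unfolding C'_def by (intro compactin_Un C \<open>compactin T D\<close> D'(1))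
  ultimately show ?thesis
    using that[of C'] by (auto simp: C'_def)
qed

text \<open>One step per dimension: on the boundary of a cell of dimension i + 1, passing to the
  centre of the cell costs the factor \<open>E\<close>, and filling the i-sphere leads from
  \<open>E <#> D i\<close> to \<open>D (Suc i)\<close>. From degree n on only the growth is
  kept.\<close>

lemma growing_compacts:
  assumes E: "compactin T E" and B: "compactin T B"
  obtains D :: "nat \<Rightarrow> 'a set" where "D 0 = B" "\<And>i. compactin T (D i)" "\<And>i. E <#> D i \<subseteq> D (Suc i)"
    "\<And>i. i < n \<Longrightarrow> sphere_null i (model (local (E <#> D i))) (model (local (D (Suc i))))"
proof -
  have "\<exists>D. \<forall>i. (compactin T (D i) \<and> (i = 0 \<longrightarrow> D i = B)) \<and>
      (E <#> D i \<subseteq> D (Suc i) \<and> (i < n \<longrightarrow> sphere_null i (model (local (E <#> D i))) (model (local (D (Suc i))))))"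
  proof (rule dependent_nat_choice)
    show "\<exists>x. compactin T x \<and> (0 = 0 \<longrightarrow> x = B)"
      using B by blast
    fix x and i :: nat assume "compactin T x \<and> (i = 0 \<longrightarrow> x = B)"
    then have x: "compactin T (E <#> x)"
      using compact_set_mult[OF E] by blast
    show "\<exists>y. (compactin T y \<and> (Suc i = 0 \<longrightarrow> y = B)) \<and>
        (E <#> x \<subseteq> y \<and> (i < n \<longrightarrow> sphere_null i (model (local (E <#> x))) (model (local y))))"
    proof (cases "i < n")
      case True
      then show ?thesis
        using sphere_null_local[OF True x] by blast
    next
      case False
      then show ?thesis
        using x by blast
    qed
  qed
  then show ?thesis
    using that by blast
qed

lemma vertex_map_translate_back:
  assumes l: "l \<in> topspace points" and g: "g \<in> carrier G" and s: "supp l \<subseteq> carrier G"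
  shows "vertex_map ((\<otimes>) g) (vertex_map ((\<otimes>) (inv g)) l) = l"
  unfolding vertex_map_vertex_map[OF l]
proof (rule vertex_map_ident[OF l])
  fix v assume "v \<in> supp l"
  then have "v \<in> carrier G"
    using s by blast
  then show "((\<otimes>) g \<circ> (\<otimes>) (inv g)) v = v"
    using g by (simp flip: m_assoc)
qed

lemma near_carrier:
  assumes "near g C s" "compactin T C" "g \<in> carrier G"
  shows "s \<subseteq> carrier G"
  using assms subgroup_in compact_in[OF assms(2)] by (fastforce simp: near_def)

lemma near_translate:
  assumes "near g C s" "compactin T C" "g \<in> carrier G"
  shows "local C ((\<otimes>) (inv g) ` s)"
proof -
  obtain \<nu> where \<nu>: "\<nu> \<in> \<Lambda>" "s \<subseteq> (\<lambda>c. g \<otimes> (\<nu> \<otimes> c)) ` C"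
    using assms(1) by (auto simp: near_def)
  have "inv g \<otimes> (g \<otimes> (\<nu> \<otimes> c)) = \<nu> \<otimes> c" if "c \<in> C" for c
    using assms(3) subgroup_in[OF \<nu>(1)] compact_in[OF assms(2) that] by (simp flip: m_assoc)
  then have "(\<otimes>) (inv g) ` s \<subseteq> (\<otimes>) \<nu> ` C"
    using \<nu>(2) by (force simp: subset_iff image_iff)
  then show ?thesis
    unfolding in_translate_def using \<nu>(1) by blast
qed

lemma local_translate: "local C s \<Longrightarrow> near g C ((\<otimes>) g ` s)"
  unfolding in_translate_def near_def by blast

text \<open>
  A map of a complex of cells of dimension at most \<open>n\<close> is lifted skeleton by skeleton. Over a cell
  of dimension \<open>i\<close> the lift stays in a translate of \<open>\<Lambda> \<cdot> E (D i)\<close>, where the compact sets \<open>D i\<close> grow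
  with the dimension only.
\<close>

lemma lifting:
  assumes C: "compactin T C"
  obtains D where "compactin T D"
    "\<And>d N S S0 \<gamma> f. \<lbrakk>0 < N; cellular d N S; cellular d N S0; S0 \<subseteq> S;
       \<And>Q. Q \<in> cells d N \<Longrightarrow> Q \<subseteq> S \<Longrightarrow> cell_dim Q \<le> n;
       \<And>x. x \<in> S \<Longrightarrow> \<gamma> x \<in> carrier G;
       \<And>Q x y. Q \<in> cells d N \<Longrightarrow> Q \<subseteq> S \<Longrightarrow> x \<in> Q \<Longrightarrow> y \<in> Q \<Longrightarrow> meets C (\<gamma> x) (\<gamma> y);
       continuous_map (top_of_set S0) points f;
       \<And>x. x \<in> S0 \<Longrightarrow> supp (f x) \<subseteq> (\<otimes>) (\<gamma> x) ` C\<rbrakk>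
     \<Longrightarrow> \<exists>F. continuous_map (top_of_set S) points F \<and> (\<forall>x\<in>S0. F x = f x) \<and> (\<forall>x\<in>S. near (\<gamma> x) D (supp (F x)))"
proof -
  have "\<exists>E. compactin T E \<and> \<one> \<in> E \<and> (\<forall>g g' \<nu>. g \<in> carrier G \<longrightarrow> g' \<in> carrier G \<longrightarrow> meets C g g' \<longrightarrow> \<nu> \<in> \<Lambda> \<longrightarrow>
       (\<exists>\<nu>'\<in>\<Lambda>. \<exists>x\<in>E. g' \<otimes> \<nu> = g \<otimes> (\<nu>' \<otimes> x)))"
    by (rule transition[OF C]) blast
  then obtain E where E: "compactin T E" "\<one> \<in> E"
    "\<And>g g' \<nu>. g \<in> carrier G \<Longrightarrow> g' \<in> carrier G \<Longrightarrow> meets C g g' \<Longrightarrow> \<nu> \<in> \<Lambda> \<Longrightarrow>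
       \<exists>\<nu>'\<in>\<Lambda>. \<exists>x\<in>E. g' \<otimes> \<nu> = g \<otimes> (\<nu>' \<otimes> x)"
    by auto
  \<comment> \<open>Two starting conditions: the prescribed map on \<open>S0\<close>, seen from the
    centre of a cell, uses \<open>E <#> C\<close>, and over a 0-cell the centre itself serves as the
    value, which needs the unit.\<close>
  have B: "compactin T ((E <#> C) \<union> {\<one>})"
    by (intro compactin_Un compact_set_mult E(1) C compact_one)
  have "\<exists>D. D 0 = (E <#> C) \<union> {\<one>} \<and> (\<forall>i. compactin T (D i)) \<and> (\<forall>i. E <#> D i \<subseteq> D (Suc i)) \<and>
      (\<forall>i<n. sphere_null i (model (local (E <#> D i))) (model (local (D (Suc i)))))"
    by (rule growing_compacts[OF E(1) B]) blast
  then obtain D where D: "D 0 = (E <#> C) \<union> {\<one>}" "\<And>i. compactin T (D i)" "\<And>i. E <#> D i \<subseteq> D (Suc i)"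
    "\<And>i. i < n \<Longrightarrow> sphere_null i (model (local (E <#> D i))) (model (local (D (Suc i))))"
    by auto
  have subE: "X \<subseteq> E <#> X" if "compactin T X" for X
  proof
    fix x assume "x \<in> X"
    moreover then have "x = \<one> \<otimes> x"
      using compact_in[OF that] by simp
    ultimately show "x \<in> E <#> X"
      using E(2) set_mult_iff[of x E X] by blast
  qed
  have Dstep: "D i \<le> D (Suc i)" for i
    using subE[OF D(2)[of i]] D(3)[of i] by (rule order_trans)
  have Dmono: "D i \<subseteq> D j" if "i \<le> j" for i j
    using lift_Suc_mono_le[of D i j] Dstep that by blast
  show ?thesis
  \<comment> \<open>The last factor \<open>E\<close> passes from the centre of the cell back to
    \<gamma> x at the point itself.\<close>
  proof (rule that[OF compact_set_mult[OF E(1) D(2)[of n]]])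
    fix d N S S0 \<gamma> and f :: "(nat \<Rightarrow> real) \<Rightarrow> ('a \<times> real) list"
    assume N: "0 < N" and S: "cellular d N S" and S0: "cellular d N S0" "S0 \<subseteq> S"
      and dim: "\<And>Q. Q \<in> cells d N \<Longrightarrow> Q \<subseteq> S \<Longrightarrow> cell_dim Q \<le> n"
      and \<gamma>: "\<And>x. x \<in> S \<Longrightarrow> \<gamma> x \<in> carrier G"
      and meet: "\<And>Q x y. Q \<in> cells d N \<Longrightarrow> Q \<subseteq> S \<Longrightarrow> x \<in> Q \<Longrightarrow> y \<in> Q \<Longrightarrow> meets C (\<gamma> x) (\<gamma> y)"
      and f: "continuous_map (top_of_set S0) points f" "\<And>x. x \<in> S0 \<Longrightarrow> supp (f x) \<subseteq> (\<otimes>) (\<gamma> x) ` C"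
    have tr: "near (\<gamma> x) (E <#> X) s"
      if "Q \<in> cells d N" "Q \<subseteq> S" "x \<in> Q" "y \<in> Q" "compactin T X" "near (\<gamma> y) X s" for Q x y X s
    proof -
      note xy = \<gamma>[OF subsetD[OF that(2) that(3)]] \<gamma>[OF subsetD[OF that(2) that(4)]]
      have m: "meets C (\<gamma> x) (\<gamma> y)"
        using that(1-4) by (rule meet)
      show ?thesis
        by (rule near_transition[where g' = "\<gamma> y" and B = X])
          (fact E(1) that(5,6) xy | rule E(3)[OF xy m], assumption)+
    qed
    \<comment> \<open>A representative point for each cell; \<gamma> (t Q) is the centre of
      \<open>Q\<close>. The carrier \<open>A Q\<close> is measured from this centre and depends
      otherwise only on the dimension of \<open>Q\<close>.\<close>
    define t where "t Q = (SOME x. x \<in> Q)" for Q :: "(nat \<Rightarrow> real) set"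
    have t: "t Q \<in> Q" if Q: "Q \<in> cells d N" for Q
    proof -
      have "\<exists>x. x \<in> Q"
        using cells_nonempty[OF N Q] by auto
      then show ?thesis
        unfolding t_def by (rule someI_ex)
    qed
    define A where "A Q = {l \<in> topspace points. near (\<gamma> (t Q)) (D (cell_dim Q)) (supp l)}" for Q
    have fA: "f ` Q \<subseteq> A Q" if Q: "Q \<in> cells d N" "Q \<subseteq> S0" for Q
    proof
      fix l assume "l \<in> f ` Q"
      then obtain x where x: "x \<in> Q" "l = f x"
        by blast
      have QS: "Q \<subseteq> S"
        using Q(2) S0(2) by blast
      have xS0: "x \<in> S0"
        using x(1) Q(2) by blast
      have "C \<subseteq> carrier G"
        using compact_in[OF C] by blast
      then have "near (\<gamma> x) C (supp l)"
        using f(2)[OF xS0] unfolding x(2) by (rule near_one[rotated])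
      then have "near (\<gamma> (t Q)) (E <#> C) (supp l)"
        by (rule tr[OF Q(1) QS t[OF Q(1)] x(1) C])
      moreover have "E <#> C \<subseteq> D (cell_dim Q)"
        using Dmono[OF le0, of "cell_dim Q"] unfolding D(1) by blast
      ultimately have "near (\<gamma> (t Q)) (D (cell_dim Q)) (supp l)"
        by (rule near_mono)
      moreover have "l \<in> topspace points"
        using continuous_map_image_subset_topspace[OF f(1)] xS0 x(2) by auto
      ultimately show "l \<in> A Q"
        by (simp add: A_def)
    qed
    have ext: "\<exists>h'. continuous_map (top_of_set Q) points h' \<and>
        (\<forall>x\<in>\<Union>{R \<in> cells d N. R \<subset> Q}. h' x = h x) \<and> h' ` Q \<subseteq> A Q"
      if Q: "Q \<in> cells d N" "Q \<subseteq> S"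
        and h: "continuous_map (top_of_set (\<Union>{R \<in> cells d N. R \<subset> Q})) points h"
          "\<And>R. R \<in> cells d N \<Longrightarrow> R \<subset> Q \<Longrightarrow> h ` R \<subseteq> A R" for Q h
    proof -
      define g where "g = \<gamma> (t Q)"
      have g: "g \<in> carrier G"
        unfolding g_def using \<gamma> t[OF Q(1)] Q(2) by blast
      show ?thesis
      proof (cases "cell_dim Q")
        case 0
        then have "\<not> R \<subset> Q" if "R \<in> cells d N" for R
          using cell_dim_less[OF N that Q(1)] by auto
        then have none: "{R \<in> cells d N. R \<subset> Q} = {}"
          by blast
        have "g = g \<otimes> (\<one> \<otimes> \<one>)" "\<one> \<in> D 0"
          using g by (simp_all add: D(1))
        then have "{g} \<subseteq> (\<lambda>c. g \<otimes> (\<one> \<otimes> c)) ` D 0"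
          by blast
        then have "near g (D 0) {g}"
          unfolding near_def using one_subgroup by blast
        then have "vertex_point g \<in> A Q"
          using vertex_point_in_points[of g] by (simp add: A_def 0 g_def)
        then show ?thesis
          unfolding none using vertex_point_in_points[of g] by (intro exI[of _ "\<lambda>_. vertex_point g"]) auto
      next
        case (Suc i)
        obtain a b where ab: "Q = box_set (grid_point d N a) (grid_point d N b)" "grid_corners d N a b"
          using Q(1) by (auto simp: cells_def)
        let ?bd = "\<Union>{R \<in> cells d N. R \<subset> Q}"
        note bd = union_proper_faces[OF N ab(2,1)]
        have i: "i < n"
          using dim[OF Q] Suc by simp
        have EDi: "compactin T (E <#> D i)"
          by (intro compact_set_mult E(1) D(2))
        have hp: "h y \<in> topspace points" if "y \<in> ?bd" for y
          using subsetD[OF continuous_map_image_subset_topspace[OF h(1)], of "h y"] imageI[OF that, of h] by simp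
        have hnear: "near g (E <#> D i) (supp (h y))" if "y \<in> ?bd" for y
        proof -
          obtain R where R: "R \<in> cells d N" "R \<subset> Q" "y \<in> R"
            using \<open>y \<in> ?bd\<close> by blast
          have "h y \<in> A R"
            using h(2)[OF R(1,2)] R(3) by blast
          then have "near (\<gamma> (t R)) (D (cell_dim R)) (supp (h y))"
            by (simp add: A_def)
          moreover have "cell_dim R \<le> i"
            using cell_dim_less[OF N R(1) Q(1) R(2)] Suc by simp
          ultimately have near: "near (\<gamma> (t R)) (D i) (supp (h y))"
            using near_mono[OF _ Dmono[of "cell_dim R" i]] by blast
          have tR: "t R \<in> Q"
            using t[OF R(1)] R(2) by blast
          show ?thesis
            unfolding g_def by (rule tr[OF Q t[OF Q(1)] tR D(2) near])
        qed
        note her = hereditary_in_translate[of "(\<otimes>)" \<Lambda>]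
        \<comment> \<open>Translating by the inverse of the centre moves the boundary sphere into
          \<Lambda> \<cdot> E (E D_i), where type C_n fills it; the filling is translated
          back.\<close>
        define h1 where "h1 = vertex_map ((\<otimes>) (inv g)) \<circ> h"
        have "continuous_map (top_of_set ?bd) points h1"
          unfolding h1_def using h(1) continuous_map_vertex_map by (rule continuous_map_compose)
        moreover have "local (E <#> D i) (supp (h1 y))" if "y \<in> ?bd" for y
          unfolding h1_def o_apply supp_vertex_map[OF hp[OF that]]
          using hnear[OF that] EDi g by (rule near_translate)
        ultimately have h1: "continuous_map (top_of_set (box_boundary (grid_point d N a) (grid_point d N b)))
            (model (local (E <#> D i))) h1"
          unfolding bd continuous_map_into_model[OF her] by simp
        have card: "card {i. grid_point d N a i < grid_point d N b i} = Suc i"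
          using Suc unfolding cell_dim_def ab(1) varying_coordinates[OF N ab(2)] .
        have fin: "finite {i. grid_point d N a i < grid_point d N b i}"
          by (rule card_ge_0_finite) (simp add: card)
        show ?thesis
        proof (rule extend_over_box[OF grid_corners_le[OF N ab(2)] fin card D(4)[OF i] h1], fold ab(1))
          fix F assume F: "continuous_map (top_of_set Q) (model (local (D (Suc i)))) F"
            "\<And>x. x \<in> box_boundary (grid_point d N a) (grid_point d N b) \<Longrightarrow> F x = h1 x"
          then have F1: "continuous_map (top_of_set Q) points F" "\<And>x. x \<in> Q \<Longrightarrow> local (D (Suc i)) (supp (F x))"
            by (auto simp: continuous_map_into_model[OF her])
          have Fp: "F x \<in> topspace points" if "x \<in> Q" for x
            using subsetD[OF continuous_map_image_subset_topspace[OF F1(1)], of "F x"] that by simp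
          let ?h' = "vertex_map ((\<otimes>) g) \<circ> F"
          have "continuous_map (top_of_set Q) points ?h'"
            using F1(1) continuous_map_vertex_map by (rule continuous_map_compose)
          moreover have "?h' x = h x" if x: "x \<in> ?bd" for x
          proof -
            have "F x = h1 x"
              using x unfolding bd by (rule F(2))
            then show ?thesis
              using vertex_map_translate_back[OF hp[OF x] g near_carrier[OF hnear[OF x] EDi g]]
              by (simp only: o_apply h1_def)
          qed
          moreover have "?h' x \<in> A Q" if x: "x \<in> Q" for x
          proof -
            have "near g (D (cell_dim Q)) (supp (?h' x))"
              unfolding o_apply supp_vertex_map[OF Fp[OF x]] Suc by (rule local_translate[OF F1(2)[OF x]])
            then show ?thesis
              using vertex_map_in_points[OF Fp[OF x]] by (simp add: A_def g_def)
          qed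
          ultimately show ?thesis
            by (intro exI[of _ ?h'] conjI ballI image_subsetI)
        qed
      qed
    qed
    have "\<exists>F. continuous_map (top_of_set S) points F \<and> (\<forall>x\<in>S0. F x = f x) \<and>
        (\<forall>Q\<in>cells d N. Q \<subseteq> S \<longrightarrow> F ` Q \<subseteq> A Q)"
      by (rule cell_extension[where g = f and A = A, OF N S S0 f(1) fA ext]) blast+
    then obtain F where F: "continuous_map (top_of_set S) points F" "\<forall>x\<in>S0. F x = f x"
      "\<And>Q. Q \<in> cells d N \<Longrightarrow> Q \<subseteq> S \<Longrightarrow> F ` Q \<subseteq> A Q"
      by auto
    have "near (\<gamma> x) (E <#> D n) (supp (F x))" if x: "x \<in> S" for x
    proof -
      obtain Q where Q: "Q \<in> cells d N" "x \<in> Q" "Q \<subseteq> S"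
        using S x by (auto simp: cellular_def)
      have "F x \<in> A Q"
        using F(3)[OF Q(1,3)] Q(2) by blast
      then have "near (\<gamma> (t Q)) (D (cell_dim Q)) (supp (F x))"
        by (simp add: A_def)
      then have "near (\<gamma> (t Q)) (D n) (supp (F x))"
        by (rule near_mono) (rule Dmono[OF dim[OF Q(1,3)]])
      then show ?thesis
        by (rule tr[OF Q(1,3,2) t[OF Q(1)] D(2)])
    qed
    then show "\<exists>F. continuous_map (top_of_set S) points F \<and> (\<forall>x\<in>S0. F x = f x) \<and>
        (\<forall>x\<in>S. near (\<gamma> x) (E <#> D n) (supp (F x)))"
      using F(1,2) by blast
  qed
qed

end

section \<open>The character and the comparison of the two filtrations\<close>

locale character_setting = type_C_subgroup +
  fixes chi :: "'a \<Rightarrow> real"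
  assumes character: "character G T chi"
    and vanishes: "\<And>x. x \<in> \<Lambda> \<Longrightarrow> chi x = 0"
begin

abbreviation S :: "'a set" where
  "S \<equiv> nonneg_part G chi"

abbreviation upstairs :: "'a set \<Rightarrow> 'a set \<Rightarrow> bool" where
  "upstairs C \<equiv> in_translate (\<otimes>) S C"

abbreviation downstairs :: "'a set set \<Rightarrow> 'a set set \<Rightarrow> bool" where
  "downstairs F \<equiv> in_translate (l_coset G) S F"

lemma S_in: "g \<in> S \<Longrightarrow> g \<in> carrier G"
  by (simp add: nonneg_part_def)

text \<open>Here the vanishing of the character on \<Lambda> enters: a lift near g lies in
  translates by g\<nu>, and these elements stay in \<Gamma>_\<chi>.\<close>

lemma S_mult: "g \<in> S \<Longrightarrow> \<nu> \<in> \<Lambda> \<Longrightarrow> g \<otimes> \<nu> \<in> S"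
  using character vanishes[of \<nu>] subgroup_in[of \<nu>] by (simp add: nonneg_part_def character_def)

lemma one_S: "\<one> \<in> S"
  using character_one[OF is_group character] by (simp add: nonneg_part_def)

lemma upstairs_iff:
  "essentially_connected (int m - 1) (simplicial_E (topspace T)) (compacts T) (translates_E (\<otimes>) S) \<longleftrightarrow>
    (\<forall>k<m. \<forall>C. compactin T C \<longrightarrow> (\<exists>C'. compactin T C' \<and> C \<subseteq> C' \<and>
       sphere_null k (model (upstairs C)) (model (upstairs C'))))"
  by (rule essentially_connected_iff[where e = \<one>]) (use one_S in \<open>auto simp: topspace_eq\<close>)

lemma Sigma_iff:
  "chi \<in> Sigma_top m G T \<longleftrightarrow>
    (\<forall>k<m. \<forall>C. compactin T C \<longrightarrow> (\<exists>C'. compactin T C' \<and> C \<subseteq> C' \<and>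
       sphere_null k (model (upstairs C)) (model (upstairs C'))))"
  using upstairs_iff[of m] character by (simp add: Sigma_top_def)

lemma downstairs_iff:
  "essentially_connected (int m - 1) (simplicial_E (topspace cosets)) (compacts cosets) (translates_E (l_coset G) S) \<longleftrightarrow>
    (\<forall>k<m. \<forall>C. compactin cosets C \<longrightarrow> (\<exists>C'. compactin cosets C' \<and> C \<subseteq> C' \<and>
       sphere_null k (model (downstairs C)) (model (downstairs C'))))"
  by (rule essentially_connected_iff[where e = \<one>])
    (use one_S in \<open>auto simp: topspace_cosets proj_mult\<close>)

lemma near_upstairs:
  assumes "near g C s" "g \<in> S" "compactin T C"
  shows "upstairs C s"
proof -
  obtain \<nu> where \<nu>: "\<nu> \<in> \<Lambda>" "s \<subseteq> (\<lambda>c. g \<otimes> (\<nu> \<otimes> c)) ` C"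
    using assms(1) by (auto simp: near_def)
  have "(\<lambda>c. g \<otimes> (\<nu> \<otimes> c)) ` C = (\<otimes>) (g \<otimes> \<nu>) ` C"
    using S_in[OF assms(2)] subgroup_in[OF \<nu>(1)] compact_in[OF assms(3)] by (intro image_cong) (auto simp: m_assoc)
  then show ?thesis
    unfolding in_translate_def using \<nu> S_mult[OF assms(2) \<nu>(1)] by blast
qed

lemma translate_proj:
  assumes "compactin T C" "g \<in> carrier G"
  shows "proj ` (\<otimes>) g ` C = l_coset G g ` proj ` C"
  unfolding image_image using compact_in[OF assms(1)] assms(2) by (intro image_cong) (simp_all add: proj_mult)

lemma upstairs_proj:
  assumes "upstairs C s" "compactin T C"
  shows "downstairs (proj ` C) (proj ` s)"
proof -
  obtain g where "g \<in> S" "s \<subseteq> (\<otimes>) g ` C"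
    using assms(1) by (auto simp: in_translate_def)
  then show ?thesis
    unfolding in_translate_def using translate_proj[OF assms(2) S_in] by (metis image_mono)
qed

text \<open>Writing \<nu>b = b'\<nu>' moves the element of \<Lambda> to the right, where the
  projection absorbs it. So the image lies in the translate by g itself, although \<nu> is
  arbitrary.\<close>

lemma compact_near_proj:
  assumes "compactin T B"
  obtains B' where "compactin T B'"
    "\<And>g s. g \<in> carrier G \<Longrightarrow> near g B s \<Longrightarrow> proj ` s \<subseteq> l_coset G g ` proj ` B'"
proof -
  have "\<exists>B'. compactin T B' \<and> (\<forall>b\<in>B. \<forall>\<nu>\<in>\<Lambda>. \<exists>\<nu>'\<in>\<Lambda>. \<exists>b'\<in>B'. \<nu> \<otimes> b = b' \<otimes> \<nu>')"
    by (rule commute_left[OF assms]) blast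
  then obtain B' where B': "compactin T B'" "\<And>b \<nu>. b \<in> B \<Longrightarrow> \<nu> \<in> \<Lambda> \<Longrightarrow> \<exists>\<nu>'\<in>\<Lambda>. \<exists>b'\<in>B'. \<nu> \<otimes> b = b' \<otimes> \<nu>'"
    by auto
  show ?thesis
  proof (rule that[OF B'(1)])
    fix g s assume g: "g \<in> carrier G" and s: "near g B s"
    obtain \<nu> where \<nu>: "\<nu> \<in> \<Lambda>" "s \<subseteq> (\<lambda>c. g \<otimes> (\<nu> \<otimes> c)) ` B"
      using s by (auto simp: near_def)
    show "proj ` s \<subseteq> l_coset G g ` proj ` B'"
    proof
      fix y assume "y \<in> proj ` s"
      then obtain b where b: "b \<in> B" "y = proj (g \<otimes> (\<nu> \<otimes> b))"
        using \<nu>(2) by blast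
      obtain \<nu>' b' where b': "\<nu>' \<in> \<Lambda>" "b' \<in> B'" "\<nu> \<otimes> b = b' \<otimes> \<nu>'"
        using B'(2)[OF b(1) \<nu>(1)] by blast
      note mem = g subgroup_in[OF b'(1)] compact_in[OF B'(1) b'(2)]
      have "g \<otimes> (b' \<otimes> \<nu>') = g \<otimes> b' \<otimes> \<nu>'"
        using mem by (simp add: m_assoc)
      then have "y = proj (g \<otimes> b')"
        unfolding b(2) b'(3) using proj_subgroup[OF _ b'(1), of "g \<otimes> b'"] mem by simp
      also have "\<dots> = g <# proj b'"
        using mem by (simp add: proj_mult)
      finally show "y \<in> l_coset G g ` proj ` B'"
        using b'(2) by blast
    qed
  qed
qed

lemma meetsI:
  assumes C: "compactin T C" and g: "g \<in> carrier G" "g' \<in> carrier G"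
    and v: "v \<in> l_coset G g ` proj ` C" "v \<in> l_coset G g' ` proj ` C"
  shows "meets C g g'"
proof -
  obtain c c' where c: "c \<in> C" "c' \<in> C" "v = g <# proj c" "v = g' <# proj c'"
    using v by blast
  then have "proj (g \<otimes> c) = proj (g' \<otimes> c')"
    using proj_mult[OF g(1) compact_in[OF C c(1)]] proj_mult[OF g(2) compact_in[OF C c(2)]] by simp
  then show ?thesis
    unfolding meets_def using c(1,2) by blast
qed

text \<open>The projected sphere is filled downstairs, and the filling is lifted with the sphere
  itself prescribed over the boundary. The cube has dimension k + 1, which must not exceed
  n.\<close>

lemma sphere_null_upstairs:
  assumes k: "k < n" and C: "compactin T C"
    and down: "\<And>F. compactin cosets F \<Longrightarrow> \<exists>F'. compactin cosets F' \<and> F \<subseteq> F' \<and>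
       sphere_null k (model (downstairs F)) (model (downstairs F'))"
  shows "\<exists>C'. compactin T C' \<and> C \<subseteq> C' \<and> sphere_null k (model (upstairs C)) (model (upstairs C'))"
proof -
  note herU = hereditary_in_translate[of "(\<otimes>)" S]
  note herD = hereditary_in_translate[of "l_coset G" S]
  obtain F' where F': "compactin cosets F'" "proj ` C \<subseteq> F'"
    "sphere_null k (model (downstairs (proj ` C))) (model (downstairs F'))"
    using down[OF compact_proj[OF C]] by blast
  obtain C0 where C0: "compactin T C0" "F' \<subseteq> proj ` C0"
    using compact_lift[OF F'(1)] by blast
  \<comment> \<open>\<open>C0\<close> covers the vertices of the filling, and \<open>C\<close> those
    of the given sphere, which is the prescribed part of the lift.\<close>
  define C1 where "C1 = C \<union> C0"
  have C1: "compactin T C1" "C \<subseteq> C1" "F' \<subseteq> proj ` C1"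
    unfolding C1_def using C0 by (auto intro: compactin_Un C)
  show ?thesis
  proof (rule lifting[OF C1(1)])
    fix D assume D: "compactin T D" and lift:
      "\<And>d N S S0 \<gamma> f. \<lbrakk>0 < N; cellular d N S; cellular d N S0; S0 \<subseteq> S;
       \<And>Q. Q \<in> cells d N \<Longrightarrow> Q \<subseteq> S \<Longrightarrow> cell_dim Q \<le> n;
       \<And>x. x \<in> S \<Longrightarrow> \<gamma> x \<in> carrier G;
       \<And>Q x y. Q \<in> cells d N \<Longrightarrow> Q \<subseteq> S \<Longrightarrow> x \<in> Q \<Longrightarrow> y \<in> Q \<Longrightarrow> meets C1 (\<gamma> x) (\<gamma> y);
       continuous_map (top_of_set S0) points f;
       \<And>x. x \<in> S0 \<Longrightarrow> supp (f x) \<subseteq> (\<otimes>) (\<gamma> x) ` C1\<rbrakk>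
     \<Longrightarrow> \<exists>F. continuous_map (top_of_set S) points F \<and> (\<forall>x\<in>S0. F x = f x) \<and> (\<forall>x\<in>S. near (\<gamma> x) D (supp (F x)))"
    have "sphere_null k (model (upstairs C)) (model (upstairs (C \<union> D)))"
      unfolding sphere_null_def
    proof (intro allI impI)
      fix f assume f: "continuous_map (nsphere k) (model (upstairs C)) f"
      let ?m = "Suc k"
      define f1 where "f1 = f \<circ> to_sphere k"
      have "continuous_map (top_of_set (cube_boundary ?m)) (model (upstairs C)) f1"
        unfolding f1_def using continuous_map_to_sphere f by (rule continuous_map_compose)
      then have f1: "continuous_map (top_of_set (cube_boundary ?m)) points f1"
        "\<And>x. x \<in> cube_boundary ?m \<Longrightarrow> upstairs C (supp (f1 x))"
        by (auto simp: continuous_map_into_model[OF herU])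
      have f1p: "f1 x \<in> topspace points" if "x \<in> cube_boundary ?m" for x
        using f1(1) that by (force simp: continuous_map_def)
      have f1c: "f1 (to_cube k x) = f x" if "x \<in> sphere_set k" for x
        using to_sphere_to_cube[OF that] by (simp add: f1_def)
      have pf1: "continuous_map (top_of_set (cube_boundary ?m)) (model (downstairs (proj ` C))) (vertex_map proj \<circ> f1)"
        unfolding continuous_map_into_model[OF herD]
        using continuous_map_compose[OF f1(1) continuous_map_vertex_map] f1p upstairs_proj[OF f1(2) C]
        by (simp add: supp_vertex_map)
      obtain c where null: "homotopic_with (\<lambda>_. True) (nsphere k) (model (downstairs F'))
          (vertex_map proj \<circ> f1 \<circ> to_cube k) (\<lambda>_. c)"
        using F'(3) continuous_map_compose[OF continuous_map_to_cube pf1] unfolding sphere_null_def by blast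
      have pf1': "continuous_map (top_of_set (cube_boundary ?m)) (model (downstairs F')) (vertex_map proj \<circ> f1)"
        by (rule continuous_map_model_mono[OF herD herD _ pf1]) (rule in_translate_mono[OF _ F'(2)])
      show "\<exists>c. homotopic_with (\<lambda>_. True) (nsphere k) (model (upstairs (C \<union> D))) f (\<lambda>_. c)"
      proof (rule extend_over_cube[OF pf1' null])
        fix h assume "continuous_map (top_of_set (cube ?m)) (model (downstairs F')) h"
          and hb: "\<And>x. x \<in> cube_boundary ?m \<Longrightarrow> h x = (vertex_map proj \<circ> f1) x"
        then have h: "continuous_map (top_of_set (cube ?m)) points h"
          "\<And>x. x \<in> cube ?m \<Longrightarrow> downstairs F' (supp (h x))"
          by (auto simp: continuous_map_into_model[OF herD])
        \<comment> \<open>On the boundary the element must be adapted to the sphere upstairs and not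
          only to its projection; the condition downstairs then follows by projecting.\<close>
        have "\<forall>x\<in>cube ?m. \<exists>g. g \<in> S \<and> supp (h x) \<subseteq> l_coset G g ` proj ` C1 \<and>
            (x \<in> cube_boundary ?m \<longrightarrow> supp (f1 x) \<subseteq> (\<otimes>) g ` C1)"
        proof
          fix x assume x: "x \<in> cube ?m"
          show "\<exists>g. g \<in> S \<and> supp (h x) \<subseteq> l_coset G g ` proj ` C1 \<and>
            (x \<in> cube_boundary ?m \<longrightarrow> supp (f1 x) \<subseteq> (\<otimes>) g ` C1)"
          proof (cases "x \<in> cube_boundary ?m")
            case True
            obtain g where g: "g \<in> S" "supp (f1 x) \<subseteq> (\<otimes>) g ` C"
              using f1(2)[OF True] by (auto simp: in_translate_def)
            then have sub: "supp (f1 x) \<subseteq> (\<otimes>) g ` C1"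
              using C1(2) by blast
            have "supp (h x) = proj ` supp (f1 x)"
              using hb[OF True] supp_vertex_map[OF f1p[OF True]] by simp
            also have "\<dots> \<subseteq> proj ` (\<otimes>) g ` C1"
              using sub by (rule image_mono)
            finally have "supp (h x) \<subseteq> l_coset G g ` proj ` C1"
              unfolding translate_proj[OF C1(1) S_in[OF g(1)]] .
            then show ?thesis
              using g(1) sub by blast
          next
            case False
            obtain g where "g \<in> S" "supp (h x) \<subseteq> l_coset G g ` F'"
              using h(2)[OF x] by (auto simp: in_translate_def)
            then show ?thesis
              using C1(3) False by blast
          qed
        qed
        from bchoice[OF this] obtain \<gamma> where
          \<gamma>0: "\<forall>x\<in>cube ?m. \<gamma> x \<in> S \<and> supp (h x) \<subseteq> l_coset G (\<gamma> x) ` proj ` C1 \<and>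
            (x \<in> cube_boundary ?m \<longrightarrow> supp (f1 x) \<subseteq> (\<otimes>) (\<gamma> x) ` C1)" ..
        have \<gamma>: "\<And>x. x \<in> cube ?m \<Longrightarrow> \<gamma> x \<in> S"
          "\<And>x. x \<in> cube ?m \<Longrightarrow> supp (h x) \<subseteq> l_coset G (\<gamma> x) ` proj ` C1"
          "\<And>x. x \<in> cube ?m \<Longrightarrow> x \<in> cube_boundary ?m \<Longrightarrow> supp (f1 x) \<subseteq> (\<otimes>) (\<gamma> x) ` C1"
          using \<gamma>0 by simp_all
        have bs: "cube_boundary ?m \<subseteq> cube ?m"
          by (auto simp: cube_boundary_def)
        show ?thesis
        proof (rule fine_grid[OF compact_cube h(1)])
          fix N assume N: "0 < N" and fine: "\<And>R. R \<noteq> {} \<Longrightarrow> R \<subseteq> cube ?m \<Longrightarrow> small N R \<Longrightarrow>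
            \<exists>v. \<forall>x\<in>R. v \<in> supp (h x)"
          have "\<exists>F. continuous_map (top_of_set (cube ?m)) points F \<and> (\<forall>x\<in>cube_boundary ?m. F x = f1 x) \<and>
              (\<forall>x\<in>cube ?m. near (\<gamma> x) D (supp (F x)))"
          proof (rule lift[OF N cellular_cube[OF N] cellular_cube_boundary[OF N] bs])
            show "cell_dim Q \<le> n" if "Q \<in> cells ?m N" for Q
              using cell_dim_le[OF N that] k by simp
            show "\<gamma> x \<in> carrier G" if "x \<in> cube ?m" for x
              using \<gamma>(1)[OF that] by (rule S_in)
            show "continuous_map (top_of_set (cube_boundary ?m)) points f1"
              by (rule f1(1))
            show "supp (f1 x) \<subseteq> (\<otimes>) (\<gamma> x) ` C1" if "x \<in> cube_boundary ?m" for x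
              using \<gamma>(3) that bs by blast
            show "meets C1 (\<gamma> x) (\<gamma> y)" if Q: "Q \<in> cells ?m N" "Q \<subseteq> cube ?m" "x \<in> Q" "y \<in> Q" for Q x y
            proof -
              have xy: "x \<in> cube ?m" "y \<in> cube ?m"
                using Q by auto
              obtain v where "v \<in> supp (h x)" "v \<in> supp (h y)"
                using fine[OF _ Q(2) small_cell[OF N Q(1)]] Q(3,4) by blast
              then have "v \<in> l_coset G (\<gamma> x) ` proj ` C1" "v \<in> l_coset G (\<gamma> y) ` proj ` C1"
                using \<gamma>(2)[OF xy(1)] \<gamma>(2)[OF xy(2)] by blast+
              then show ?thesis
                by (rule meetsI[OF C1(1) S_in[OF \<gamma>(1)[OF xy(1)]] S_in[OF \<gamma>(1)[OF xy(2)]]])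
            qed
          qed
          then obtain F where F: "continuous_map (top_of_set (cube ?m)) points F"
            "\<And>x. x \<in> cube_boundary ?m \<Longrightarrow> F x = f1 x" "\<And>x. x \<in> cube ?m \<Longrightarrow> near (\<gamma> x) D (supp (F x))"
            by auto
          have "upstairs (C \<union> D) (supp (F x))" if "x \<in> cube ?m" for x
            using near_upstairs[OF F(3)[OF that] \<gamma>(1)[OF that] D] by (rule in_translate_mono) simp
          then have "continuous_map (top_of_set (cube ?m)) (model (upstairs (C \<union> D))) F"
            unfolding continuous_map_into_model[OF herU] using F(1) by simp
          from null_homotopic_from_cube[OF this]
          have "homotopic_with (\<lambda>_. True) (nsphere k) (model (upstairs (C \<union> D))) (F \<circ> to_cube k) (\<lambda>_. F sphere_base)"
            by (rule homotopic_with_mono) simp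
          then have "homotopic_with (\<lambda>_. True) (nsphere k) (model (upstairs (C \<union> D))) f (\<lambda>_. F sphere_base)"
            by (rule homotopic_with_eq) (auto simp: nsphere_eq F(2) to_cube_in f1c)
          then show ?thesis
            by blast
        qed
      qed
    qed
    then show ?thesis
      using compactin_Un[OF C D] by blast
  qed
qed

text \<open>Only the cube boundary is lifted, and its cells have dimension at most k; hence k \<le>
  n suffices. Over a small set, \<open>f1\<close> and the projected lift use vertices of one single
  translate of a compact set, so \<open>homotopic_small_carriers\<close> connects the two
  maps.\<close>

lemma sphere_null_downstairs:
  assumes k: "k \<le> n" and F: "compactin cosets F"
    and up: "\<And>C. compactin T C \<Longrightarrow> \<exists>C'. compactin T C' \<and> C \<subseteq> C' \<and>
       sphere_null k (model (upstairs C)) (model (upstairs C'))"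
  shows "\<exists>F'. compactin cosets F' \<and> F \<subseteq> F' \<and> sphere_null k (model (downstairs F)) (model (downstairs F'))"
proof -
  note herU = hereditary_in_translate[of "(\<otimes>)" S]
  note herD = hereditary_in_translate[of "l_coset G" S]
  obtain C1 where C1: "compactin T C1" "F \<subseteq> proj ` C1"
    using compact_lift[OF F] by blast
  have "\<exists>E. compactin T E \<and> (\<forall>g g' \<nu>. g \<in> carrier G \<longrightarrow> g' \<in> carrier G \<longrightarrow> meets C1 g g' \<longrightarrow> \<nu> \<in> \<Lambda> \<longrightarrow>
       (\<exists>\<nu>'\<in>\<Lambda>. \<exists>x\<in>E. g' \<otimes> \<nu> = g \<otimes> (\<nu>' \<otimes> x)))"
    by (rule transition[OF C1(1)]) blast
  then obtain E where E: "compactin T E"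
    "\<And>g g' \<nu>. g \<in> carrier G \<Longrightarrow> g' \<in> carrier G \<Longrightarrow> meets C1 g g' \<Longrightarrow> \<nu> \<in> \<Lambda> \<Longrightarrow>
       \<exists>\<nu>'\<in>\<Lambda>. \<exists>x\<in>E. g' \<otimes> \<nu> = g \<otimes> (\<nu>' \<otimes> x)"
    by auto
  show ?thesis
  proof (rule lifting[OF C1(1)])
    fix D assume D: "compactin T D" and lift:
      "\<And>d N S S0 \<gamma> f. \<lbrakk>0 < N; cellular d N S; cellular d N S0; S0 \<subseteq> S;
       \<And>Q. Q \<in> cells d N \<Longrightarrow> Q \<subseteq> S \<Longrightarrow> cell_dim Q \<le> n;
       \<And>x. x \<in> S \<Longrightarrow> \<gamma> x \<in> carrier G;
       \<And>Q x y. Q \<in> cells d N \<Longrightarrow> Q \<subseteq> S \<Longrightarrow> x \<in> Q \<Longrightarrow> y \<in> Q \<Longrightarrow> meets C1 (\<gamma> x) (\<gamma> y);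
       continuous_map (top_of_set S0) points f;
       \<And>x. x \<in> S0 \<Longrightarrow> supp (f x) \<subseteq> (\<otimes>) (\<gamma> x) ` C1\<rbrakk>
     \<Longrightarrow> \<exists>F. continuous_map (top_of_set S) points F \<and> (\<forall>x\<in>S0. F x = f x) \<and> (\<forall>x\<in>S. near (\<gamma> x) D (supp (F x)))"
    obtain C' where C': "compactin T C'" "sphere_null k (model (upstairs D)) (model (upstairs C'))"
      using up[OF D] by blast
    \<comment> \<open>\<open>C1\<close> accounts for the vertices of the given sphere,
      \<open>D\<close> for those of its lift; the factor \<open>E\<close> moves both to the centre
      of one common point of a small set.\<close>
    define B where "B = E <#> (C1 \<union> D)"
    have B: "compactin T B"
      unfolding B_def by (intro compact_set_mult compactin_Un E(1) C1(1) D)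
    have "\<exists>B'. compactin T B' \<and> (\<forall>g s. g \<in> carrier G \<longrightarrow> near g B s \<longrightarrow> proj ` s \<subseteq> l_coset G g ` proj ` B')"
      by (rule compact_near_proj[OF B]) blast
    then obtain B' where B': "compactin T B'"
      "\<And>g s. g \<in> carrier G \<Longrightarrow> near g B s \<Longrightarrow> proj ` s \<subseteq> l_coset G g ` proj ` B'"
      by auto
    define F' where "F' = F \<union> proj ` B' \<union> proj ` C'"
    have F': "compactin cosets F'"
      unfolding F'_def by (intro compactin_Un F compact_proj B'(1) C'(1))
    have "sphere_null k (model (downstairs F)) (model (downstairs F'))"
      unfolding sphere_null_def
    proof (intro allI impI)
      fix f assume f: "continuous_map (nsphere k) (model (downstairs F)) f"
      let ?m = "Suc k"
      define f1 where "f1 = f \<circ> to_sphere k"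
      have "continuous_map (top_of_set (cube_boundary ?m)) (model (downstairs F)) f1"
        unfolding f1_def using continuous_map_to_sphere f by (rule continuous_map_compose)
      then have f1: "continuous_map (top_of_set (cube_boundary ?m)) points f1"
        "\<And>x. x \<in> cube_boundary ?m \<Longrightarrow> downstairs F (supp (f1 x))"
        by (auto simp: continuous_map_into_model[OF herD])
      have f1c: "f1 (to_cube k x) = f x" if "x \<in> sphere_set k" for x
        using to_sphere_to_cube[OF that] by (simp add: f1_def)
      have "\<forall>x\<in>cube_boundary ?m. \<exists>g. g \<in> S \<and> supp (f1 x) \<subseteq> l_coset G g ` proj ` C1"
      proof
        fix x assume x: "x \<in> cube_boundary ?m"
        obtain g where "g \<in> S" "supp (f1 x) \<subseteq> l_coset G g ` F"
          using f1(2)[OF x] by (auto simp: in_translate_def)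
        then show "\<exists>g. g \<in> S \<and> supp (f1 x) \<subseteq> l_coset G g ` proj ` C1"
          using C1(2) by blast
      qed
      from bchoice[OF this] obtain \<gamma> where
        \<gamma>0: "\<forall>x\<in>cube_boundary ?m. \<gamma> x \<in> S \<and> supp (f1 x) \<subseteq> l_coset G (\<gamma> x) ` proj ` C1" ..
      have \<gamma>: "\<And>x. x \<in> cube_boundary ?m \<Longrightarrow> \<gamma> x \<in> S"
        "\<And>x. x \<in> cube_boundary ?m \<Longrightarrow> supp (f1 x) \<subseteq> l_coset G (\<gamma> x) ` proj ` C1"
        using \<gamma>0 by simp_all
      have \<gamma>c: "\<gamma> x \<in> carrier G" if "x \<in> cube_boundary ?m" for x
        using \<gamma>(1)[OF that] by (rule S_in)
      show "\<exists>c. homotopic_with (\<lambda>_. True) (nsphere k) (model (downstairs F')) f (\<lambda>_. c)"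
      proof (rule fine_grid[OF compact_cube_boundary f1(1)])
        fix N assume N: "0 < N" and fine: "\<And>R. R \<noteq> {} \<Longrightarrow> R \<subseteq> cube_boundary ?m \<Longrightarrow> small N R \<Longrightarrow>
          \<exists>v. \<forall>x\<in>R. v \<in> supp (f1 x)"
        have meet: "meets C1 (\<gamma> x) (\<gamma> y)"
          if R: "R \<subseteq> cube_boundary ?m" "small N R" "x \<in> R" "y \<in> R" for R x y
        proof -
          have xy: "x \<in> cube_boundary ?m" "y \<in> cube_boundary ?m"
            using R by auto
          obtain v where "v \<in> supp (f1 x)" "v \<in> supp (f1 y)"
            using fine[OF _ R(1,2)] R(3,4) by blast
          then have "v \<in> l_coset G (\<gamma> x) ` proj ` C1" "v \<in> l_coset G (\<gamma> y) ` proj ` C1"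
            using \<gamma>(2)[OF xy(1)] \<gamma>(2)[OF xy(2)] by blast+
          then show ?thesis
            by (rule meetsI[OF C1(1) \<gamma>c[OF xy(1)] \<gamma>c[OF xy(2)]])
        qed
        have "\<exists>L. continuous_map (top_of_set (cube_boundary ?m)) points L \<and> (\<forall>x\<in>{}. L x = vertex_point \<one>) \<and>
            (\<forall>x\<in>cube_boundary ?m. near (\<gamma> x) D (supp (L x)))"
        \<comment> \<open>Nothing is prescribed, so \<open>S0\<close> is empty and
          \<open>vertex_point \<one>\<close> is a placeholder.\<close>
        proof (rule lift[OF N cellular_cube_boundary[OF N], where ?S0.0 = "{}"])
          show "cell_dim Q \<le> n" if "Q \<in> cells ?m N" "Q \<subseteq> cube_boundary ?m" for Q
            using cell_dim_boundary[OF N that] k by simp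
          show "meets C1 (\<gamma> x) (\<gamma> y)"
            if "Q \<in> cells ?m N" "Q \<subseteq> cube_boundary ?m" "x \<in> Q" "y \<in> Q" for Q x y
            using meet[OF that(2) small_cell[OF N that(1)] that(3,4)] .
          show "cellular ?m N {}"
            by (simp add: cellular_def)
        qed (auto intro: \<gamma>c)
        then obtain L where L: "continuous_map (top_of_set (cube_boundary ?m)) points L"
          "\<And>x. x \<in> cube_boundary ?m \<Longrightarrow> near (\<gamma> x) D (supp (L x))"
          by auto
        have Lp: "L x \<in> topspace points" if "x \<in> cube_boundary ?m" for x
          using L(1) that by (force simp: continuous_map_def)
        have "continuous_map (top_of_set (cube_boundary ?m)) (model (upstairs D)) L"
          unfolding continuous_map_into_model[OF herU] using L(1) near_upstairs[OF L(2) \<gamma>(1) D] by simp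
        from continuous_map_compose[OF continuous_map_to_cube this]
        obtain c where c: "homotopic_with (\<lambda>_. True) (nsphere k) (model (upstairs C')) (L \<circ> to_cube k) (\<lambda>_. c)"
          using C'(2) unfolding sphere_null_def by blast
        have "continuous_map (model (upstairs C')) (model (downstairs F')) (vertex_map proj)"
          unfolding continuous_map_into_model[OF herD]
        proof
          show "continuous_map (model (upstairs C')) points (vertex_map proj)"
            unfolding model_eq_subtopology[OF herU]
            by (rule continuous_map_from_subtopology[OF continuous_map_vertex_map])
          show "\<forall>l\<in>topspace (model (upstairs C')). downstairs F' (supp (vertex_map proj l))"
          proof
            fix l assume "l \<in> topspace (model (upstairs C'))"
            then have l: "l \<in> topspace points" "upstairs C' (supp l)"
              by (auto simp: topspace_model_eq[OF herU])
            have "downstairs (proj ` C') (supp (vertex_map proj l))"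
              using upstairs_proj[OF l(2) C'(1)] by (simp add: supp_vertex_map[OF l(1)])
            then show "downstairs F' (supp (vertex_map proj l))"
              by (rule in_translate_mono) (simp add: F'_def)
          qed
        qed
        from homotopic_with_compose_continuous_map_left[OF c this, of "\<lambda>_. True"]
        have h2: "homotopic_with (\<lambda>_. True) (nsphere k) (model (downstairs F'))
            (vertex_map proj \<circ> (L \<circ> to_cube k)) (vertex_map proj \<circ> (\<lambda>_. c))"
          by simp
        have "homotopic_with (\<lambda>_. True) (top_of_set (cube_boundary ?m)) (model (downstairs F')) f1 (vertex_map proj \<circ> L)"
        proof (rule homotopic_small_carriers[OF f1(1) continuous_map_compose[OF L(1) continuous_map_vertex_map] herD N])
          fix R assume R: "R \<noteq> {}" "R \<subseteq> cube_boundary ?m" "small N R"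
          then obtain x0 where x0: "x0 \<in> R"
            by blast
          then have x0b: "x0 \<in> cube_boundary ?m"
            using R(2) by blast
          \<comment> \<open>All points of the small set are compared with the one element \<gamma>
            x0, so that a single translate contains all vertices over the set.\<close>
          have "supp (f1 x) \<union> supp ((vertex_map proj \<circ> L) x) \<subseteq> l_coset G (\<gamma> x0) ` proj ` B'" if x: "x \<in> R" for x
          proof -
            have xb: "x \<in> cube_boundary ?m"
              using x R(2) by blast
            have m: "meets C1 (\<gamma> x0) (\<gamma> x)"
              using R(2,3) x0 x by (rule meet)
            have tr: "near (\<gamma> x0) (E <#> X) s" if "compactin T X" "near (\<gamma> x) X s" for X s
              by (rule near_transition[where g' = "\<gamma> x" and B = X])
                (fact E(1) that \<gamma>c[OF x0b] \<gamma>c[OF xb] | rule E(2)[OF \<gamma>c[OF x0b] \<gamma>c[OF xb] m], assumption)+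
            have step: "proj ` s \<subseteq> l_coset G (\<gamma> x0) ` proj ` B'"
              if "near (\<gamma> x) (C1 \<union> D) s" for s
            proof -
              have "near (\<gamma> x0) B s"
                unfolding B_def using compactin_Un[OF C1(1) D] that by (rule tr)
              with \<gamma>c[OF x0b] show ?thesis
                by (rule B'(2))
            qed
            have "C1 \<subseteq> carrier G"
              using compact_in[OF C1(1)] by blast
            then have "near (\<gamma> x) C1 ((\<otimes>) (\<gamma> x) ` C1)"
              by (rule near_one[OF subset_refl])
            then have "near (\<gamma> x) (C1 \<union> D) ((\<otimes>) (\<gamma> x) ` C1)"
              by (rule near_mono) simp
            then have "proj ` (\<otimes>) (\<gamma> x) ` C1 \<subseteq> l_coset G (\<gamma> x0) ` proj ` B'"
              by (rule step)
            then have "supp (f1 x) \<subseteq> l_coset G (\<gamma> x0) ` proj ` B'"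
              unfolding translate_proj[OF C1(1) \<gamma>c[OF xb]] using \<gamma>(2)[OF xb] by (rule order_trans[rotated])
            moreover have "near (\<gamma> x) (C1 \<union> D) (supp (L x))"
              using L(2)[OF xb] by (rule near_mono) simp
            then have "proj ` supp (L x) \<subseteq> l_coset G (\<gamma> x0) ` proj ` B'"
              by (rule step)
            ultimately show ?thesis
              unfolding o_apply supp_vertex_map[OF Lp[OF xb]] by (rule Un_least)
          qed
          then have "(\<Union>x\<in>R. supp (f1 x) \<union> supp ((vertex_map proj \<circ> L) x)) \<subseteq> l_coset G (\<gamma> x0) ` proj ` B'"
            by (rule UN_least)
          also have "\<dots> \<subseteq> l_coset G (\<gamma> x0) ` F'"
            by (rule image_mono) (simp add: F'_def le_supI1)
          finally have "(\<Union>x\<in>R. supp (f1 x) \<union> supp ((vertex_map proj \<circ> L) x)) \<subseteq> l_coset G (\<gamma> x0) ` F'" .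
          then show "downstairs F' (\<Union>x\<in>R. supp (f1 x) \<union> supp ((vertex_map proj \<circ> L) x))"
            unfolding in_translate_def using \<gamma>(1)[OF x0b] by (rule bexI)
        qed
        from homotopic_with_compose_continuous_map_right[OF this continuous_map_to_cube, of "\<lambda>_. True"]
        have "homotopic_with (\<lambda>_. True) (nsphere k) (model (downstairs F')) (f1 \<circ> to_cube k) (vertex_map proj \<circ> L \<circ> to_cube k)"
          by simp
        then have "homotopic_with (\<lambda>_. True) (nsphere k) (model (downstairs F')) f (vertex_map proj \<circ> (L \<circ> to_cube k))"
          by (rule homotopic_with_eq) (auto simp: nsphere_eq f1c)
        from homotopic_with_trans[OF this h2]
        have "homotopic_with (\<lambda>_. True) (nsphere k) (model (downstairs F')) f (\<lambda>_. vertex_map proj c)"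
          by (simp add: o_def)
        then show ?thesis
          by blast
      qed
    qed
    then show ?thesis
      using F' by (intro exI[of _ F']) (auto simp: F'_def)
  qed
qed

end

theorem proposition5p3:
  fixes \<Gamma> :: "('a, 'b) monoid_scheme"
    and T :: "'a topology"
    and \<Lambda> :: "'a set"
    and n :: nat
    and chi :: "'a \<Rightarrow> real"
  assumes "locally_compact_Hausdorff_group \<Gamma> T"
    and "subgroup \<Lambda> \<Gamma>"
    and "closedin T \<Lambda>"
    and "almost_commutes_with_compacts \<Gamma> T \<Lambda>"
    and "character \<Gamma> T chi"
    and "\<And>x. x \<in> \<Lambda> \<Longrightarrow> chi x = 0"
    and "type_C n (\<Gamma>\<lparr>carrier := \<Lambda>\<rparr>) (subtopology T \<Lambda>)"
  shows "(\<forall>k::nat. k \<le> n \<longrightarrow>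
            essentially_connected (int k - 1)
              (simplicial_E (topspace (coset_space \<Gamma> T \<Lambda>)))
              (compacts (coset_space \<Gamma> T \<Lambda>))
              (translates_E (l_coset \<Gamma>) (nonneg_part \<Gamma> chi)) \<longrightarrow>
            chi \<in> Sigma_top k \<Gamma> T)
       \<and> (\<forall>k::nat. k \<le> n + 1 \<longrightarrow>
            chi \<in> Sigma_top k \<Gamma> T \<longrightarrow>
            essentially_connected (int k - 1)
              (simplicial_E (topspace (coset_space \<Gamma> T \<Lambda>)))
              (compacts (coset_space \<Gamma> T \<Lambda>))
              (translates_E (l_coset \<Gamma>) (nonneg_part \<Gamma> chi)))"
proof -
  interpret topological_group \<Gamma> T
    using assms(1) by (simp add: locally_compact_Hausdorff_group_def)
  interpret character_setting \<Gamma> T \<Lambda> n chi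
    by (intro character_setting.intro type_C_subgroup.intro commuting_subgroup.intro
        commuting_subgroup_axioms.intro type_C_subgroup_axioms.intro character_setting_axioms.intro)
      (use assms in \<open>simp_all add: locally_compact_Hausdorff_group_def\<close>)
  show ?thesis
  proof (intro conjI allI impI)
    fix k assume k: "k \<le> n" and down: "essentially_connected (int k - 1) (simplicial_E (topspace cosets))
      (compacts cosets) (translates_E (l_coset \<Gamma>) S)"
    show "chi \<in> Sigma_top k \<Gamma> T"
      unfolding Sigma_iff
    proof (intro allI impI)
      fix j C assume j: "j < k" and C: "compactin T C"
      show "\<exists>C'. compactin T C' \<and> C \<subseteq> C' \<and> sphere_null j (model (upstairs C)) (model (upstairs C'))"
        using j k C down[unfolded downstairs_iff] by (intro sphere_null_upstairs) simp_all
    qed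
  next
    fix k assume k: "k \<le> n + 1" and up: "chi \<in> Sigma_top k \<Gamma> T"
    show "essentially_connected (int k - 1) (simplicial_E (topspace cosets))
      (compacts cosets) (translates_E (l_coset \<Gamma>) S)"
      unfolding downstairs_iff
    proof (intro allI impI)
      fix j F assume j: "j < k" and F: "compactin cosets F"
      show "\<exists>F'. compactin cosets F' \<and> F \<subseteq> F' \<and> sphere_null j (model (downstairs F)) (model (downstairs F'))"
        using j k F up[unfolded Sigma_iff] by (intro sphere_null_downstairs) simp_all
    qed
  qed
qed

end
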